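(* Let $k$ be a field and let $A/B$ be an extension of $k$-algebras such that $B$ is a separable $k$-algebra. Then for every $(A,A)$-bimodule $M$ we have $$\mathrm{HH}_*(A/B,M)\simeq\mathrm{HH}_*(A,M)\qquad\text{and}\qquad\mathrm{HC}_*(A/B)\simeq\mathrm{HC}_*(A),$$ where $\mathrm{HH}_*(A,M)$ and $\mathrm{HC}_*(A)$ are the usual Hochschild homology and cyclic homology of the $k$-algebra $A$ (i.e. of the extension $A/k$).
   Context: $A/B$ denotes a $k$-algebra $A$ with subalgebra $B$. For a $(B,B)$-bimodule $X$, $[X,B]$ is the subspace spanned by all $xb-bx$ and $X_B:=X/[X,B]$; $M\widehat\otimes_BA^{\otimes_Bn}:=(M\otimes_BA^{\otimes_Bn})_B$. $B$ is separable over $k$ if the multiplication $B\otimes_kB\to B$ has a section as a map of $(B,B)$-bimodules. $Z_*(A/B,M)$ is the simplicial object with $Z_n=M\widehat\otimes_BA^{\otimes_Bn}$, faces $d_0(m\widehat\otimes_Ba^1\widehat\otimes_B\cdots\widehat\otimes_Ba^n)=ma^1\widehat\otimes_Ba^2\widehat\otimes_B\cdots\widehat\otimes_Ba^n$, $d_i$ multiplying $a^i$ and $a^{i+1}$ for $0<i<n$, $d_n(m\widehat\otimes_Ba^1\widehat\otimes_B\cdots\widehat\otimes_Ba^n)=a^nm\widehat\otimes_Ba^1\widehat\otimes_B\cdots\widehat\otimes_Ba^{n-1}$, and degeneracies $s_i$ inserting $1$ after the $i$-th entry ($m$ being the $0$-th). $\mathrm{HH}_*(A/B,M)$ is the homology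 of the associated complex (differential $\sum(-1)^id_i$). For $M=A$ it is a cyclic object with $t_n(a^0\widehat\otimes_B\cdots\widehat\otimes_Ba^n)=a^n\widehat\otimes_Ba^0\widehat\otimes_B\cdots\widehat\otimes_Ba^{n-1}$, and $\mathrm{HC}_*(A/B)$ is its cyclic homology (homology of the total complex of the Tsygan double complex). *)

theory Defs
  imports Complex_Main "HOL-Library.Poly_Mapping" "HOL-Library.FuncSet"
begin

section \<open>Vector spaces on a carrier set\<close>

text \<open>
  Quotients whose defining data vary cannot be types, so the spaces built below are records
  with an explicit carrier; the field of scalars is the whole type \<open>'k\<close>.
\<close>

record ('k, 'v) vspace =
  vcarrier :: "'v set"
  vadd :: "'v \<Rightarrow> 'v \<Rightarrow> 'v"
  vzero :: 'v
  vscale :: "'k \<Rightarrow> 'v \<Rightarrow> 'v"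

definition vs_subspace :: "('k, 'v) vspace \<Rightarrow> 'v set \<Rightarrow> bool" where
  "vs_subspace V W \<longleftrightarrow> W \<subseteq> vcarrier V \<and> vzero V \<in> W \<and>
     (\<forall>x\<in>W. \<forall>y\<in>W. vadd V x y \<in> W) \<and> (\<forall>c. \<forall>x\<in>W. vscale V c x \<in> W)"

definition vs_span :: "('k, 'v) vspace \<Rightarrow> 'v set \<Rightarrow> 'v set" where
  "vs_span V S = vs_subspace V hull S"

definition vs_diff :: "('k::field, 'v) vspace \<Rightarrow> 'v \<Rightarrow> 'v \<Rightarrow> 'v" where
  "vs_diff V x y = vadd V x (vscale V (- 1) y)"

primrec vs_sum :: "('k, 'v) vspace \<Rightarrow> (nat \<Rightarrow> 'v) \<Rightarrow> nat \<Rightarrow> 'v" where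
  "vs_sum V f 0 = vzero V"
| "vs_sum V f (Suc n) = vadd V (vs_sum V f n) (f n)"

definition vs_coset :: "('k, 'v) vspace \<Rightarrow> 'v set \<Rightarrow> 'v \<Rightarrow> 'v set" where
  "vs_coset V W x = {vadd V x w | w. w \<in> W}"

definition vs_quot :: "('k, 'v) vspace \<Rightarrow> 'v set \<Rightarrow> ('k, 'v set) vspace" where
  "vs_quot V W =
    \<lparr> vcarrier = vs_coset V W ` vcarrier V,
      vadd = (\<lambda>X Y. {vadd V x y | x y. x \<in> X \<and> y \<in> Y}),
      vzero = W,
      vscale = (\<lambda>c X. {vadd V (vscale V c x) w | x w. x \<in> X \<and> w \<in> W}) \<rparr>"

definition vs_iso :: "('k, 'v) vspace \<Rightarrow> ('k, 'w) vspace \<Rightarrow> bool" where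
  "vs_iso V W \<longleftrightarrow> (\<exists>f. bij_betw f (vcarrier V) (vcarrier W) \<and>
     (\<forall>x\<in>vcarrier V. \<forall>y\<in>vcarrier V. f (vadd V x y) = vadd W (f x) (f y)) \<and>
     (\<forall>c. \<forall>x\<in>vcarrier V. f (vscale V c x) = vscale W c (f x)))"

definition vs_free :: "'g set \<Rightarrow> ('k::field, 'g \<Rightarrow>\<^sub>0 'k) vspace" where
  "vs_free G =
    \<lparr> vcarrier = {x. Poly_Mapping.keys x \<subseteq> G},
      vadd = (+),
      vzero = 0,
      vscale = (\<lambda>c. Poly_Mapping.map ((*) c)) \<rparr>"

definition lin_ext :: "('g \<Rightarrow> 'h) \<Rightarrow> ('g \<Rightarrow>\<^sub>0 'k::field) \<Rightarrow> ('h \<Rightarrow>\<^sub>0 'k)" where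
  "lin_ext g x = (\<Sum>p\<in>Poly_Mapping.keys x. Poly_Mapping.single (g p) (Poly_Mapping.lookup x p))"


section \<open>Algebras, bimodules and tensor products\<close>

text \<open>
  The sort \<open>{ring, monoid_mult}\<close> is that of unital, not necessarily commutative rings, the zero
  ring included (unlike \<open>ring_1\<close>).
\<close>

locale k_algebra = vector_space sA
  for sA :: "'k::field \<Rightarrow> 'a::{ring, monoid_mult} \<Rightarrow> 'a" +
  assumes scale_mult_left: "sA c a * b = sA c (a * b)"
    and scale_mult_right: "a * sA c b = sA c (a * b)"

definition subalgebra :: "('k::field \<Rightarrow> 'a::{ring, monoid_mult} \<Rightarrow> 'a) \<Rightarrow> 'a set \<Rightarrow> bool" where
  "subalgebra sA B \<longleftrightarrow> module.subspace sA B \<and> 1 \<in> B \<and> (\<forall>a\<in>B. \<forall>b\<in>B. a * b \<in> B)"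

definition ground :: "('k::field \<Rightarrow> 'a::{ring, monoid_mult} \<Rightarrow> 'a) \<Rightarrow> 'a set" where
  "ground sA = range (\<lambda>c. sA c 1)"

text \<open>Bimodules over a \<open>k\<close>-algebra are \<open>k\<close>-spaces on which \<open>k\<close> acts in the same way from both sides.\<close>

locale k_bimodule = k_algebra sA + M: vector_space sM
  for sA :: "'k::field \<Rightarrow> 'a::{ring, monoid_mult} \<Rightarrow> 'a"
    and sM :: "'k \<Rightarrow> 'm::ab_group_add \<Rightarrow> 'm" +
  fixes l :: "'a \<Rightarrow> 'm \<Rightarrow> 'm" and r :: "'m \<Rightarrow> 'a \<Rightarrow> 'm"
  assumes l_add_left: "l (a + b) m = l a m + l b m"
    and l_add_right: "l a (m + m') = l a m + l a m'"
    and l_mult: "l (a * b) m = l a (l b m)"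
    and l_one: "l 1 m = m"
    and l_scale_left: "l (sA c a) m = sM c (l a m)"
    and l_scale_right: "l a (sM c m) = sM c (l a m)"
    and r_add_left: "r (m + m') a = r m a + r m' a"
    and r_add_right: "r m (a + b) = r m a + r m b"
    and r_mult: "r m (a * b) = r (r m a) b"
    and r_one: "r m 1 = m"
    and r_scale_left: "r (sM c m) a = sM c (r m a)"
    and r_scale_right: "r m (sA c a) = sM c (r m a)"
    and l_r: "r (l a m) b = l a (r m b)"

text \<open>
  The tensor product \<open>X \<otimes>\<^sub>B Y \<otimes>\<^sub>B \<dots> \<otimes>\<^sub>B Y\<close> with \<open>n\<close> factors \<open>Y\<close> is the space generated by
  the tuples \<open>(m, [a\<^sub>1, \<dots>, a\<^sub>n])\<close>, modulo multilinearity and \<open>B\<close>-balancedness. Carrier sets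
  \<open>X\<close> and \<open>Y\<close> are needed because \<open>B \<otimes>\<^sub>k B\<close> is an instance; bimodules are whole types.
\<close>

definition tens_gens :: "'m set \<Rightarrow> 'a set \<Rightarrow> nat \<Rightarrow> ('m \<times> 'a list) set" where
  "tens_gens X Y n = {(m, as). m \<in> X \<and> set as \<subseteq> Y \<and> length as = n}"

abbreviation pure :: "'m \<Rightarrow> 'a list \<Rightarrow> ('m \<times> 'a list \<Rightarrow>\<^sub>0 'k::field)" where
  "pure m as \<equiv> Poly_Mapping.single (m, as) 1"

definition tens_rels ::
  "('k::field \<Rightarrow> 'a::{ring, monoid_mult} \<Rightarrow> 'a) \<Rightarrow> ('k \<Rightarrow> 'm::ab_group_add \<Rightarrow> 'm) \<Rightarrow>
   ('m \<Rightarrow> 'a \<Rightarrow> 'm) \<Rightarrow> 'm set \<Rightarrow> 'a set \<Rightarrow> 'a set \<Rightarrow> nat \<Rightarrow> ('m \<times> 'a list \<Rightarrow>\<^sub>0 'k) set" where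
  "tens_rels sA sM r X Y B n =
     {pure (m + m') as - pure m as - pure m' as | m m' as.
        m \<in> X \<and> m' \<in> X \<and> set as \<subseteq> Y \<and> length as = n} \<union>
     {pure (sM c m) as - Poly_Mapping.single (m, as) c | c m as.
        m \<in> X \<and> set as \<subseteq> Y \<and> length as = n} \<union>
     {pure m (xs @ (a + a') # ys) - pure m (xs @ a # ys) - pure m (xs @ a' # ys) | m xs a a' ys.
        m \<in> X \<and> set xs \<union> {a, a'} \<union> set ys \<subseteq> Y \<and> length xs + 1 + length ys = n} \<union>
     {pure m (xs @ sA c a # ys) - Poly_Mapping.single (m, xs @ a # ys) c | c m xs a ys.
        m \<in> X \<and> set xs \<union> {a} \<union> set ys \<subseteq> Y \<and> length xs + 1 + length ys = n} \<union>
     {pure (r m b) (a # as) - pure m ((b * a) # as) | b m a as.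
        b \<in> B \<and> m \<in> X \<and> {a} \<union> set as \<subseteq> Y \<and> 1 + length as = n} \<union>
     {pure m (xs @ (a * b) # a' # ys) - pure m (xs @ a # (b * a') # ys) | b m xs a a' ys.
        b \<in> B \<and> m \<in> X \<and> set xs \<union> {a, a'} \<union> set ys \<subseteq> Y \<and> length xs + 2 + length ys = n}"

definition tens_free ::
  "'m set \<Rightarrow> 'a set \<Rightarrow> nat \<Rightarrow> ('k::field, 'm \<times> 'a list \<Rightarrow>\<^sub>0 'k) vspace" where
  "tens_free X Y n = vs_free (tens_gens X Y n)"

definition tens_ker ::
  "('k::field \<Rightarrow> 'a::{ring, monoid_mult} \<Rightarrow> 'a) \<Rightarrow> ('k \<Rightarrow> 'm::ab_group_add \<Rightarrow> 'm) \<Rightarrow>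
   ('m \<Rightarrow> 'a \<Rightarrow> 'm) \<Rightarrow> 'm set \<Rightarrow> 'a set \<Rightarrow> 'a set \<Rightarrow> nat \<Rightarrow> ('m \<times> 'a list \<Rightarrow>\<^sub>0 'k) set" where
  "tens_ker sA sM r X Y B n = vs_span (tens_free X Y n) (tens_rels sA sM r X Y B n)"

definition tens_class ::
  "('k::field \<Rightarrow> 'a::{ring, monoid_mult} \<Rightarrow> 'a) \<Rightarrow> ('k \<Rightarrow> 'm::ab_group_add \<Rightarrow> 'm) \<Rightarrow>
   ('m \<Rightarrow> 'a \<Rightarrow> 'm) \<Rightarrow> 'm set \<Rightarrow> 'a set \<Rightarrow> 'a set \<Rightarrow> nat \<Rightarrow>
   ('m \<times> 'a list \<Rightarrow>\<^sub>0 'k) \<Rightarrow> ('m \<times> 'a list \<Rightarrow>\<^sub>0 'k) set" where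
  "tens_class sA sM r X Y B n = vs_coset (tens_free X Y n) (tens_ker sA sM r X Y B n)"

definition tens ::
  "('k::field \<Rightarrow> 'a::{ring, monoid_mult} \<Rightarrow> 'a) \<Rightarrow> ('k \<Rightarrow> 'm::ab_group_add \<Rightarrow> 'm) \<Rightarrow>
   ('m \<Rightarrow> 'a \<Rightarrow> 'm) \<Rightarrow> 'm set \<Rightarrow> 'a set \<Rightarrow> 'a set \<Rightarrow> nat \<Rightarrow>
   ('k, ('m \<times> 'a list \<Rightarrow>\<^sub>0 'k) set) vspace" where
  "tens sA sM r X Y B n = vs_quot (tens_free X Y n) (tens_ker sA sM r X Y B n)"

text \<open>
  A map defined on representatives is carried to a quotient as \<open>X \<mapsto> the_elem (f ` X)\<close>:
  the common value of \<open>f\<close> on the class \<open>X\<close>.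
\<close>

definition tens_lact ::
  "('k::field \<Rightarrow> 'a::{ring, monoid_mult} \<Rightarrow> 'a) \<Rightarrow> ('k \<Rightarrow> 'm::ab_group_add \<Rightarrow> 'm) \<Rightarrow>
   ('a \<Rightarrow> 'm \<Rightarrow> 'm) \<Rightarrow> ('m \<Rightarrow> 'a \<Rightarrow> 'm) \<Rightarrow> 'm set \<Rightarrow> 'a set \<Rightarrow> 'a set \<Rightarrow> nat \<Rightarrow>
   'a \<Rightarrow> ('m \<times> 'a list \<Rightarrow>\<^sub>0 'k) set \<Rightarrow> ('m \<times> 'a list \<Rightarrow>\<^sub>0 'k) set" where
  "tens_lact sA sM l r X Y B n b U =
     the_elem ((\<lambda>x. tens_class sA sM r X Y B n (lin_ext (\<lambda>(m, as). (l b m, as)) x)) ` U)"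

definition tens_ract ::
  "('k::field \<Rightarrow> 'a::{ring, monoid_mult} \<Rightarrow> 'a) \<Rightarrow> ('k \<Rightarrow> 'm::ab_group_add \<Rightarrow> 'm) \<Rightarrow>
   ('m \<Rightarrow> 'a \<Rightarrow> 'm) \<Rightarrow> 'm set \<Rightarrow> 'a set \<Rightarrow> 'a set \<Rightarrow> nat \<Rightarrow>
   ('m \<times> 'a list \<Rightarrow>\<^sub>0 'k) set \<Rightarrow> 'a \<Rightarrow> ('m \<times> 'a list \<Rightarrow>\<^sub>0 'k) set" where
  "tens_ract sA sM r X Y B n U b =
     the_elem ((\<lambda>x. tens_class sA sM r X Y B n
       (lin_ext (\<lambda>(m, as). if as = [] then (r m b, []) else (m, butlast as @ [last as * b])) x)) ` U)"

definition sep_mult ::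
  "('k::field \<Rightarrow> 'a::{ring, monoid_mult} \<Rightarrow> 'a) \<Rightarrow> ('a \<times> 'a list \<Rightarrow>\<^sub>0 'k) set \<Rightarrow> 'a" where
  "sep_mult sA U =
     the_elem ((\<lambda>x. \<Sum>(a, as)\<in>Poly_Mapping.keys x.
       sA (Poly_Mapping.lookup x (a, as)) (a * prod_list as)) ` U)"

text \<open>\<open>B \<otimes>\<^sub>k B\<close> is the case \<open>X = Y = B\<close>, \<open>n = 1\<close>, balanced over the scalars; linearity of the section over \<open>k\<close> follows from linearity over \<open>B\<close>.\<close>

definition separable :: "('k::field \<Rightarrow> 'a::{ring, monoid_mult} \<Rightarrow> 'a) \<Rightarrow> 'a set \<Rightarrow> bool" where
  "separable sA B \<longleftrightarrow>
    (let BB = tens sA sA (*) B B (ground sA) 1;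
         lact = tens_lact sA sA (*) (*) B B (ground sA) 1;
         ract = tens_ract sA sA (*) B B (ground sA) 1
     in \<exists>s. s \<in> B \<rightarrow> vcarrier BB \<and>
          (\<forall>x\<in>B. \<forall>y\<in>B. s (x + y) = vadd BB (s x) (s y)) \<and>
          (\<forall>b\<in>B. \<forall>x\<in>B. s (b * x) = lact b (s x) \<and> s (x * b) = ract (s x) b) \<and>
          (\<forall>x\<in>B. sep_mult sA (s x) = x))"


section \<open>Homology of complexes\<close>

definition vs_homology ::
  "(nat \<Rightarrow> ('k, 'v) vspace) \<Rightarrow> (nat \<Rightarrow> 'v \<Rightarrow> 'v) \<Rightarrow> nat \<Rightarrow> ('k, 'v set) vspace" where
  "vs_homology C d n =
     vs_quot ((C n)\<lparr>vcarrier := {x \<in> vcarrier (C n). n = 0 \<or> d n x = vzero (C (n - 1))}\<rparr>)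
       (d (Suc n) ` vcarrier (C (Suc n)))"

text \<open>
  In the following, \<open>d n i\<close> is the face map \<open>d\<^sub>i : Z\<^sub>n \<rightarrow> Z\<^sub>n\<^sub>-\<^sub>1\<close> and \<open>t n\<close> the (unsigned) cyclic
  operator of \<open>Z\<^sub>n\<close>. The differentials \<open>b\<close> and \<open>b'\<close> are defined for \<open>n \<ge> 1\<close>.
\<close>

definition b_diff ::
  "(nat \<Rightarrow> ('k::field, 'v) vspace) \<Rightarrow> (nat \<Rightarrow> nat \<Rightarrow> 'v \<Rightarrow> 'v) \<Rightarrow> nat \<Rightarrow> 'v \<Rightarrow> 'v" where
  "b_diff Z d n x = vs_sum (Z (n - 1)) (\<lambda>i. vscale (Z (n - 1)) ((- 1) ^ i) (d n i x)) (n + 1)"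

definition b'_diff ::
  "(nat \<Rightarrow> ('k::field, 'v) vspace) \<Rightarrow> (nat \<Rightarrow> nat \<Rightarrow> 'v \<Rightarrow> 'v) \<Rightarrow> nat \<Rightarrow> 'v \<Rightarrow> 'v" where
  "b'_diff Z d n x = vs_sum (Z (n - 1)) (\<lambda>i. vscale (Z (n - 1)) ((- 1) ^ i) (d n i x)) n"

definition signed_t ::
  "(nat \<Rightarrow> ('k::field, 'v) vspace) \<Rightarrow> (nat \<Rightarrow> 'v \<Rightarrow> 'v) \<Rightarrow> nat \<Rightarrow> 'v \<Rightarrow> 'v" where
  "signed_t Z t n x = vscale (Z n) ((- 1) ^ n) (t n x)"

definition cyc_norm ::
  "(nat \<Rightarrow> ('k::field, 'v) vspace) \<Rightarrow> (nat \<Rightarrow> 'v \<Rightarrow> 'v) \<Rightarrow> nat \<Rightarrow> 'v \<Rightarrow> 'v" where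
  "cyc_norm Z t n x = vs_sum (Z n) (\<lambda>i. (signed_t Z t n ^^ i) x) (n + 1)"

text \<open>
  The Tsygan double complex has \<open>Z q\<close> in position \<open>(p, q)\<close> for \<open>p, q \<ge> 0\<close>. The vertical
  differentials are \<open>b\<close> in even columns and \<open>-b'\<close> in odd columns, so that squares anticommute;
  the horizontal map leaving column \<open>p\<close> is \<open>1 - (-1)\<^sup>q t\<close> for odd \<open>p\<close> and the norm for even \<open>p \<ge> 2\<close>.
\<close>

definition tsygan_vert ::
  "(nat \<Rightarrow> ('k::field, 'v) vspace) \<Rightarrow> (nat \<Rightarrow> nat \<Rightarrow> 'v \<Rightarrow> 'v) \<Rightarrow> nat \<Rightarrow> nat \<Rightarrow> 'v \<Rightarrow> 'v" where
  "tsygan_vert Z d p q x =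
     (if even p then b_diff Z d q x else vscale (Z (q - 1)) (- 1) (b'_diff Z d q x))"

definition tsygan_horiz ::
  "(nat \<Rightarrow> ('k::field, 'v) vspace) \<Rightarrow> (nat \<Rightarrow> 'v \<Rightarrow> 'v) \<Rightarrow> nat \<Rightarrow> nat \<Rightarrow> 'v \<Rightarrow> 'v" where
  "tsygan_horiz Z t p q x =
     (if odd p then vs_diff (Z q) x (signed_t Z t q x) else cyc_norm Z t q x)"

text \<open>An element of total degree \<open>n\<close> is a family \<open>x\<close> with \<open>x p\<close> in position \<open>(p, n - p)\<close>, \<open>p \<le> n\<close>.\<close>

definition tsygan_tot ::
  "(nat \<Rightarrow> ('k::field, 'v) vspace) \<Rightarrow> nat \<Rightarrow> ('k, nat \<Rightarrow> 'v) vspace" where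
  "tsygan_tot Z n =
    \<lparr> vcarrier = (\<Pi>\<^sub>E p\<in>{..n}. vcarrier (Z (n - p))),
      vadd = (\<lambda>x y. \<lambda>p\<in>{..n}. vadd (Z (n - p)) (x p) (y p)),
      vzero = (\<lambda>p\<in>{..n}. vzero (Z (n - p))),
      vscale = (\<lambda>c x. \<lambda>p\<in>{..n}. vscale (Z (n - p)) c (x p)) \<rparr>"

definition tsygan_diff ::
  "(nat \<Rightarrow> ('k::field, 'v) vspace) \<Rightarrow> (nat \<Rightarrow> nat \<Rightarrow> 'v \<Rightarrow> 'v) \<Rightarrow> (nat \<Rightarrow> 'v \<Rightarrow> 'v) \<Rightarrow>
   nat \<Rightarrow> (nat \<Rightarrow> 'v) \<Rightarrow> (nat \<Rightarrow> 'v)" where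
  "tsygan_diff Z d t n x =
     (\<lambda>p\<in>{..n - 1}. vadd (Z (n - 1 - p))
        (tsygan_vert Z d p (n - p) (x p))
        (tsygan_horiz Z t (p + 1) (n - (p + 1)) (x (p + 1))))"

definition cyclic_homology ::
  "(nat \<Rightarrow> ('k::field, 'v) vspace) \<Rightarrow> (nat \<Rightarrow> nat \<Rightarrow> 'v \<Rightarrow> 'v) \<Rightarrow> (nat \<Rightarrow> 'v \<Rightarrow> 'v) \<Rightarrow>
   nat \<Rightarrow> ('k, (nat \<Rightarrow> 'v) set) vspace" where
  "cyclic_homology Z d t = vs_homology (tsygan_tot Z) (tsygan_diff Z d t)"


section \<open>Relative Hochschild and cyclic homology\<close>

abbreviation mtens ::
  "('k::field \<Rightarrow> 'a::{ring, monoid_mult} \<Rightarrow> 'a) \<Rightarrow> 'a set \<Rightarrow> ('k \<Rightarrow> 'm::ab_group_add \<Rightarrow> 'm) \<Rightarrow>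
   ('m \<Rightarrow> 'a \<Rightarrow> 'm) \<Rightarrow> nat \<Rightarrow> ('k, ('m \<times> 'a list \<Rightarrow>\<^sub>0 'k) set) vspace" where
  "mtens sA B sM r n \<equiv> tens sA sM r UNIV UNIV B n"

definition commutators ::
  "('k::field \<Rightarrow> 'a::{ring, monoid_mult} \<Rightarrow> 'a) \<Rightarrow> 'a set \<Rightarrow> ('k \<Rightarrow> 'm::ab_group_add \<Rightarrow> 'm) \<Rightarrow>
   ('a \<Rightarrow> 'm \<Rightarrow> 'm) \<Rightarrow> ('m \<Rightarrow> 'a \<Rightarrow> 'm) \<Rightarrow> nat \<Rightarrow> ('m \<times> 'a list \<Rightarrow>\<^sub>0 'k) set set" where
  "commutators sA B sM l r n =
     vs_span (mtens sA B sM r n)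
       {vs_diff (mtens sA B sM r n) (tens_ract sA sM r UNIV UNIV B n x b)
          (tens_lact sA sM l r UNIV UNIV B n b x) | x b. x \<in> vcarrier (mtens sA B sM r n) \<and> b \<in> B}"

definition hoch_Z ::
  "('k::field \<Rightarrow> 'a::{ring, monoid_mult} \<Rightarrow> 'a) \<Rightarrow> 'a set \<Rightarrow> ('k \<Rightarrow> 'm::ab_group_add \<Rightarrow> 'm) \<Rightarrow>
   ('a \<Rightarrow> 'm \<Rightarrow> 'm) \<Rightarrow> ('m \<Rightarrow> 'a \<Rightarrow> 'm) \<Rightarrow> nat \<Rightarrow> ('k, ('m \<times> 'a list \<Rightarrow>\<^sub>0 'k) set set) vspace" where
  "hoch_Z sA B sM l r n = vs_quot (mtens sA B sM r n) (commutators sA B sM l r n)"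

definition hoch_class ::
  "('k::field \<Rightarrow> 'a::{ring, monoid_mult} \<Rightarrow> 'a) \<Rightarrow> 'a set \<Rightarrow> ('k \<Rightarrow> 'm::ab_group_add \<Rightarrow> 'm) \<Rightarrow>
   ('a \<Rightarrow> 'm \<Rightarrow> 'm) \<Rightarrow> ('m \<Rightarrow> 'a \<Rightarrow> 'm) \<Rightarrow> nat \<Rightarrow>
   ('m \<times> 'a list \<Rightarrow>\<^sub>0 'k) \<Rightarrow> ('m \<times> 'a list \<Rightarrow>\<^sub>0 'k) set set" where
  "hoch_class sA B sM l r n x =
     vs_coset (mtens sA B sM r n) (commutators sA B sM l r n) (tens_class sA sM r UNIV UNIV B n x)"

text \<open>
  The linear map from \<open>Z\<^sub>p\<close> to \<open>Z\<^sub>n\<close> given on generators by \<open>g\<close>; \<open>\<Union>U\<close> consists of all formal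
  linear combinations representing \<open>U\<close>.
\<close>

definition hoch_map ::
  "('k::field \<Rightarrow> 'a::{ring, monoid_mult} \<Rightarrow> 'a) \<Rightarrow> 'a set \<Rightarrow> ('k \<Rightarrow> 'm::ab_group_add \<Rightarrow> 'm) \<Rightarrow>
   ('a \<Rightarrow> 'm \<Rightarrow> 'm) \<Rightarrow> ('m \<Rightarrow> 'a \<Rightarrow> 'm) \<Rightarrow> nat \<Rightarrow> ('m \<times> 'a list \<Rightarrow> 'm \<times> 'a list) \<Rightarrow>
   ('m \<times> 'a list \<Rightarrow>\<^sub>0 'k) set set \<Rightarrow> ('m \<times> 'a list \<Rightarrow>\<^sub>0 'k) set set" where
  "hoch_map sA B sM l r n g U = the_elem ((\<lambda>x. hoch_class sA B sM l r n (lin_ext g x)) ` \<Union>U)"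

text \<open>List positions start at \<open>0\<close>: the entry \<open>a\<^sup>i\<close> is \<open>as ! (i - 1)\<close>.\<close>

definition face_gen ::
  "('a::{ring, monoid_mult} \<Rightarrow> 'm \<Rightarrow> 'm) \<Rightarrow> ('m \<Rightarrow> 'a \<Rightarrow> 'm) \<Rightarrow> nat \<Rightarrow> nat \<Rightarrow>
   'm \<times> 'a list \<Rightarrow> 'm \<times> 'a list" where
  "face_gen l r n i = (\<lambda>(m, as).
     if i = 0 then (r m (hd as), tl as)
     else if i < n then (m, take (i - 1) as @ [as ! (i - 1) * as ! i] @ drop (i + 1) as)
     else (l (last as) m, butlast as))"

definition hoch_face ::
  "('k::field \<Rightarrow> 'a::{ring, monoid_mult} \<Rightarrow> 'a) \<Rightarrow> 'a set \<Rightarrow> ('k \<Rightarrow> 'm::ab_group_add \<Rightarrow> 'm) \<Rightarrow>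
   ('a \<Rightarrow> 'm \<Rightarrow> 'm) \<Rightarrow> ('m \<Rightarrow> 'a \<Rightarrow> 'm) \<Rightarrow> nat \<Rightarrow> nat \<Rightarrow>
   ('m \<times> 'a list \<Rightarrow>\<^sub>0 'k) set set \<Rightarrow> ('m \<times> 'a list \<Rightarrow>\<^sub>0 'k) set set" where
  "hoch_face sA B sM l r n i = hoch_map sA B sM l r (n - 1) (face_gen l r n i)"

text \<open>
  The unnormalised complex does not involve the degeneracies. The usual homology of the
  \<open>k\<close>-algebra \<open>A\<close> is the case \<open>B = ground sA\<close>.
\<close>

definition HH ::
  "('k::field \<Rightarrow> 'a::{ring, monoid_mult} \<Rightarrow> 'a) \<Rightarrow> 'a set \<Rightarrow> ('k \<Rightarrow> 'm::ab_group_add \<Rightarrow> 'm) \<Rightarrow>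
   ('a \<Rightarrow> 'm \<Rightarrow> 'm) \<Rightarrow> ('m \<Rightarrow> 'a \<Rightarrow> 'm) \<Rightarrow> nat \<Rightarrow>
   ('k, ('m \<times> 'a list \<Rightarrow>\<^sub>0 'k) set set set) vspace" where
  "HH sA B sM l r =
     vs_homology (hoch_Z sA B sM l r) (b_diff (hoch_Z sA B sM l r) (hoch_face sA B sM l r))"

definition t_gen :: "'a \<times> 'a list \<Rightarrow> 'a \<times> 'a list" where
  "t_gen = (\<lambda>(a, as). if as = [] then (a, []) else (last as, a # butlast as))"

definition HC ::
  "('k::field \<Rightarrow> 'a::{ring, monoid_mult} \<Rightarrow> 'a) \<Rightarrow> 'a set \<Rightarrow> nat \<Rightarrow>
   ('k, (nat \<Rightarrow> ('a \<times> 'a list \<Rightarrow>\<^sub>0 'k) set set) set) vspace" where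
  "HC sA B =
     cyclic_homology (hoch_Z sA B sA (*) (*)) (hoch_face sA B sA (*) (*))
       (\<lambda>n. hoch_map sA B sA (*) (*) n t_gen)"

end

theory Submission
  imports Defs "HOL-Library.Function_Algebras"
begin

text \<open>
  Let \<open>e = \<Sum>j. x\<^sub>j \<otimes> y\<^sub>j\<close> be a separability idempotent of \<open>B\<close>. Inserting a copy of \<open>e\<close> at every (cyclic) tensor
  sign, \<open>a\<^sub>0 \<otimes> a\<^sub>1 \<otimes> \<dots> \<otimes> a\<^sub>n \<mapsto> \<Sum> y\<^sub>n a\<^sub>0 x\<^sub>0 \<otimes> y\<^sub>0 a\<^sub>1 x\<^sub>1 \<otimes> \<dots> \<otimes> y\<^sub>n\<^sub>-\<^sub>1 a\<^sub>n x\<^sub>n\<close> with independent copies \<open>x\<^sub>i \<otimes> y\<^sub>i\<close>, is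
  well defined on \<open>Z\<^sub>n(A/B, M)\<close> because \<open>e\<close> commutes with \<open>B\<close>, and commutes with all faces and with
  the cyclic operator (though not with degeneracies) because \<open>e\<close> multiplies to \<open>1\<close>. It is a section
  \<open>\<sigma>\<close> of the projection from \<open>Z(A, M)\<close> to \<open>Z(A/B, M)\<close>. The maps
  \<open>h\<^sub>j(a\<^sub>0 \<otimes> \<dots> \<otimes> a\<^sub>n) = \<Sum> a\<^sub>0 x\<^sub>0 \<otimes> y\<^sub>0 a\<^sub>1 x\<^sub>1 \<otimes> \<dots> \<otimes> y\<^sub>j\<^sub>-\<^sub>1 a\<^sub>j x\<^sub>j \<otimes> y\<^sub>j \<otimes> a\<^sub>j\<^sub>+\<^sub>1 \<otimes> \<dots> \<otimes> a\<^sub>n\<close> form a simplicial homotopy from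
  the identity to \<open>\<sigma>\<close>, which settles Hochschild homology. For cyclic homology, the kernel of the
  projection is a presimplicial cyclic summand whose \<open>b\<close>-columns are contracted by this homotopy and
  whose \<open>b'\<close>-columns by the extra degeneracy; hence its total complex is acyclic.
\<close>

section \<open>Presentations of quotient spaces\<close>

text \<open>Both complexes are quotients of the same spaces \<open>tfree n\<close> of formal
  combinations of tuples: by \<open>ml_ker n\<close>, the multilinearity relations, for
  \<open>A\<close> over \<open>k\<close>, and by the larger \<open>hoch_ker B n\<close> for
  \<open>A/B\<close>. Every operator is thus a linear map of formal combinations given on tuples,
  and comparisons are made modulo \<open>ml_ker\<close>. Congruences are unavoidable: the terms
  \<open>x_j y_j\<close> add up to \<open>1\<close> only after the sum is collected inside one
  entry. The section has to fill every sign, with independent copies, because each balancing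
  relation of \<open>A/B\<close> lives at one sign (commutators at the cyclic one) and a copy of
  \<open>e\<close> placed there absorbs it; insertions at different signs commute, so that copy may
  be taken first. Commuting with faces and rotation then also shows, without inspecting balancing
  relations, that these descend to \<open>A/B\<close>. For cyclic homology no spectral sequence is
  used: a fixed total degree meets finitely many columns, so exactness of the columns of the kernel
  yields an explicit primitive by recursion on columns.\<close>

abbreviation single :: "'g \<Rightarrow> 'k::zero \<Rightarrow> 'g \<Rightarrow>\<^sub>0 'k" where "single \<equiv> Poly_Mapping.single"
abbreviation keys :: "('g \<Rightarrow>\<^sub>0 'k::zero) \<Rightarrow> 'g set" where "keys \<equiv> Poly_Mapping.keys"
abbreviation lookup :: "('g \<Rightarrow>\<^sub>0 'k::zero) \<Rightarrow> 'g \<Rightarrow> 'k" where "lookup \<equiv> Poly_Mapping.lookup"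

type_synonym ('k, 'm, 'a) chains = "'m \<times> 'a list \<Rightarrow>\<^sub>0 'k"

definition pscale :: "'k::field \<Rightarrow> ('g \<Rightarrow>\<^sub>0 'k) \<Rightarrow> ('g \<Rightarrow>\<^sub>0 'k)" where
  "pscale c = Poly_Mapping.map ((*) c)"

lemma lookup_pscale [simp]: "lookup (pscale c x) p = c * lookup x p"
  by (simp add: pscale_def Poly_Mapping.map.rep_eq when_def)

lemma pscale_single [simp]: "pscale c (single p a) = single p (c * a)"
  by (rule poly_mapping_eqI) (simp add: lookup_single when_def)

global_interpretation pm: vector_space "pscale :: 'k::field \<Rightarrow> ('g \<Rightarrow>\<^sub>0 'k) \<Rightarrow> _"
  by unfold_locales (auto intro!: poly_mapping_eqI simp: lookup_add algebra_simps)

text \<open>The linear map out of the free space with prescribed values on the basis.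
  \<open>lin_ext\<close>, \<open>op\<close> and the multiplication map on
  \<open>B \<otimes> B\<close> are instances, so linearity is proved once.\<close>

definition lsum :: "('k::field \<Rightarrow> 'w::ab_group_add \<Rightarrow> 'w) \<Rightarrow> ('g \<Rightarrow> 'w) \<Rightarrow> ('g \<Rightarrow>\<^sub>0 'k) \<Rightarrow> 'w" where
  "lsum s G x = (\<Sum>p\<in>keys x. s (lookup x p) (G p))"

lemma lsum_superset:
  assumes "vector_space s" "finite S" "keys x \<subseteq> S"
  shows "lsum s G x = (\<Sum>p\<in>S. s (lookup x p) (G p))"
proof -
  interpret vector_space s by fact
  show ?thesis unfolding lsum_def
    by (rule sum.mono_neutral_left) (use assms in \<open>auto simp: in_keys_iff\<close>)
qed

lemma lsum_hom:
  assumes "vector_space s"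
  shows "module_hom pscale s (lsum s G)"
proof -
  interpret vector_space s by fact
  show ?thesis
  proof unfold_locales
    fix x y :: "'c \<Rightarrow>\<^sub>0 'a" and c
    let ?S = "keys x \<union> keys y \<union> keys (x + y)"
    show "lsum s G (x + y) = lsum s G x + lsum s G y"
      by (subst (1 2 3) lsum_superset[OF assms, of ?S])
        (auto simp: lookup_add scale_left_distrib sum.distrib)
    let ?T = "keys x \<union> keys (pscale c x)"
    show "lsum s G (pscale c x) = s c (lsum s G x)"
      by (subst (1 2) lsum_superset[OF assms, of ?T]) (auto simp: scale_sum_right)
  qed
qed

lemma lsum_single [simp]:
  assumes "vector_space s"
  shows "lsum s G (single p a) = s a (G p)"
proof -
  interpret vector_space s by fact
  show ?thesis by (simp add: lsum_def)
qed

lemma lin_ext_lsum: "lin_ext g = lsum pscale (\<lambda>p. single (g p) 1)"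
  by (rule ext) (simp add: lin_ext_def lsum_def)

lemma poly_mapping_expand:
  "x = (\<Sum>p\<in>keys x. pscale (lookup x p) (single p 1))"
  by (rule poly_mapping_eqI) (auto simp: lookup_sum lookup_single when_def in_keys_iff sum.delta')

lemma keys_subset_span:
  assumes "keys x \<subseteq> G"
  shows "x \<in> pm.span ((\<lambda>p. single p 1) ` G)"
  by (subst poly_mapping_expand, intro pm.span_sum pm.span_scale pm.span_base) (use assms in auto)

lemma subspace_keys: "pm.subspace {x. keys x \<subseteq> G}"
  unfolding pm.subspace_def
  by (auto simp: in_keys_iff subset_iff lookup_add) (metis add.right_neutral)

text \<open>A quotient \<open>F / N\<close> of subspaces of a type, as a record with carrier \<open>c ` F\<close>.\<close>

locale presented = vector_space s
  for s :: "'k::field \<Rightarrow> 'u::ab_group_add \<Rightarrow> 'u" +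
  fixes V :: "('k, 'v) vspace" and F N :: "'u set" and c :: "'u \<Rightarrow> 'v"
  assumes F: "subspace F" and N: "subspace N" and N_F: "N \<subseteq> F"
    and carrier: "vcarrier V = c ` F"
    and zero: "vzero V = c 0"
    and cls: "\<And>x y. x \<in> F \<Longrightarrow> y \<in> F \<Longrightarrow> c x = c y \<longleftrightarrow> x - y \<in> N"
    and add: "\<And>x y. x \<in> F \<Longrightarrow> y \<in> F \<Longrightarrow> vadd V (c x) (c y) = c (x + y)"
    and scl: "\<And>a x. x \<in> F \<Longrightarrow> vscale V a (c x) = c (s a x)"
begin

lemmas F0 [simp] = subspace_0[OF F]
lemmas Fadd = subspace_add[OF F]
lemmas Fdiff = subspace_diff[OF F]
lemmas Fscale = subspace_scale[OF F]

lemma cls_zero: "x \<in> F \<Longrightarrow> c x = vzero V \<longleftrightarrow> x \<in> N"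
  using cls[of x 0] zero by simp

lemma vs_diff_cls: "x \<in> F \<Longrightarrow> y \<in> F \<Longrightarrow> vs_diff V (c x) (c y) = c (x - y)"
  using add[of x "s (- 1) y"] Fscale[of y "- 1"] by (simp add: vs_diff_def scl)

lemma vs_sum_cls:
  assumes "\<And>i. i < n \<Longrightarrow> f i \<in> F"
  shows "vs_sum V (\<lambda>i. c (f i)) n = c (\<Sum>i<n. f i)"
  using assms
proof (induction n)
  case (Suc n)
  have "sum f {..<n} \<in> F" by (rule subspace_sum[OF F]) (use Suc.prems in auto)
  then show ?case using Suc by (simp add: add)
qed (simp add: zero)

lemma vs_subspace_image:
  assumes "subspace P" "P \<subseteq> F"
  shows "vs_subspace V (c ` P)"
proof -
  have "vadd V (c x) (c y) \<in> c ` P" "vscale V a (c x) \<in> c ` P" if "x \<in> P" "y \<in> P" for a x y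
    using that assms subspace_add[OF assms(1)] subspace_scale[OF assms(1)]
    by (auto simp: subset_iff add scl)
  then show ?thesis
    unfolding vs_subspace_def using assms subspace_0[OF assms(1)]
    by (auto simp: carrier zero)
qed

lemma subspace_preimage:
  assumes "vs_subspace V W"
  shows "subspace {x \<in> F. c x \<in> W}"
proof -
  have "c (x + y) \<in> W" if "x \<in> F" "y \<in> F" "c x \<in> W" "c y \<in> W" for x y
    using assms that add[of x y] unfolding vs_subspace_def by metis
  moreover have "c (s a x) \<in> W" if "x \<in> F" "c x \<in> W" for a x
    using assms that scl[of x a] unfolding vs_subspace_def by metis
  moreover have "c 0 \<in> W" using assms zero unfolding vs_subspace_def by metis
  ultimately show ?thesis unfolding subspace_def by (auto intro: Fadd Fscale)
qed

lemma coset_eq: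
  assumes W: "vs_subspace V W" and x: "x \<in> F"
  shows "vs_coset V W (c x) = c ` {y \<in> F. c (y - x) \<in> W}"
proof (intro set_eqI iffI)
  fix u assume "u \<in> vs_coset V W (c x)"
  then obtain w where w: "w \<in> F" "c w \<in> W" "u = vadd V (c x) (c w)"
    using W carrier unfolding vs_coset_def vs_subspace_def by auto
  then show "u \<in> c ` {y \<in> F. c (y - x) \<in> W}"
    using x by (auto simp: add Fadd intro!: image_eqI[where x = "x + w"])
next
  fix u assume "u \<in> c ` {y \<in> F. c (y - x) \<in> W}"
  then obtain y where "y \<in> F" "c (y - x) \<in> W" "u = c y" by auto
  then show "u \<in> vs_coset V W (c x)"
    using x by (auto simp: vs_coset_def add Fdiff intro!: exI[of _ "c (y - x)"])
qed

text \<open>\<open>W\<close> need not lie in \<open>c ` F'\<close>: homology is presented without knowing that boundaries are cycles.\<close>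

lemma presented_quot:
  assumes W: "vs_subspace V W" and F': "subspace F'" "N \<subseteq> F'" "F' \<subseteq> F"
    and V': "V' = V\<lparr>vcarrier := c ` F'\<rparr>"
  shows "presented s (vs_quot V' W) F' {x \<in> F'. c x \<in> W} (\<lambda>x. vs_coset V W (c x))"
proof -
  let ?N = "{x \<in> F. c x \<in> W}"
  have sub: "subspace ?N" by (rule subspace_preimage[OF W])
  have coset: "vs_coset V W (c x) = c ` {y \<in> F. y - x \<in> ?N}" if "x \<in> F" for x
    using coset_eq[OF W that] Fdiff that by auto
  have V'_coset: "vs_coset V' W = vs_coset V W"
    by (simp add: V' vs_coset_def fun_eq_iff)
  have W_eq: "W = c ` ?N" using W carrier unfolding vs_subspace_def by auto
  have N_sub: "N \<subseteq> ?N"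
  proof
    fix x assume "x \<in> N"
    moreover from \<open>x \<in> N\<close> have "x \<in> F" using N_F by blast
    ultimately have "c x = vzero V" using cls_zero by blast
    moreover have "vzero V \<in> W" using W unfolding vs_subspace_def by blast
    ultimately show "x \<in> ?N" using \<open>x \<in> F\<close> by simp
  qed
  have eq: "vs_coset V W (c x) = vs_coset V W (c y) \<longleftrightarrow> x - y \<in> ?N" if "x \<in> F" "y \<in> F" for x y
  proof
    \<comment> \<open>As \<open>c\<close> need not be injective, membership of \<open>c x\<close> in
      the second coset only yields some \<open>z\<close> with \<open>c z = c x\<close>; the error
      \<open>x - z\<close> lies in \<open>N\<close>, hence in \<open>?N\<close>.\<close>
    assume "vs_coset V W (c x) = vs_coset V W (c y)"
    moreover have "c x \<in> vs_coset V W (c x)" using that subspace_0[OF sub] by (auto simp: coset)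
    ultimately have "c x \<in> c ` {z \<in> F. z - y \<in> ?N}" using that coset by simp
    then obtain z where z: "z \<in> F" "z - y \<in> ?N" "c x = c z" by auto
    then have "x - z \<in> ?N" using that cls N_sub by blast
    then have "(x - z) + (z - y) \<in> ?N" by (rule subspace_add[OF sub _ z(2)])
    then show "x - y \<in> ?N" by simp
  next
    assume xy: "x - y \<in> ?N"
    then have "z - x \<in> ?N \<longleftrightarrow> z - y \<in> ?N" for z
      using subspace_add[OF sub _ xy, of "z - x"] subspace_diff[OF sub _ xy, of "z - y"]
      by (smt (verit) diff_diff_eq2 diff_add_cancel diff_add_eq)
    then show "vs_coset V W (c x) = vs_coset V W (c y)" using that by (simp add: coset)
  qed
  have add': "{vadd V u v |u v. u \<in> vs_coset V W (c x) \<and> v \<in> vs_coset V W (c y)} =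
      vs_coset V W (c (x + y))" (is "?L = ?R") if xy: "x \<in> F" "y \<in> F" for x y
  proof
    show "?L \<subseteq> ?R"
    proof
      fix u assume "u \<in> ?L"
      then obtain a b where ab: "a \<in> F" "b \<in> F" "a - x \<in> ?N" "b - y \<in> ?N"
        "u = vadd V (c a) (c b)" using xy by (auto simp: coset)
      then have "(a - x) + (b - y) \<in> ?N" using subspace_add[OF sub] by blast
      then have "(a + b) - (x + y) \<in> ?N" by (simp add: algebra_simps)
      then show "u \<in> ?R" using xy ab by (auto simp: coset Fadd add)
    qed
    show "?R \<subseteq> ?L"
    proof
      fix u assume "u \<in> ?R"
      then obtain z where z: "z \<in> F" "z - (x + y) \<in> ?N" "u = c z" using xy
        by (auto simp: coset Fadd)
      have u: "u = vadd V (c (z - y)) (c y)" using z xy by (simp add: add Fdiff)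
      have e: "(z - y) - x = z - (x + y)" by simp
      have "(z - y) - x \<in> ?N" unfolding e by (rule z)
      moreover have "z - y \<in> F" using z xy Fdiff by simp
      moreover have "y - y \<in> ?N" using subspace_0[OF sub] by simp
      ultimately have "c (z - y) \<in> vs_coset V W (c x)" "c y \<in> vs_coset V W (c y)"
        unfolding coset[OF xy(1)] coset[OF xy(2)] using xy by blast+
      then show "u \<in> ?L" using u by blast
    qed
  qed
  have scl': "{vadd V (vscale V a u) w |u w. u \<in> vs_coset V W (c x) \<and> w \<in> W} =
      vs_coset V W (c (s a x))" (is "?L = ?R") if x: "x \<in> F" for a x
  proof
    show "?L \<subseteq> ?R"
    proof
      fix u assume "u \<in> ?L"
      then obtain v v' where v: "v \<in> vs_coset V W (c x)" "v' \<in> W"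
        and u: "u = vadd V (vscale V a v) v'" by blast
      obtain w where w: "w \<in> ?N" "v' = c w" using v(2) W_eq by blast
      obtain y where y: "y \<in> F" "y - x \<in> ?N" "v = c y" using v(1) coset[OF x] by blast
      note yw = y(1,2) w(1) u[unfolded y(3) w(2)]
      have "s a (y - x) + w \<in> ?N" using yw subspace_add[OF sub] subspace_scale[OF sub] by blast
      moreover have "s a (y - x) + w = s a y + w - s a x" by (simp add: scale_right_diff_distrib)
      ultimately have "s a y + w - s a x \<in> ?N" by (simp only:)
      then show "u \<in> ?R" using x yw by (auto simp: coset Fadd Fscale add scl)
    qed
    show "?R \<subseteq> ?L"
    proof
      fix u assume "u \<in> ?R"
      then obtain z where z: "z \<in> F" "z - s a x \<in> ?N" "u = c z" using x
        by (auto simp: coset Fscale)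
      then have "u = vadd V (vscale V a (c x)) (c (z - s a x))" "c (z - s a x) \<in> W"
        using x by (auto simp: add scl Fdiff Fscale)
      moreover have "c x \<in> vs_coset V W (c x)" using x subspace_0[OF sub] by (auto simp: coset)
      ultimately show "u \<in> ?L" by blast
    qed
  qed
  have "subspace {x \<in> F'. c x \<in> W}"
  proof -
    have "{x \<in> F'. c x \<in> W} = F' \<inter> ?N" using F' by auto
    then show ?thesis using subspace_inter[OF F'(1) sub] by simp
  qed
  moreover have "vs_coset V W (c 0) = W"
    using W_eq by (auto simp: coset)
  moreover have "vs_quot V' W =
    \<lparr> vcarrier = vs_coset V W ` c ` F', vadd = (\<lambda>X Y. {vadd V x y |x y. x \<in> X \<and> y \<in> Y}),
      vzero = W, vscale = (\<lambda>a X. {vadd V (vscale V a x) w |x w. x \<in> X \<and> w \<in> W}) \<rparr>"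
    unfolding vs_quot_def V'_coset by (simp add: V')
  ultimately show ?thesis
    using F' subspace_diff[OF F'(1)] eq add' scl'
    by unfold_locales (auto simp: image_image subset_iff)
qed

end

text \<open>The map on classes is read off from a chosen representative. The two directions of
  \<open>inj\<close> play different roles: one makes the choice irrelevant, the other gives
  injectivity.\<close>

lemma vs_iso_presented:
  assumes "presented s V F N c" "presented s' V' F' N' c'"
    and hom: "module_hom s s' f" and f: "\<And>x. x \<in> F \<Longrightarrow> f x \<in> F'"
    and inj: "\<And>x. x \<in> F \<Longrightarrow> f x \<in> N' \<longleftrightarrow> x \<in> N"
    and surj: "\<And>y. y \<in> F' \<Longrightarrow> \<exists>x\<in>F. y - f x \<in> N'"
  shows "vs_iso V V'"
proof -
  interpret V: presented s V F N c by fact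
  interpret V': presented s' V' F' N' c' by fact
  interpret module_hom s s' f by fact
  define g where "g = (\<lambda>u. c' (f (inv_into F c u)))"
  have eq: "c' (f x) = c' (f y) \<longleftrightarrow> c x = c y" if "x \<in> F" "y \<in> F" for x y
    using that V'.cls[of "f x" "f y"] V.cls[of x y] inj[of "x - y"] f V.Fdiff
    by (simp add: diff)
  have g: "g (c x) = c' (f x)" if "x \<in> F" for x
  proof -
    have "c x \<in> c ` F" using that by simp
    then show ?thesis unfolding g_def
      using eq[OF inv_into_into that] f_inv_into_f by metis
  qed
  have "bij_betw g (vcarrier V) (vcarrier V')"
  proof (rule bij_betw_imageI)
    show "inj_on g (vcarrier V)" by (auto simp: V.carrier g eq intro!: inj_onI)
    have "c' y \<in> g ` c ` F" if y: "y \<in> F'" for y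
    proof -
      obtain x where "x \<in> F" "y - f x \<in> N'" using surj[OF y] by blast
      then have "c' y = g (c x)" using V'.cls[OF y f] g by simp
      then show ?thesis using \<open>x \<in> F\<close> by blast
    qed
    then show "g ` vcarrier V = vcarrier V'" using f by (auto simp: V.carrier V'.carrier g)
  qed
  moreover have "g (vadd V u v) = vadd V' (g u) (g v)"
    if "u \<in> vcarrier V" "v \<in> vcarrier V" for u v
    using that f by (auto simp: V.carrier V.add V.Fadd g V'.add add)
  moreover have "g (vscale V a u) = vscale V' a (g u)" if "u \<in> vcarrier V" for a u
    using that f by (auto simp: V.carrier V.scl V.Fscale g V'.scl scale)
  ultimately show ?thesis unfolding vs_iso_def by blast
qed

text \<open>Homology expressed through representatives only. The cycle condition is repeated in the
  denominator because \<open>\<delta> \<delta> = 0\<close> is not among the assumptions.\<close>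

lemma presented_homology:
  assumes P: "\<And>n. presented s (C n) (F n) (N n) (c n)"
    and hom: "\<And>n. module_hom s s (\<delta> n)"
    and \<delta>: "\<And>n x. x \<in> F (Suc n) \<Longrightarrow> \<delta> (Suc n) x \<in> F n"
    and d: "\<And>n x. x \<in> F (Suc n) \<Longrightarrow> d (Suc n) (c (Suc n) x) = c n (\<delta> (Suc n) x)"
  shows "\<exists>c'. presented s (vs_homology C d n) {x \<in> F n. n = 0 \<or> \<delta> n x \<in> N (n - 1)}
     {x \<in> F n. (n = 0 \<or> \<delta> n x \<in> N (n - 1)) \<and> (\<exists>y\<in>F (Suc n). x - \<delta> (Suc n) y \<in> N n)} c'"
proof -
  interpret P: presented s "C m" "F m" "N m" "c m" for m by (rule P)
  interpret D: module_hom s s "\<delta> m" for m by (rule hom)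
  let ?Z = "{x \<in> F n. n = 0 \<or> \<delta> n x \<in> N (n - 1)}"
  let ?W = "d (Suc n) ` vcarrier (C (Suc n))"
  let ?B = "\<delta> (Suc n) ` F (Suc n)"
  have W: "?W = c n ` ?B" by (simp add: P.carrier image_image d cong: image_cong)
  have BF: "?B \<subseteq> F n" using \<delta> by auto
  have sub: "vs_subspace (C n) ?W"
    unfolding W by (rule P.vs_subspace_image) (use P.F BF D.subspace_image in auto)
  have d': "d n (c n x) = vzero (C (n - 1)) \<longleftrightarrow> \<delta> n x \<in> N (n - 1)" if "n \<noteq> 0" "x \<in> F n" for x
    using that by (cases n) (auto simp: d P.cls_zero \<delta>)
  have sZ: "module.subspace s ?Z"
  proof (cases "n = 0")
    case True
    then show ?thesis using P.F[of n] by simp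
  next
    case False
    then have "?Z = F n \<inter> \<delta> n -` N (n - 1)" by auto
    then show ?thesis
      using P.subspace_inter[OF P.F D.subspace_vimage[OF P.N]] by metis
  qed
  have NZ: "N n \<subseteq> ?Z"
  proof
    fix x assume x: "x \<in> N n"
    then have xF: "x \<in> F n" using P.N_F by blast
    \<comment> \<open>That \<open>\<delta>\<close> maps \<open>N n\<close> into
      \<open>N (n - 1)\<close> comes from \<open>d\<close> being a function of classes:
      \<open>x\<close> and \<open>0\<close> have the same class.\<close>
    then have "d n (c n x) = d n (c n 0)" using x P.cls[of x n 0] by simp
    then have "n = 0 \<or> \<delta> n x \<in> N (n - 1)"
      using d'[OF _ xF] d'[of 0] P.subspace_0[OF P.N] by auto
    then show "x \<in> ?Z" using xF by simp
  qed
  have "presented s (vs_homology C d n) ?Z {x \<in> ?Z. c n x \<in> ?W} (\<lambda>x. vs_coset (C n) ?W (c n x))"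
    unfolding vs_homology_def
  proof (rule P.presented_quot[OF sub sZ NZ])
    show "(C n)\<lparr>vcarrier := {x \<in> vcarrier (C n). n = 0 \<or> d n x = vzero (C (n - 1))}\<rparr> =
        (C n)\<lparr>vcarrier := c n ` ?Z\<rparr>"
      using d' by (intro arg_cong2[where f = "\<lambda>S. vcarrier_update (\<lambda>_. S)"]) (auto simp: P.carrier)
  qed auto
  moreover have "{x \<in> ?Z. c n x \<in> ?W} =
      {x \<in> F n. (n = 0 \<or> \<delta> n x \<in> N (n - 1)) \<and> (\<exists>y\<in>F (Suc n). x - \<delta> (Suc n) y \<in> N n)}"
    unfolding W using \<delta> by (auto simp: image_iff P.cls)
  ultimately show ?thesis by auto
qed

text \<open>
  Two quotients of one family of spaces \<open>F\<close> with the same differential, compared by an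
  endomorphism \<open>\<sigma>\<close> which is a chain map up to the smaller subspaces \<open>N'\<close> and splits \<open>F / N' \<rightarrow> F / N\<close>.
\<close>

lemma vs_iso_homology:
  assumes P: "\<And>n. presented s (C n) (F n) (N n) (c n)" "\<And>n. presented s (C' n) (F n) (N' n) (c' n)"
    and hom: "\<And>n. module_hom s s (\<delta> n)" "\<And>n. module_hom s s (\<sigma> n)"
    and \<delta>: "\<And>n x. x \<in> F (Suc n) \<Longrightarrow> \<delta> (Suc n) x \<in> F n"
    and d: "\<And>n x. x \<in> F (Suc n) \<Longrightarrow> d (Suc n) (c (Suc n) x) = c n (\<delta> (Suc n) x)"
      "\<And>n x. x \<in> F (Suc n) \<Longrightarrow> d' (Suc n) (c' (Suc n) x) = c' n (\<delta> (Suc n) x)"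
    and \<sigma>: "\<And>n x. x \<in> F n \<Longrightarrow> \<sigma> n x \<in> F n"
    and N: "\<And>n. N' n \<subseteq> N n"
    and \<sigma>N: "\<And>n x. x \<in> N n \<Longrightarrow> \<sigma> n x \<in> N' n"
    and \<sigma>_id: "\<And>n x. x \<in> F n \<Longrightarrow> \<sigma> n x - x \<in> N n"
    and \<sigma>\<delta>: "\<And>n x. x \<in> F (Suc n) \<Longrightarrow> \<sigma> n (\<delta> (Suc n) x) - \<delta> (Suc n) (\<sigma> (Suc n) x) \<in> N' n"
    and exact: "\<And>n x. x \<in> F n \<Longrightarrow> n = 0 \<or> \<delta> n x \<in> N' (n - 1) \<Longrightarrow>
      \<exists>y\<in>F (Suc n). x - \<sigma> n x - \<delta> (Suc n) y \<in> N' n"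
  shows "vs_iso (vs_homology C d n) (vs_homology C' d' n)"
proof -
  interpret P: presented s "C m" "F m" "N m" "c m" for m by (rule P)
  interpret P': presented s "C' m" "F m" "N' m" "c' m" for m by (rule P)
  interpret D: module_hom s s "\<delta> m" for m by (rule hom)
  interpret S: module_hom s s "\<sigma> m" for m by (rule hom)
  note N'_add = P.subspace_add[OF P'.N] and N'_diff = P.subspace_diff[OF P'.N]
    and N_add = P.subspace_add[OF P.N] and N'_0 = P.subspace_0[OF P'.N]
  obtain h where h: "presented s (vs_homology C d n) {x \<in> F n. n = 0 \<or> \<delta> n x \<in> N (n - 1)}
     {x \<in> F n. (n = 0 \<or> \<delta> n x \<in> N (n - 1)) \<and> (\<exists>y\<in>F (Suc n). x - \<delta> (Suc n) y \<in> N n)} h"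
    using presented_homology[of s C F N c \<delta> d n, OF P(1) hom(1) \<delta> d(1)] by blast
  obtain h' where h': "presented s (vs_homology C' d' n) {x \<in> F n. n = 0 \<or> \<delta> n x \<in> N' (n - 1)}
     {x \<in> F n. (n = 0 \<or> \<delta> n x \<in> N' (n - 1)) \<and> (\<exists>y\<in>F (Suc n). x - \<delta> (Suc n) y \<in> N' n)} h'"
    using presented_homology[of s C' F N' c' \<delta> d' n, OF P(2) hom(1) \<delta> d(2)] by blast
  have \<delta>N: "n = 0 \<or> \<delta> n (\<sigma> n x) \<in> N' (n - 1)" if "x \<in> F n" "n = 0 \<or> \<delta> n x \<in> N (n - 1)" for x
  proof (cases n)
    case (Suc m)
    then have "\<sigma> m (\<delta> (Suc m) x) \<in> N' m" using that \<sigma>N by auto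
    moreover have "\<sigma> m (\<delta> (Suc m) x) - \<delta> (Suc m) (\<sigma> (Suc m) x) \<in> N' m"
      using that Suc by (intro \<sigma>\<delta>) simp
    ultimately have "\<delta> (Suc m) (\<sigma> (Suc m) x) \<in> N' m" using N'_diff by (metis diff_diff_eq2 add_diff_cancel_left')
    then show ?thesis using Suc by simp
  qed simp
  show ?thesis
  \<comment> \<open>The isomorphism is induced by \<open>\<sigma>\<close>, from the homology of
    \<open>F / N\<close> to that of \<open>F / N'\<close>. Facts 1 and 2 below compare boundaries in
    the two quotients, in either direction.\<close>
  proof (rule vs_iso_presented[OF h h' hom(2)[of n]])
    fix x assume "x \<in> {x \<in> F n. n = 0 \<or> \<delta> n x \<in> N (n - 1)}"
    then have x: "x \<in> F n" "n = 0 \<or> \<delta> n x \<in> N (n - 1)" by auto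
    show Z: "\<sigma> n x \<in> {x \<in> F n. n = 0 \<or> \<delta> n x \<in> N' (n - 1)}"
      using x \<sigma> \<delta>N by auto
    have 1: "x - \<delta> (Suc n) y \<in> N n" if "y \<in> F (Suc n)" "\<sigma> n x - \<delta> (Suc n) y \<in> N' n" for y
    proof -
      have "(\<sigma> n x - \<delta> (Suc n) y) - (\<sigma> n x - x) \<in> N n"
        by (rule P.subspace_diff[OF P.N]) (use that N \<sigma>_id x in auto)
      then show ?thesis by simp
    qed
    have 2: "\<sigma> n x - \<delta> (Suc n) (\<sigma> (Suc n) y) \<in> N' n"
      if "y \<in> F (Suc n)" "x - \<delta> (Suc n) y \<in> N n" for y
    proof -
      have "\<sigma> n (x - \<delta> (Suc n) y) + (\<sigma> n (\<delta> (Suc n) y) - \<delta> (Suc n) (\<sigma> (Suc n) y)) \<in> N' n"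
        by (rule N'_add) (use that \<sigma>N \<sigma>\<delta> in auto)
      then show ?thesis by (simp add: S.diff)
    qed
    have "(\<exists>y\<in>F (Suc n). \<sigma> n x - \<delta> (Suc n) y \<in> N' n) \<longleftrightarrow> (\<exists>y\<in>F (Suc n). x - \<delta> (Suc n) y \<in> N n)"
      using 1 2 \<sigma> by meson
    then show "\<sigma> n x \<in> {x \<in> F n. (n = 0 \<or> \<delta> n x \<in> N' (n - 1)) \<and> (\<exists>y\<in>F (Suc n). x - \<delta> (Suc n) y \<in> N' n)}
      \<longleftrightarrow> x \<in> {x \<in> F n. (n = 0 \<or> \<delta> n x \<in> N (n - 1)) \<and> (\<exists>y\<in>F (Suc n). x - \<delta> (Suc n) y \<in> N n)}"
      using x Z by simp
  next
    fix y assume "y \<in> {x \<in> F n. n = 0 \<or> \<delta> n x \<in> N' (n - 1)}"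
    then have y: "y \<in> F n" "n = 0 \<or> \<delta> n y \<in> N' (n - 1)" by auto
    then have y': "n = 0 \<or> \<delta> n y \<in> N (n - 1)" using N by auto
    \<comment> \<open>Surjectivity: the preimage of the class of \<open>y\<close> is represented by
      \<open>y\<close> itself, since \<open>exact\<close> makes the cycle
      \<open>y - \<sigma> n y\<close> a boundary.\<close>
    have "n = 0 \<or> \<delta> n (y - \<sigma> n y) \<in> N' (n - 1)"
      using y(2) \<delta>N[OF y(1) y'] N'_diff unfolding D.diff by blast
    then show "\<exists>x\<in>{x \<in> F n. n = 0 \<or> \<delta> n x \<in> N (n - 1)}. y - \<sigma> n x \<in>
       {x \<in> F n. (n = 0 \<or> \<delta> n x \<in> N' (n - 1)) \<and> (\<exists>y\<in>F (Suc n). x - \<delta> (Suc n) y \<in> N' n)}"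
      using y y' exact[OF y] \<sigma>[OF y(1)] P.Fdiff by (intro bexI[of _ y]) simp_all
  qed
qed

section \<open>Split presimplicial quotients\<close>

lemma (in module) sum_diff_mem:
  assumes "subspace N" "\<And>i. i \<in> I \<Longrightarrow> f i - g i \<in> N"
  shows "sum f I - sum g I \<in> N"
  unfolding sum_subtractf[symmetric] by (rule subspace_sum) (use assms in auto)

lemma module_hom_sum:
  assumes "module s" "module s'" "\<And>i. i \<in> I \<Longrightarrow> module_hom s s' (f i)"
  shows "module_hom s s' (\<lambda>x. \<Sum>i\<in>I. f i x)"
proof -
  interpret A: module s by fact
  interpret B: module s' by fact
  show ?thesis
  proof unfold_locales
    show "(\<Sum>i\<in>I. f i (x + y)) = (\<Sum>i\<in>I. f i x) + (\<Sum>i\<in>I. f i y)" for x y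
      unfolding sum.distrib[symmetric] by (rule sum.cong[OF refl]) (rule module_hom.add[OF assms(3)])
    show "(\<Sum>i\<in>I. f i (s c x)) = s' c (\<Sum>i\<in>I. f i x)" for c x
      unfolding B.scale_sum_right by (rule sum.cong[OF refl]) (rule module_hom.scale[OF assms(3)])
  qed
qed

lemma module_hom_scale_comp:
  assumes "module_hom s s' f"
  shows "module_hom s s' (\<lambda>x. s' c (f x))"
proof -
  interpret module_hom s s' f by fact
  show ?thesis by unfold_locales (simp_all add: add scale m2.scale_right_distrib mult.commute)
qed

text \<open>The sign cancellation behind the passage from a simplicial homotopy to a chain homotopy.\<close>

lemma simplicial_homotopy_sum:
  fixes A C :: "nat \<Rightarrow> nat \<Rightarrow> 'u::ab_group_add"
  assumes "\<And>i j. i < j \<Longrightarrow> A i j = - C i (j - 1)" "\<And>i j. Suc j < i \<Longrightarrow> A i j = - C (i - 1) j"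
    and "\<And>j. A j j = e j" "\<And>j. A (Suc j) j = - e (Suc j)"
  shows "(\<Sum>j<M. \<Sum>i<Suc M. A i j) = e 0 - e M - (\<Sum>i<M. \<Sum>j<M - 1. C i j)"
proof (induction M)
  case (Suc M)
  \<comment> \<open>The enlarged index range adds row \<open>Suc M\<close> and column
    \<open>M\<close>. Their off-diagonal parts supply the new \<open>C\<close> terms, and the two
    remaining entries add up to \<open>e M - e (Suc M)\<close>, which telescopes.\<close>
  have "(\<Sum>j<Suc M. \<Sum>i<Suc (Suc M). A i j) =
      (\<Sum>j<M. \<Sum>i<Suc M. A i j) + (\<Sum>j<M. A (Suc M) j) + (\<Sum>i<M. A i M) + A M M + A (Suc M) M"
    by (simp add: sum.distrib algebra_simps)
  also have "(\<Sum>j<M. A (Suc M) j) = - (\<Sum>j<M. C M j)"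
    by (simp add: assms(2) sum_negf)
  also have "(\<Sum>i<M. A i M) = - (\<Sum>i<M. C i (M - 1))"
    by (simp add: assms(1) sum_negf)
  also note Suc.IH
  also have "e 0 - e M - S + - P + - Q + A M M + A (Suc M) M = e 0 - e (Suc M) - (S + Q + P)" for S P Q
    by (simp add: assms(3,4))
  finally have 1: "(\<Sum>j<Suc M. \<Sum>i<Suc (Suc M). A i j) = e 0 - e (Suc M) -
      ((\<Sum>i<M. \<Sum>j<M - 1. C i j) + (\<Sum>i<M. C i (M - 1)) + (\<Sum>j<M. C M j))" .
  have "(\<Sum>i<M. \<Sum>j<M - 1. C i j) + (\<Sum>i<M. C i (M - 1)) = (\<Sum>i<M. \<Sum>j<M. C i j)"
    by (cases M) (simp_all add: sum.distrib)
  then have "(\<Sum>i<M. \<Sum>j<M - 1. C i j) + (\<Sum>i<M. C i (M - 1)) + (\<Sum>j<M. C M j) =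
      (\<Sum>i<Suc M. \<Sum>j<Suc M - 1. C i j)" by simp
  then show ?case using 1 by (simp only:)
qed simp

text \<open>
  Presimplicial spaces \<open>F n / NK n\<close> and \<open>F n / NB n\<close>: the operators \<open>\<sigma>\<close> induce a section of the
  projection, and \<open>h\<close> is a simplicial homotopy from the identity of the first to \<open>\<sigma>\<close>.
\<close>

locale splitting = vector_space s
  for s :: "'k::field \<Rightarrow> 'u::ab_group_add \<Rightarrow> 'u" +
  fixes F NK NB :: "nat \<Rightarrow> 'u set" and \<delta> h :: "nat \<Rightarrow> nat \<Rightarrow> 'u \<Rightarrow> 'u" and \<sigma> :: "nat \<Rightarrow> 'u \<Rightarrow> 'u"
  assumes F: "\<And>n. subspace (F n)" and NK: "\<And>n. subspace (NK n)"
    and NK_NB: "\<And>n. NK n \<subseteq> NB n" and NB_F: "\<And>n. NB n \<subseteq> F n"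
    and \<delta>_hom: "\<And>n i. module_hom s s (\<delta> n i)"
    and h_hom: "\<And>n i. module_hom s s (h n i)"
    and \<sigma>_hom: "\<And>n. module_hom s s (\<sigma> n)"
    and \<delta>_F: "\<And>n i x. i \<le> Suc n \<Longrightarrow> x \<in> F (Suc n) \<Longrightarrow> \<delta> (Suc n) i x \<in> F n"
    and \<sigma>_F: "\<And>n x. x \<in> F n \<Longrightarrow> \<sigma> n x \<in> F n"
    and \<sigma>_NB: "\<And>n x. x \<in> NB n \<Longrightarrow> \<sigma> n x \<in> NK n"
    and \<sigma>_id: "\<And>n x. x \<in> F n \<Longrightarrow> \<sigma> n x - x \<in> NB n"
    and \<sigma>_\<delta>: "\<And>n i x. i \<le> Suc n \<Longrightarrow> x \<in> F (Suc n) \<Longrightarrow> \<sigma> n (\<delta> (Suc n) i x) - \<delta> (Suc n) i (\<sigma> (Suc n) x) \<in> NK n"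
    and h_F: "\<And>n j x. j \<le> n \<Longrightarrow> x \<in> F n \<Longrightarrow> h n j x \<in> F (Suc n)"
    and h_NK: "\<And>n j x. j \<le> n \<Longrightarrow> x \<in> NK n \<Longrightarrow> h n j x \<in> NK (Suc n)"
    and h_first: "\<And>n x. x \<in> F n \<Longrightarrow> \<delta> (Suc n) 0 (h n 0 x) - x \<in> NK n"
    and h_last: "\<And>n x. x \<in> F n \<Longrightarrow> \<delta> (Suc n) (Suc n) (h n n x) - \<sigma> n x \<in> NK n"
    and h_mid: "\<And>n j x. j < n \<Longrightarrow> x \<in> F n \<Longrightarrow>
      \<delta> (Suc n) (Suc j) (h n j x) - \<delta> (Suc n) (Suc j) (h n (Suc j) x) \<in> NK n"
    and h_low: "\<And>n i j x. i < j \<Longrightarrow> j \<le> Suc n \<Longrightarrow> x \<in> F (Suc n) \<Longrightarrow>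
      \<delta> (Suc (Suc n)) i (h (Suc n) j x) - h n (j - 1) (\<delta> (Suc n) i x) \<in> NK (Suc n)"
    and h_high: "\<And>n i j x. Suc j < i \<Longrightarrow> i \<le> Suc (Suc n) \<Longrightarrow> x \<in> F (Suc n) \<Longrightarrow>
      \<delta> (Suc (Suc n)) i (h (Suc n) j x) - h n j (\<delta> (Suc n) (i - 1) x) \<in> NK (Suc n)"
begin

sublocale \<delta>: module_hom s s "\<delta> n i" for n i by (rule \<delta>_hom)
sublocale h: module_hom s s "h n i" for n i by (rule h_hom)
sublocale \<sigma>: module_hom s s "\<sigma> n" for n by (rule \<sigma>_hom)

definition cong :: "nat \<Rightarrow> 'u \<Rightarrow> 'u \<Rightarrow> bool" where "cong n x y \<longleftrightarrow> x - y \<in> NK n"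

lemma cong_refl [simp]: "cong n x x" by (simp add: cong_def subspace_0[OF NK])

lemma cong_sym: "cong n x y \<Longrightarrow> cong n y x"
  using subspace_neg[OF NK, of "x - y" n] by (simp add: cong_def)

lemma cong_trans [trans]: "cong n x y \<Longrightarrow> cong n y z \<Longrightarrow> cong n x z"
  using subspace_add[OF NK, of "x - y" n "y - z"] by (simp add: cong_def)

lemma cong_add: "cong n x y \<Longrightarrow> cong n x' y' \<Longrightarrow> cong n (x + x') (y + y')"
  using subspace_add[OF NK, of "x - y" n "x' - y'"] by (simp add: cong_def algebra_simps)

lemma cong_diff: "cong n x y \<Longrightarrow> cong n x' y' \<Longrightarrow> cong n (x - x') (y - y')"
  using subspace_diff[OF NK, of "x - y" n "x' - y'"] by (simp add: cong_def algebra_simps)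

lemma cong_minus: "cong n x y \<Longrightarrow> cong n (- x) (- y)"
  using cong_diff[of n 0 0 x y] by simp

lemma cong_scale: "cong n x y \<Longrightarrow> cong n (s c x) (s c y)"
  using subspace_scale[OF NK, of "x - y" n c] by (simp add: cong_def scale_right_diff_distrib)

lemma cong_sum: "(\<And>i. i \<in> I \<Longrightarrow> cong n (f i) (g i)) \<Longrightarrow> cong n (sum f I) (sum g I)"
  unfolding cong_def by (rule sum_diff_mem[OF NK])

lemma cong_0: "cong n x 0 \<longleftrightarrow> x \<in> NK n" by (simp add: cong_def)

lemma cong_hom:
  assumes "module_hom s s f" "\<And>x. x \<in> NK n \<Longrightarrow> f x \<in> NK m" "cong n x y"
  shows "cong m (f x) (f y)"
  using assms module_hom.diff[OF assms(1)] by (simp add: cong_def flip: module_hom.diff[OF assms(1)])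

lemma \<sigma>_NK: "x \<in> NK n \<Longrightarrow> \<sigma> n x \<in> NK n" using NK_NB \<sigma>_NB by blast

lemma \<sigma>_cong: "cong n x y \<Longrightarrow> cong n (\<sigma> n x) (\<sigma> n y)"
  by (rule cong_hom[OF \<sigma>_hom \<sigma>_NK])

text \<open>Modulo \<open>NK\<close> the operator \<open>\<sigma>\<close> is idempotent, and this is
  the complementary projection, onto the kernel of
  \<open>F / NK \<rightarrow> F / NB\<close>.\<close>

definition \<pi> :: "nat \<Rightarrow> 'u \<Rightarrow> 'u" where "\<pi> n x = x - \<sigma> n x"

lemma \<pi>_F: "x \<in> F n \<Longrightarrow> \<pi> n x \<in> F n"
  by (simp add: \<pi>_def subspace_diff[OF F] \<sigma>_F)

lemma \<sigma>_\<pi>: "x \<in> F n \<Longrightarrow> \<sigma> n (\<pi> n x) \<in> NK n"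
  using subspace_neg[OF NK, OF \<sigma>_NB[OF \<sigma>_id]]
  by (simp add: \<pi>_def \<sigma>.diff)

definition \<beta> :: "nat \<Rightarrow> 'u \<Rightarrow> 'u" where "\<beta> n x = (\<Sum>i<Suc n. s ((- 1) ^ i) (\<delta> n i x))"
definition H :: "nat \<Rightarrow> 'u \<Rightarrow> 'u" where "H n x = (\<Sum>j<Suc n. s ((- 1) ^ j) (h n j x))"

lemma \<beta>_hom: "module_hom s s (\<beta> n)"
  unfolding \<beta>_def by (intro module_hom_sum module_hom_scale_comp module_axioms \<delta>_hom)

lemma \<beta>_F: "x \<in> F (Suc n) \<Longrightarrow> \<beta> (Suc n) x \<in> F n"
  unfolding \<beta>_def by (intro subspace_sum subspace_scale F \<delta>_F) auto

lemma H_F: "x \<in> F n \<Longrightarrow> H n x \<in> F (Suc n)"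
  unfolding H_def by (intro subspace_sum subspace_scale F h_F) auto

lemma H_NK: "x \<in> NK n \<Longrightarrow> H n x \<in> NK (Suc n)"
  unfolding H_def by (intro subspace_sum subspace_scale NK h_NK) auto

lemma \<sigma>_\<beta>: "x \<in> F (Suc n) \<Longrightarrow> cong n (\<sigma> n (\<beta> (Suc n) x)) (\<beta> (Suc n) (\<sigma> (Suc n) x))"
  unfolding \<beta>_def \<sigma>.sum \<sigma>.scale
  by (intro cong_sum cong_scale) (simp add: cong_def \<sigma>_\<delta>)

lemma homotopy_0: "x \<in> F 0 \<Longrightarrow> cong 0 (\<beta> (Suc 0) (H 0 x)) (\<pi> 0 x)"
  using cong_diff[of 0 "\<delta> (Suc 0) 0 (h 0 0 x)" x "\<delta> (Suc 0) (Suc 0) (h 0 0 x)" "\<sigma> 0 x"]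
    h_first[of x 0] h_last[of x 0]
  by (simp add: \<beta>_def H_def \<pi>_def cong_def)

lemma homotopy_Suc:
  assumes x: "x \<in> F (Suc n)"
  shows "cong (Suc n) (\<beta> (Suc (Suc n)) (H (Suc n) x)) (\<pi> (Suc n) x - H n (\<beta> (Suc n) x))"
proof -
  let ?m = "Suc n"
  define a where "a i j = \<delta> (Suc ?m) i (h ?m j x)" for i j
  define C where "C i j = s ((- 1) ^ (i + j)) (h n j (\<delta> ?m i x))" for i j
  \<comment> \<open>The homotopy identities hold only modulo \<open>NK\<close>, whereas the
    cancellation lemma wants equations. So \<open>A\<close> is defined to satisfy them exactly and
    is congruent to the signed terms \<open>a\<close>. For \<open>0 < j < Suc ?m\<close>,
    \<open>e j\<close> stands for the common value of face \<open>j\<close> on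
    \<open>h (j - 1)\<close> and on \<open>h j\<close>; the ends are the identity and
    \<open>\<sigma>\<close>.\<close>
  define e where "e j = (if j = 0 then x else if j = Suc ?m then \<sigma> ?m x else a j j)" for j
  define A where "A i j = (if i < j then - C i (j - 1) else if Suc j < i then - C (i - 1) j
    else if i = j then e j else - e i)" for i j
  have aA: "cong ?m (s ((- 1) ^ (i + j)) (a i j)) (A i j)" if "j < Suc ?m" "i < Suc (Suc ?m)" for i j
  proof -
    consider "i < j" | "Suc j < i" | "i = j" | "i = Suc j" by linarith
    then show ?thesis
    proof cases
      case 1
      have "cong ?m (a i j) (h n (j - 1) (\<delta> ?m i x))"
        using 1 that x h_low[of i j n x] by (simp add: a_def cong_def)
      moreover have "s ((- 1) ^ (i + j)) (h n (j - 1) (\<delta> ?m i x)) = A i j"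
        using 1 by (cases j) (simp_all add: A_def C_def)
      ultimately show ?thesis using cong_scale by metis
    next
      case 2
      have "cong ?m (a i j) (h n j (\<delta> ?m (i - 1) x))"
        using 2 that x h_high[of j i n x] by (simp add: a_def cong_def)
      moreover have "s ((- 1) ^ (i + j)) (h n j (\<delta> ?m (i - 1) x)) = A i j"
        using 2 by (cases i) (simp_all add: A_def C_def)
      ultimately show ?thesis using cong_scale by metis
    next
      case 3
      have "cong ?m (a j j) (e j)"
        using that 3 h_first[OF x] by (auto simp: e_def a_def cong_def subspace_0[OF NK])
      then show ?thesis using 3 by (simp add: A_def flip: mult_2)
    next
      case 4
      have "cong ?m (a (Suc j) j) (e (Suc j))"
        using that 4 h_last[OF x] h_mid[OF _ x, of j]
        by (auto simp: e_def a_def cong_def less_Suc_eq)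
      then show ?thesis using 4 cong_minus by (simp add: A_def flip: mult_2)
    qed
  qed
  have "\<beta> (Suc ?m) (H ?m x) = (\<Sum>i<Suc (Suc ?m). \<Sum>j<Suc ?m. s ((- 1) ^ (i + j)) (a i j))"
    unfolding \<beta>_def H_def \<delta>.sum \<delta>.scale scale_sum_right a_def by (simp add: power_add)
  also have "\<dots> = (\<Sum>j<Suc ?m. \<Sum>i<Suc (Suc ?m). s ((- 1) ^ (i + j)) (a i j))"
    by (rule sum.swap)
  also have "cong ?m \<dots> (\<Sum>j<Suc ?m. \<Sum>i<Suc (Suc ?m). A i j)"
    by (intro cong_sum) (use aA in auto)
  also have "(\<Sum>j<Suc ?m. \<Sum>i<Suc (Suc ?m). A i j) =
      e 0 - e (Suc ?m) - (\<Sum>i<Suc ?m. \<Sum>j<Suc ?m - 1. C i j)"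
    by (rule simplicial_homotopy_sum) (auto simp: A_def)
  also have "\<dots> = \<pi> ?m x - (\<Sum>j<?m. \<Sum>i<Suc ?m. C i j)"
    by (subst sum.swap) (simp add: e_def \<pi>_def)
  also have "(\<Sum>j<?m. \<Sum>i<Suc ?m. C i j) = H n (\<beta> ?m x)"
    unfolding \<beta>_def H_def h.sum h.scale scale_sum_right C_def by (simp add: power_add mult.commute)
  finally show ?thesis .
qed

lemma homotopy_cycle:
  assumes "x \<in> F n" "n = 0 \<or> \<beta> n x \<in> NK (n - 1)"
  shows "cong n (\<beta> (Suc n) (H n x)) (\<pi> n x)"
proof (cases n)
  case (Suc m)
  then have "cong n (\<pi> n x - H m (\<beta> n x)) (\<pi> n x - 0)"
    using assms by (intro cong_diff) (auto simp: cong_0 H_NK)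
  then show ?thesis using homotopy_Suc[of x m] assms Suc cong_trans by simp
qed (use assms homotopy_0 in simp)

text \<open>Moves a primitive of \<open>w\<close> into the kernel of \<open>\<sigma>\<close>: the
  part removed, \<open>f (\<sigma> y)\<close>, is congruent to \<open>\<sigma> w\<close>, which
  vanishes.\<close>

lemma \<pi>_lift:
  assumes f: "module_hom s s f" and y: "y \<in> F (Suc n)"
    and comm: "cong n (\<sigma> n (f y)) (f (\<sigma> (Suc n) y))"
    and w: "\<sigma> n w \<in> NK n" "cong n (f y) w"
  shows "cong n (f (\<pi> (Suc n) y)) w"
proof -
  have "f (\<pi> (Suc n) y) = f y - f (\<sigma> (Suc n) y)" by (simp add: \<pi>_def module_hom.diff[OF f])
  also have "cong n \<dots> (w - 0)"
  proof (rule cong_diff[OF w(2)])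
    have "cong n (\<sigma> n (f y)) 0"
      using cong_trans[OF \<sigma>_cong[OF w(2)], of 0] w(1) by (simp add: cong_0)
    then show "cong n (f (\<sigma> (Suc n) y)) 0" using cong_trans cong_sym comm by blast
  qed
  finally show ?thesis by simp
qed

text \<open>On the kernel of \<open>\<sigma>\<close> the projection \<open>\<pi>\<close> is the
  identity modulo \<open>NK\<close>, so \<open>H w\<close> is a primitive of the cycle
  \<open>w\<close>; applying \<open>\<pi>\<close> returns it to the kernel.\<close>

lemma \<beta>_exact:
  assumes w: "w \<in> F n" "\<sigma> n w \<in> NK n" "n = 0 \<or> \<beta> n w \<in> NK (n - 1)"
  shows "\<exists>y\<in>F (Suc n). \<sigma> (Suc n) y \<in> NK (Suc n) \<and> cong n (\<beta> (Suc n) y) w"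
proof (rule bexI[of _ "\<pi> (Suc n) (H n w)"], rule conjI)
  have "cong n (\<pi> n w) w" using w(2) subspace_neg[OF NK] by (simp add: \<pi>_def cong_def)
  then show "cong n (\<beta> (Suc n) (\<pi> (Suc n) (H n w))) w"
    using cong_trans[OF homotopy_cycle[OF w(1,3)]] w
    by (intro \<pi>_lift[OF \<beta>_hom] H_F \<sigma>_\<beta>) auto
qed (use w in \<open>auto intro!: \<pi>_F H_F \<sigma>_\<pi>\<close>)

end

text \<open>The number \<open>m\<close> of faces is a parameter so that the computation serves both
  \<open>b_diff\<close> and \<open>b'_diff\<close>.\<close>

lemma b_diff_presented:
  assumes "presented s (Z n) (F n) (N n) (c n)"
    and "\<And>i. i < m \<Longrightarrow> d (Suc n) i (c (Suc n) x) = c n (\<delta> i)"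
    and "\<And>i. i < m \<Longrightarrow> \<delta> i \<in> F n"
  shows "vs_sum (Z n) (\<lambda>i. vscale (Z n) ((- 1) ^ i) (d (Suc n) i (c (Suc n) x))) m =
    c n (\<Sum>i<m. s ((- 1) ^ i) (\<delta> i))"
proof -
  interpret presented s "Z n" "F n" "N n" "c n" by fact
  have cong: "vs_sum (Z n) f k = vs_sum (Z n) g k" if "\<And>i. i < k \<Longrightarrow> f i = g i" for f g k
    using that by (induction k) auto
  show ?thesis
    by (subst vs_sum_cls[symmetric]) (use assms(2,3) in \<open>auto intro!: cong simp: scl Fscale\<close>)
qed

locale presented_splitting = splitting s F NK NB \<delta> h \<sigma>
  for s :: "'k::field \<Rightarrow> 'u::ab_group_add \<Rightarrow> 'u" and F NK NB \<delta> h \<sigma> +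
  fixes Z Z' :: "nat \<Rightarrow> ('k, 'v) vspace" and c c' :: "nat \<Rightarrow> 'u \<Rightarrow> 'v" and d d' :: "nat \<Rightarrow> nat \<Rightarrow> 'v \<Rightarrow> 'v"
  assumes Z: "\<And>n. presented s (Z n) (F n) (NB n) (c n)"
    and Z': "\<And>n. presented s (Z' n) (F n) (NK n) (c' n)"
    and d: "\<And>n i x. i \<le> Suc n \<Longrightarrow> x \<in> F (Suc n) \<Longrightarrow> d (Suc n) i (c (Suc n) x) = c n (\<delta> (Suc n) i x)"
    and d': "\<And>n i x. i \<le> Suc n \<Longrightarrow> x \<in> F (Suc n) \<Longrightarrow> d' (Suc n) i (c' (Suc n) x) = c' n (\<delta> (Suc n) i x)"
begin

lemma b_diff_cls:
  assumes "x \<in> F (Suc n)"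
  shows "b_diff Z d (Suc n) (c (Suc n) x) = c n (\<beta> (Suc n) x)"
    "b_diff Z' d' (Suc n) (c' (Suc n) x) = c' n (\<beta> (Suc n) x)"
  unfolding b_diff_def \<beta>_def
  using b_diff_presented[of s Z n F NB c "Suc (Suc n)" d x "\<lambda>i. \<delta> (Suc n) i x"]
    b_diff_presented[of s Z' n F NK c' "Suc (Suc n)" d' x "\<lambda>i. \<delta> (Suc n) i x"]
    Z[of n] Z'[of n] d d' \<delta>_F assms by auto

theorem vs_iso_hochschild: "vs_iso (vs_homology Z (b_diff Z d) n) (vs_homology Z' (b_diff Z' d') n)"
proof (rule vs_iso_homology[where \<delta> = \<beta> and \<sigma> = \<sigma>, OF Z Z' \<beta>_hom \<sigma>_hom])
  fix m x assume x: "x \<in> F m" "m = 0 \<or> \<beta> m x \<in> NK (m - 1)"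
  show "\<exists>y\<in>F (Suc m). x - \<sigma> m x - \<beta> (Suc m) y \<in> NK m"
    using cong_sym[OF homotopy_cycle[OF x]] H_F[OF x(1)] unfolding cong_def \<pi>_def by blast
qed (use \<beta>_F b_diff_cls \<sigma>_F NK_NB \<sigma>_NB \<sigma>_id \<sigma>_\<beta> in \<open>auto simp: cong_def\<close>)

end

section \<open>Split cyclic quotients\<close>

definition tscale :: "('k \<Rightarrow> 'u \<Rightarrow> 'u) \<Rightarrow> 'k \<Rightarrow> (nat \<Rightarrow> 'u) \<Rightarrow> nat \<Rightarrow> 'u" where
  "tscale s c x = (\<lambda>p. s c (x p))"

lemma vector_space_tscale:
  assumes "vector_space s"
  shows "vector_space (tscale s)"
proof -
  interpret vector_space s by fact
  show ?thesis
    by unfold_locales (auto simp: tscale_def plus_fun_def scale_right_distrib scale_left_distrib)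
qed

text \<open>Representatives are total functions with arbitrary values beyond position
  \<open>n\<close>, so that all degrees live in one vector space; truncation happens only in the
  class map.\<close>

lemma presented_tsygan_tot:
  assumes P: "\<And>n. presented s (Z n) (F n) (N n) (c n)"
  shows "presented (tscale s) (tsygan_tot Z n) {x. \<forall>p\<le>n. x p \<in> F (n - p)} {x. \<forall>p\<le>n. x p \<in> N (n - p)}
    (\<lambda>x. \<lambda>p\<in>{..n}. c (n - p) (x p))"
proof -
  interpret P: presented s "Z m" "F m" "N m" "c m" for m by (rule P)
  interpret T: vector_space "tscale s" by (rule vector_space_tscale) unfold_locales
  have sub: "T.subspace {x. \<forall>p\<le>n. x p \<in> G (n - p)}" if "\<And>m. P.subspace (G m)" for G
    using that unfolding P.subspace_def T.subspace_def by (auto simp: tscale_def)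
  have carrier: "vcarrier (tsygan_tot Z n) =
      (\<lambda>x. \<lambda>p\<in>{..n}. c (n - p) (x p)) ` {x. \<forall>p\<le>n. x p \<in> F (n - p)}" (is "_ = ?f ` ?F")
  proof (intro set_eqI iffI)
    fix u assume u: "u \<in> vcarrier (tsygan_tot Z n)"
    then have "\<forall>p\<in>{..n}. \<exists>x. x \<in> F (n - p) \<and> u p = c (n - p) x"
      by (auto simp: tsygan_tot_def P.carrier PiE_iff)
    then obtain x where x: "\<And>p. p \<le> n \<Longrightarrow> x p \<in> F (n - p) \<and> u p = c (n - p) (x p)"
      by (metis atMost_iff)
    moreover have "u p = undefined" if "\<not> p \<le> n" for p
      using u that by (auto simp: tsygan_tot_def PiE_iff extensional_def)
    ultimately have "u = ?f x" by (auto simp: fun_eq_iff)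
    then show "u \<in> ?f ` ?F" using x by blast
  qed (auto simp: tsygan_tot_def P.carrier PiE_iff)
  show ?thesis
  proof unfold_locales
    fix x y assume "x \<in> {x. \<forall>p\<le>n. x p \<in> F (n - p)}" "y \<in> {x. \<forall>p\<le>n. x p \<in> F (n - p)}"
    then have "(\<forall>p\<le>n. c (n - p) (x p) = c (n - p) (y p)) \<longleftrightarrow> (\<forall>p\<le>n. x p - y p \<in> N (n - p))"
      using P.cls by blast
    moreover have "?f x = ?f y \<longleftrightarrow> (\<forall>p\<le>n. c (n - p) (x p) = c (n - p) (y p))"
      by (auto simp: fun_eq_iff restrict_def)
    ultimately show "?f x = ?f y \<longleftrightarrow> x - y \<in> {x. \<forall>p\<le>n. x p \<in> N (n - p)}"
      by simp
  qed (use sub[OF P.F] sub[OF P.N] subsetD[OF P.N_F] carrier in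
      \<open>auto simp: tsygan_tot_def P.zero P.add P.scl tscale_def intro!: restrict_ext\<close>)
qed

text \<open>Here \<open>t\<close> is the unsigned cyclic operator and \<open>\<eta>\<close> the
  extra degeneracy. Permuting entries and prepending \<open>1\<close> involve no relations, so the
  identities of \<open>t\<close> and \<open>\<eta>\<close> with the faces are equations on
  \<open>F\<close>; only the compatibility with \<open>\<sigma>\<close> is a congruence.\<close>

locale cyclic_splitting = splitting s F NK NB \<delta> h \<sigma>
  for s :: "'k::field \<Rightarrow> 'u::ab_group_add \<Rightarrow> 'u" and F NK NB \<delta> h \<sigma> +
  fixes t \<eta> :: "nat \<Rightarrow> 'u \<Rightarrow> 'u"
  assumes t_hom: "\<And>n. module_hom s s (t n)"
    and \<eta>_hom: "\<And>n. module_hom s s (\<eta> n)"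
    and t_F: "\<And>n x. x \<in> F n \<Longrightarrow> t n x \<in> F n"
    and t_NK: "\<And>n x. x \<in> NK n \<Longrightarrow> t n x \<in> NK n"
    and t_pow: "\<And>n x. x \<in> F n \<Longrightarrow> (t n ^^ Suc n) x = x"
    and \<sigma>_t: "\<And>n x. x \<in> F n \<Longrightarrow> \<sigma> n (t n x) - t n (\<sigma> n x) \<in> NK n"
    and \<delta>_0_t: "\<And>n x. x \<in> F (Suc n) \<Longrightarrow> \<delta> (Suc n) 0 (t (Suc n) x) = \<delta> (Suc n) (Suc n) x"
    and \<delta>_Suc_t: "\<And>n i x. i \<le> n \<Longrightarrow> x \<in> F (Suc n) \<Longrightarrow>
      \<delta> (Suc n) (Suc i) (t (Suc n) x) = t n (\<delta> (Suc n) i x)"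
    and \<eta>_F: "\<And>n x. x \<in> F n \<Longrightarrow> \<eta> n x \<in> F (Suc n)"
    and \<eta>_NK: "\<And>n x. x \<in> NK n \<Longrightarrow> \<eta> n x \<in> NK (Suc n)"
    and \<delta>_0_\<eta>: "\<And>n x. x \<in> F n \<Longrightarrow> \<delta> (Suc n) 0 (\<eta> n x) = x"
    and \<delta>_Suc_\<eta>: "\<And>n i x. i \<le> n \<Longrightarrow> x \<in> F (Suc n) \<Longrightarrow>
      \<delta> (Suc (Suc n)) (Suc i) (\<eta> (Suc n) x) = \<eta> n (\<delta> (Suc n) i x)"
begin

sublocale t: module_hom s s "t n" for n by (rule t_hom)
sublocale \<eta>: module_hom s s "\<eta> n" for n by (rule \<eta>_hom)

definition T :: "nat \<Rightarrow> 'u \<Rightarrow> 'u" where "T n x = s ((- 1) ^ n) (t n x)"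
definition Nm :: "nat \<Rightarrow> 'u \<Rightarrow> 'u" where "Nm n x = (\<Sum>i<Suc n. (T n ^^ i) x)"
definition \<beta>' :: "nat \<Rightarrow> 'u \<Rightarrow> 'u" where "\<beta>' n x = (\<Sum>i<n. s ((- 1) ^ i) (\<delta> n i x))"
text \<open>With the sign carried by the face, the commutation rules with the signed operator
  \<open>T\<close> become free of signs.\<close>

definition D :: "nat \<Rightarrow> nat \<Rightarrow> 'u \<Rightarrow> 'u" where "D n i x = s ((- 1) ^ i) (\<delta> n i x)"

section \<open>Signed cyclic operator, norm and the identities of the Tsygan double complex\<close>

lemma T_hom: "module_hom s s (T n)"
  unfolding T_def by (intro module_hom_scale_comp t_hom)

sublocale T: module_hom s s "T n" for n by (rule T_hom)

lemma T_pow_hom: "module_hom s s (T n ^^ i)"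
proof (induction i)
  case 0
  show ?case by unfold_locales auto
next
  case (Suc i)
  then interpret module_hom s s "T n ^^ i" .
  show ?case by unfold_locales (simp_all add: add scale T.add T.scale)
qed

lemma Nm_hom: "module_hom s s (Nm n)"
  unfolding Nm_def by (intro module_hom_sum T_pow_hom module_axioms)

lemma \<beta>'_hom: "module_hom s s (\<beta>' n)"
  unfolding \<beta>'_def by (intro module_hom_sum module_hom_scale_comp module_axioms \<delta>_hom)

lemma T_F: "x \<in> F n \<Longrightarrow> T n x \<in> F n"
  unfolding T_def by (intro subspace_scale F t_F)

lemma T_NK: "x \<in> NK n \<Longrightarrow> T n x \<in> NK n"
  unfolding T_def by (intro subspace_scale NK t_NK)

lemma T_pow_F: "x \<in> F n \<Longrightarrow> (T n ^^ i) x \<in> F n"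
  by (induction i) (auto simp: T_F)

lemma T_pow_NK: "x \<in> NK n \<Longrightarrow> (T n ^^ i) x \<in> NK n"
  by (induction i) (auto simp: T_NK)

lemma Nm_F: "x \<in> F n \<Longrightarrow> Nm n x \<in> F n"
  unfolding Nm_def by (intro subspace_sum F T_pow_F)

lemma Nm_NK: "x \<in> NK n \<Longrightarrow> Nm n x \<in> NK n"
  unfolding Nm_def by (intro subspace_sum NK T_pow_NK)

lemma \<beta>'_F: "x \<in> F (Suc n) \<Longrightarrow> \<beta>' (Suc n) x \<in> F n"
  unfolding \<beta>'_def by (intro subspace_sum subspace_scale F \<delta>_F) auto

lemma D_F: "i \<le> Suc n \<Longrightarrow> x \<in> F (Suc n) \<Longrightarrow> D (Suc n) i x \<in> F n"
  unfolding D_def by (intro subspace_scale F \<delta>_F)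

lemma \<sigma>_T: "x \<in> F n \<Longrightarrow> cong n (\<sigma> n (T n x)) (T n (\<sigma> n x))"
  unfolding T_def \<sigma>.scale by (intro cong_scale) (simp add: cong_def \<sigma>_t)

lemma \<sigma>_T_pow: "x \<in> F n \<Longrightarrow> cong n (\<sigma> n ((T n ^^ i) x)) ((T n ^^ i) (\<sigma> n x))"
proof (induction i)
  case (Suc i)
  have "cong n (\<sigma> n ((T n ^^ Suc i) x)) (T n (\<sigma> n ((T n ^^ i) x)))"
    using \<sigma>_T[OF T_pow_F[OF Suc.prems]] by simp
  also have "cong n \<dots> (T n ((T n ^^ i) (\<sigma> n x)))"
    by (rule cong_hom[OF T_hom T_NK]) (use Suc in auto)
  finally show ?case by simp
qed simp

lemma \<sigma>_Nm: "x \<in> F n \<Longrightarrow> cong n (\<sigma> n (Nm n x)) (Nm n (\<sigma> n x))"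
  unfolding Nm_def \<sigma>.sum by (intro cong_sum \<sigma>_T_pow)

lemma \<sigma>_\<beta>': "x \<in> F (Suc n) \<Longrightarrow> cong n (\<sigma> n (\<beta>' (Suc n) x)) (\<beta>' (Suc n) (\<sigma> (Suc n) x))"
  unfolding \<beta>'_def \<sigma>.sum \<sigma>.scale
  by (intro cong_sum cong_scale) (simp add: cong_def \<sigma>_\<delta>)

lemma D_0_T: "x \<in> F (Suc n) \<Longrightarrow> D (Suc n) 0 (T (Suc n) x) = D (Suc n) (Suc n) x"
  by (simp add: D_def T_def \<delta>.scale \<delta>.neg \<delta>_0_t)

lemma D_Suc_T:
  "i \<le> n \<Longrightarrow> x \<in> F (Suc n) \<Longrightarrow> D (Suc n) (Suc i) (T (Suc n) x) = T n (D (Suc n) i x)"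
  by (simp add: D_def T_def \<delta>.scale \<delta>.neg t.scale \<delta>_Suc_t mult.commute)

lemma D_T_pow_le:
  assumes "x \<in> F (Suc n)"
  shows "j \<le> i \<Longrightarrow> i \<le> n \<Longrightarrow> D (Suc n) i ((T (Suc n) ^^ j) x) = (T n ^^ j) (D (Suc n) (i - j) x)"
proof (induction j arbitrary: i)
  case (Suc j)
  then obtain i' where i: "i = Suc i'" by (cases i) auto
  then show ?case using Suc D_Suc_T[of i' n "(T (Suc n) ^^ j) x"] T_pow_F[OF assms] by simp
qed simp

text \<open>Passing each factor \<open>T\<close> lowers the face index by one, cyclically modulo
  \<open>n + 2\<close>. The wrap from \<open>0\<close> to \<open>Suc n\<close> absorbs one factor,
  which explains the exponent \<open>j - 1\<close>.\<close>

lemma D_T_pow_gt: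
  assumes x: "x \<in> F (Suc n)" and "i < j" "i \<le> n" "j \<le> Suc n"
  shows "D (Suc n) i ((T (Suc n) ^^ j) x) = (T n ^^ (j - 1)) (D (Suc n) (Suc (Suc n) + i - j) x)"
proof -
  obtain k where j: "j = i + Suc k" using assms(2) less_imp_Suc_add by auto
  have last: "D (Suc n) (Suc n) ((T (Suc n) ^^ k) x) = (T n ^^ k) (D (Suc n) (Suc n - k) x)" if "k \<le> n"
    using that
  proof (induction k)
    case (Suc k)
    have "D (Suc n) (Suc n) ((T (Suc n) ^^ Suc k) x) = T n (D (Suc n) n ((T (Suc n) ^^ k) x))"
      using D_Suc_T[of n n "(T (Suc n) ^^ k) x"] T_pow_F[OF x] by simp
    also have "\<dots> = T n ((T n ^^ k) (D (Suc n) (n - k) x))"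
      using D_T_pow_le[OF x, of k n] Suc by simp
    finally show ?case by simp
  qed simp
  have "D (Suc n) i ((T (Suc n) ^^ j) x) = (T n ^^ i) (D (Suc n) 0 (T (Suc n) ((T (Suc n) ^^ k) x)))"
    using D_T_pow_le[of "(T (Suc n) ^^ Suc k) x" n i i] T_pow_F[OF x, of "Suc k"] assms(3)
    by (simp add: j funpow_add funpow_swap1)
  also have "\<dots> = (T n ^^ i) ((T n ^^ k) (D (Suc n) (Suc n - k) x))"
    using D_0_T T_pow_F[OF x] last assms j by simp
  finally show ?thesis by (simp add: j funpow_add)
qed

text \<open>The signs multiply to \<open>(-1)^(n (n + 1)) = 1\<close>.\<close>

lemma T_pow_Suc: "x \<in> F n \<Longrightarrow> (T n ^^ Suc n) x = x"
proof -
  assume x: "x \<in> F n"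
  have "(T n ^^ i) x = s ((- 1) ^ (n * i)) ((t n ^^ i) x)" for i
    by (induction i) (simp_all add: T_def t.scale power_add)
  moreover have "even (n * Suc n)" by simp
  ultimately show ?thesis using t_pow[OF x] by (metis power_minus_even power_one scale_one)
qed

lemma Nm_T: "x \<in> F n \<Longrightarrow> Nm n (T n x) = Nm n x"
  unfolding Nm_def using T_pow_Suc[of x n]
  by (subst (2) sum.lessThan_Suc_shift, subst sum.lessThan_Suc)
    (simp add: funpow_swap1 add.commute del: sum.lessThan_Suc)

lemma T_Nm: "x \<in> F n \<Longrightarrow> T n (Nm n x) = Nm n x"
  unfolding Nm_def T.sum using T_pow_Suc[of x n]
  by (subst (2) sum.lessThan_Suc_shift, subst sum.lessThan_Suc)
    (simp add: add.commute del: sum.lessThan_Suc)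

text \<open>Face \<open>Suc i\<close> of \<open>T x\<close> is \<open>T\<close> of face
  \<open>i\<close> of \<open>x\<close>, and face \<open>0\<close> of \<open>T x\<close> is the last
  face of \<open>x\<close>. So \<open>\<beta> T\<close> and \<open>T \<beta>'\<close> differ by the
  last face, exactly as \<open>\<beta>\<close> and \<open>\<beta>'\<close> do.\<close>

lemma \<beta>_T:
  assumes x: "x \<in> F (Suc n)"
  shows "\<beta> (Suc n) (x - T (Suc n) x) = \<beta>' (Suc n) x - T n (\<beta>' (Suc n) x)"
proof -
  have "\<beta> (Suc n) (T (Suc n) x) = (\<Sum>i<Suc (Suc n). D (Suc n) i (T (Suc n) x))"
    by (simp add: \<beta>_def D_def)
  also have "\<dots> = D (Suc n) (Suc n) x + (\<Sum>i<Suc n. T n (D (Suc n) i x))"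
    by (subst sum.lessThan_Suc_shift) (use x in \<open>auto simp: D_0_T D_Suc_T simp del: sum.lessThan_Suc intro!: sum.cong\<close>)
  also have "(\<Sum>i<Suc n. T n (D (Suc n) i x)) = T n (\<beta>' (Suc n) x)"
    unfolding \<beta>'_def D_def T.sum ..
  finally have "\<beta> (Suc n) (T (Suc n) x) = D (Suc n) (Suc n) x + T n (\<beta>' (Suc n) x)" .
  moreover have "\<beta> (Suc n) x = \<beta>' (Suc n) x + D (Suc n) (Suc n) x"
    unfolding \<beta>_def \<beta>'_def D_def by (rule sum.lessThan_Suc)
  ultimately show ?thesis by (simp add: module_hom.diff[OF \<beta>_hom])
qed

lemma \<beta>'_Nm:
  assumes x: "x \<in> F (Suc n)"
  shows "\<beta>' (Suc n) (Nm (Suc n) x) = Nm n (\<beta> (Suc n) x)"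
proof -
  interpret Tp: module_hom s s "T n ^^ i" for i by (rule T_pow_hom)
  define A where "A = (\<lambda>(i, j). D (Suc n) i ((T (Suc n) ^^ j) x))"
  define B where "B = (\<lambda>(k, l). (T n ^^ k) (D (Suc n) l x))"
  have "\<beta>' (Suc n) (Nm (Suc n) x) = (\<Sum>i<Suc n. \<Sum>j<Suc (Suc n). A (i, j))"
    unfolding \<beta>'_def Nm_def A_def D_def \<delta>.sum scale_sum_right by simp
  also have "\<dots> = sum A ({..<Suc n} \<times> {..<Suc (Suc n)})"
    by (simp only: sum.cartesian_product split_def prod.collapse)
  \<comment> \<open>The bijection of index pairs reads off the two commutation rules:
    \<open>(i, j)\<close> goes to \<open>(j, i - j)\<close> before the face index wraps and to
    \<open>(j - 1, n + 2 + i - j)\<close> after.\<close>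
  also have "\<dots> = sum B ({..<Suc n} \<times> {..<Suc (Suc n)})"
    by (rule sum.reindex_bij_witness[where
          j = "\<lambda>(i, j). if j \<le> i then (j, i - j) else (j - 1, Suc (Suc n) + i - j)" and
          i = "\<lambda>(k, l). if k + l \<le> n then (k + l, k) else (k + l - Suc n, Suc k)"])
      (auto simp: A_def B_def D_T_pow_le[OF x] D_T_pow_gt[OF x] split: if_splits)
  also have "\<dots> = (\<Sum>k<Suc n. \<Sum>l<Suc (Suc n). B (k, l))"
    by (simp only: sum.cartesian_product split_def prod.collapse)
  also have "\<dots> = Nm n (\<beta> (Suc n) x)"
    unfolding \<beta>_def Nm_def B_def D_def Tp.sum by simp
  finally show ?thesis .
qed

text \<open>The extra degeneracy contracts the columns with differential \<open>b'\<close>.\<close>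

lemma \<beta>'_exact:
  assumes w: "w \<in> F n" "\<sigma> n w \<in> NK n" "n = 0 \<or> \<beta>' n w \<in> NK (n - 1)"
  shows "\<exists>y\<in>F (Suc n). \<sigma> (Suc n) y \<in> NK (Suc n) \<and> cong n (\<beta>' (Suc n) y) w"
proof (rule bexI[of _ "\<pi> (Suc n) (\<eta> n w)"], rule conjI)
  have "cong n (\<beta>' (Suc n) (\<eta> n w)) w"
  proof (cases n)
    case 0
    then show ?thesis using w by (simp add: \<beta>'_def \<delta>_0_\<eta>)
  next
    case (Suc m)
    have "\<beta>' (Suc n) (\<eta> n w) = w - \<eta> m (\<beta>' n w)"
      using w(1) unfolding \<beta>'_def Suc \<eta>.sum \<eta>.scale
      by (subst sum.lessThan_Suc_shift)
        (auto simp: \<delta>_0_\<eta> \<delta>_Suc_\<eta> sum_negf[symmetric] simp del: sum.lessThan_Suc intro!: sum.cong)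
    moreover have "cong n (w - \<eta> m (\<beta>' n w)) (w - 0)"
      using w(3) Suc by (intro cong_diff) (auto simp: cong_0 \<eta>_NK)
    ultimately show ?thesis by simp
  qed
  then show "cong n (\<beta>' (Suc n) (\<pi> (Suc n) (\<eta> n w))) w"
    using w by (intro \<pi>_lift[OF \<beta>'_hom] \<eta>_F \<sigma>_\<beta>') auto
qed (use w in \<open>auto intro!: \<pi>_F \<eta>_F \<sigma>_\<pi>\<close>)

section \<open>Total complex and acyclicity of the kernel\<close>

definition vert :: "nat \<Rightarrow> nat \<Rightarrow> 'u \<Rightarrow> 'u" where
  "vert p q x = (if even p then \<beta> q x else - \<beta>' q x)"
definition horiz :: "nat \<Rightarrow> nat \<Rightarrow> 'u \<Rightarrow> 'u" where
  "horiz p q x = (if odd p then x - T q x else Nm q x)"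

lemma vert_hom: "module_hom s s (vert p q)"
proof (cases "even p")
  case False
  then have "vert p q = (\<lambda>x. s (- 1) (\<beta>' q x))" by (auto simp: vert_def fun_eq_iff)
  show ?thesis unfolding \<open>vert p q = _\<close> by (rule module_hom_scale_comp[OF \<beta>'_hom])
qed (simp add: vert_def[abs_def] \<beta>_hom)

lemma horiz_hom: "module_hom s s (horiz p q)"
proof (cases "odd p")
  case True
  then have "horiz p q = (\<lambda>x. x - T q x)" by (auto simp: horiz_def fun_eq_iff)
  then show ?thesis
    by simp (unfold_locales, auto simp: T.add T.scale scale_right_diff_distrib)
qed (simp add: horiz_def[abs_def] Nm_hom)

sublocale vert: module_hom s s "vert p q" for p q by (rule vert_hom)
sublocale horiz: module_hom s s "horiz p q" for p q by (rule horiz_hom)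

lemma vert_F: "x \<in> F (Suc q) \<Longrightarrow> vert p (Suc q) x \<in> F q"
  by (auto simp: vert_def \<beta>_F \<beta>'_F subspace_neg[OF F])
lemma horiz_F: "x \<in> F q \<Longrightarrow> horiz p q x \<in> F q"
  by (auto simp: horiz_def T_F Nm_F subspace_diff[OF F])
lemma horiz_NK: "x \<in> NK q \<Longrightarrow> horiz p q x \<in> NK q"
  by (auto simp: horiz_def T_NK Nm_NK subspace_diff[OF NK])

lemma \<sigma>_vert: "x \<in> F (Suc q) \<Longrightarrow> cong q (\<sigma> q (vert p (Suc q) x)) (vert p (Suc q) (\<sigma> (Suc q) x))"
  by (auto simp: vert_def \<sigma>_\<beta> \<sigma>_\<beta>' \<sigma>.neg intro!: cong_minus)
lemma \<sigma>_horiz: "x \<in> F q \<Longrightarrow> cong q (\<sigma> q (horiz p q x)) (horiz p q (\<sigma> q x))"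
  by (auto simp: horiz_def \<sigma>_T \<sigma>_Nm \<sigma>.diff intro!: cong_diff)

lemma horiz_horiz: "x \<in> F q \<Longrightarrow> horiz p q (horiz (Suc p) q x) = 0"
  by (auto simp: horiz_def Nm_T T_Nm module_hom.diff[OF Nm_hom])

text \<open>Even \<open>p\<close> is \<open>\<beta>_T\<close>, odd \<open>p\<close> is
  \<open>\<beta>'_Nm\<close>; the sign comes from the \<open>- \<beta>'\<close> in odd
  columns.\<close>

lemma vert_horiz:
  "x \<in> F (Suc q) \<Longrightarrow> vert p (Suc q) (horiz (Suc p) (Suc q) x) = - horiz (Suc p) q (vert (Suc p) (Suc q) x)"
  by (auto simp: horiz_def vert_def \<beta>_T \<beta>'_Nm T.neg)

lemma vert_exact:
  assumes "w \<in> F q" "\<sigma> q w \<in> NK q" "q = 0 \<or> vert p q w \<in> NK (q - 1)"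
  shows "\<exists>y\<in>F (Suc q). \<sigma> (Suc q) y \<in> NK (Suc q) \<and> cong q (vert p (Suc q) y) w"
proof (cases "even p")
  case True
  then show ?thesis using \<beta>_exact assms by (simp add: vert_def)
next
  case False
  have "- w \<in> F q" "\<sigma> q (- w) \<in> NK q" "q = 0 \<or> \<beta>' q (- w) \<in> NK (q - 1)"
    using assms False subspace_neg[OF F] subspace_neg[OF NK]
    by (auto simp: vert_def \<sigma>.neg module_hom.neg[OF \<beta>'_hom])
  then obtain y where "y \<in> F (Suc q)" "\<sigma> (Suc q) y \<in> NK (Suc q)" "cong q (\<beta>' (Suc q) y) (- w)"
    using \<beta>'_exact by blast
  then show ?thesis using False cong_minus[of q _ "- w"] by (auto simp: vert_def)
qed

text \<open>\<open>tsygan_diff\<close> on representatives. Positions \<open>p \<ge> n\<close> do not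
  occur in degree \<open>n - 1\<close> and are filled with \<open>0\<close>, keeping the map linear
  on all families.\<close>

definition tot :: "nat \<Rightarrow> (nat \<Rightarrow> 'u) \<Rightarrow> nat \<Rightarrow> 'u" where
  "tot n x p = (if p < n then vert p (n - p) (x p) + horiz (Suc p) (n - Suc p) (x (Suc p)) else 0)"

text \<open>
  The kernel of \<open>\<sigma>\<close> has exact columns, so a primitive of a cycle can be built one column at a
  time, starting from the right-most one.
\<close>

lemma tot_exact:
  assumes x: "\<And>p. p \<le> n \<Longrightarrow> x p \<in> F (n - p)"
    and cyc: "\<And>p. p < n \<Longrightarrow> tot n x p \<in> NK (n - Suc p)"
  shows "\<exists>y. (\<forall>p\<le>Suc n. y p \<in> F (Suc n - p)) \<and>
    (\<forall>p\<le>n. cong (n - p) (tot (Suc n) y p) (\<pi> (n - p) (x p)))"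
proof -
  \<comment> \<open>From here on the cycle is replaced by its projection to the kernel of
    \<open>\<sigma>\<close>, where columns are exact. It is again a cycle because
    \<open>\<sigma>\<close> commutes with both differentials modulo \<open>NK\<close>.\<close>
  define z where "z p = \<pi> (n - p) (x p)" for p
  have z_F: "z p \<in> F (n - p)" "\<sigma> (n - p) (z p) \<in> NK (n - p)" if "p \<le> n" for p
    using x[OF that] by (auto simp: z_def \<pi>_F \<sigma>_\<pi>)
  have z_cyc: "cong (n - Suc p) (vert p (n - p) (z p) + horiz (Suc p) (n - Suc p) (z (Suc p))) 0"
    if "p < n" for p
  proof -
    define q where "q = n - Suc p"
    have q: "n - p = Suc q" "n - Suc p = q" using that by (auto simp: q_def)
    have xp: "x p \<in> F (Suc q)" "x (Suc p) \<in> F q" using x[of p] x[of "Suc p"] that q by auto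
    have "vert p (Suc q) (z p) + horiz (Suc p) q (z (Suc p)) =
        tot n x p - (vert p (Suc q) (\<sigma> (Suc q) (x p)) + horiz (Suc p) q (\<sigma> q (x (Suc p))))"
      using that by (simp add: tot_def z_def \<pi>_def q vert.diff horiz.diff)
    also have "cong q \<dots> (0 - \<sigma> q (tot n x p))"
      using that cyc[OF that] q
      by (intro cong_diff) (auto simp: tot_def cong_0 \<sigma>.add xp xp[unfolded q_def] intro!: cong_add cong_sym[OF \<sigma>_vert] cong_sym[OF \<sigma>_horiz])
    also have "cong q \<dots> (0 - 0)"
      using cyc[OF that] q by (intro cong_diff) (auto simp: cong_0 \<sigma>_NK)
    finally show ?thesis by (simp add: q)
  qed
  \<comment> \<open>For \<open>p \<le> n\<close> the condition \<open>n < p + k\<close> singles out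
    the \<open>k\<close> right-most columns, those already settled.\<close>
  have "\<exists>y. (\<forall>p\<le>Suc n. y p \<in> F (Suc n - p) \<and> \<sigma> (Suc n - p) (y p) \<in> NK (Suc n - p)) \<and>
    (\<forall>p\<le>n. n < p + k \<longrightarrow> cong (n - p) (tot (Suc n) y p) (z p))" if "k \<le> Suc n" for k
    using that
  proof (induction k)
    case 0
    show ?case by (rule exI[of _ "\<lambda>_. 0"]) (auto simp: subspace_0[OF F] subspace_0[OF NK])
  next
    case (Suc k)
    then obtain y where y: "\<And>p. p \<le> Suc n \<Longrightarrow> y p \<in> F (Suc n - p)"
        "\<And>p. p \<le> Suc n \<Longrightarrow> \<sigma> (Suc n - p) (y p) \<in> NK (Suc n - p)"
        "\<And>p. p \<le> n \<Longrightarrow> n < p + k \<Longrightarrow> cong (n - p) (tot (Suc n) y p) (z p)"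
      by auto
    define p where "p = n - k"
    define q where "q = n - p"
    define u where "u = y (Suc p)"
    have p: "p \<le> n" by (simp add: p_def)
    have u: "u \<in> F q" "\<sigma> q u \<in> NK q" using y(1,2)[of "Suc p"] p by (auto simp: u_def q_def)
    \<comment> \<open>Column \<open>p = n - k\<close> comes next. With \<open>u = y (Suc p)\<close>
      already chosen, \<open>w\<close> is what the vertical differential of the new entry has to
      produce.\<close>
    define w where "w = z p - horiz (Suc p) q u"
    have "w \<in> F q" unfolding w_def using z_F[OF p] u
      by (intro subspace_diff[OF F] horiz_F) (auto simp: q_def)
    moreover have "\<sigma> q w \<in> NK q"
    proof -
      have "cong q (\<sigma> q (horiz (Suc p) q u)) 0"
        using cong_trans[OF \<sigma>_horiz[OF u(1)], of "Suc p" 0] horiz_NK[OF u(2), of "Suc p"] by (simp add: cong_0)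
      then show ?thesis
        unfolding w_def \<sigma>.diff using z_F[OF p] by (intro subspace_diff[OF NK]) (auto simp: q_def cong_0)
    qed
    \<comment> \<open>\<open>w\<close> is a vertical cycle: anticommutation turns
      \<open>vert (horiz u)\<close> into \<open>- horiz (vert u)\<close>; the equation settled in
      column \<open>Suc p\<close> and \<open>horiz horiz = 0\<close> replace \<open>vert u\<close>
      by \<open>z (Suc p)\<close>; then the cycle condition for \<open>z\<close> applies.\<close>
    moreover have "q = 0 \<or> vert p q w \<in> NK (q - 1)"
    proof (cases q)
      case (Suc r)
      then have pn: "p < n" "n - Suc p = r" "n - p = Suc r" by (auto simp: q_def)
      have yp: "y (Suc (Suc p)) \<in> F r" using y(1)[of "Suc (Suc p)"] pn by simp
      have "cong r (tot (Suc n) y (Suc p)) (z (Suc p))"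
        using y(3)[of "Suc p"] pn by (simp add: p_def)
      then have "cong r (vert (Suc p) q u + horiz (Suc (Suc p)) r (y (Suc (Suc p)))) (z (Suc p))"
        using pn Suc by (simp add: tot_def u_def)
      then have "cong r (horiz (Suc p) r (vert (Suc p) q u + horiz (Suc (Suc p)) r (y (Suc (Suc p)))))
          (horiz (Suc p) r (z (Suc p)))"
        by (intro cong_hom[OF horiz_hom horiz_NK])
      then have "cong r (horiz (Suc p) r (vert (Suc p) q u)) (horiz (Suc p) r (z (Suc p)))"
        by (simp add: horiz.add horiz_horiz[OF yp])
      then have "cong r (vert p q (z p) + horiz (Suc p) r (vert (Suc p) q u))
          (vert p q (z p) + horiz (Suc p) r (z (Suc p)))"
        by (intro cong_add) auto
      also have "cong r \<dots> 0" using z_cyc[OF pn(1)] pn Suc by simp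
      finally have "cong r (vert p q w) 0"
        using u(1) by (simp add: w_def vert.diff Suc vert_horiz)
      then show ?thesis using Suc by (simp add: cong_0)
    qed simp
    ultimately obtain v where v: "v \<in> F (Suc q)" "\<sigma> (Suc q) v \<in> NK (Suc q)" "cong q (vert p (Suc q) v) w"
      using vert_exact by blast
    have "cong q (vert p (Suc q) v + horiz (Suc p) q u) (w + horiz (Suc p) q u)"
      by (intro cong_add v) simp
    then have "cong (n - p) (tot (Suc n) (y(p := v)) p) (z p)"
      using p by (simp add: tot_def q_def u_def w_def Suc_diff_le)
    \<comment> \<open>Position \<open>p'\<close> of the differential involves only entries
      \<open>p'\<close> and \<open>Suc p'\<close>, so the new entry leaves the settled columns
      untouched.\<close>
    moreover have "tot (Suc n) (y(p := v)) p' = tot (Suc n) y p'" if "p < p'" for p'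
      using that by (simp add: tot_def)
    ultimately have "cong (n - p') (tot (Suc n) (y(p := v)) p') (z p')" if "p' \<le> n" "n < p' + Suc k" for p'
      using that y(3)[of p'] Suc.prems by (cases "p' = p") (auto simp: p_def)
    moreover have "(y(p := v)) p' \<in> F (Suc n - p') \<and> \<sigma> (Suc n - p') ((y(p := v)) p') \<in> NK (Suc n - p')"
      if "p' \<le> Suc n" for p'
      using that v y(1,2) p by (auto simp: q_def Suc_diff_le)
    ultimately show ?case by blast
  qed
  from this[of "Suc n"] show ?thesis by (auto simp: z_def)
qed

end

locale presented_cyclic_splitting = presented_splitting s F NK NB \<delta> h \<sigma> Z Z' c c' d d' +
  cyclic_splitting s F NK NB \<delta> h \<sigma> t \<eta>
  for s :: "'k::field \<Rightarrow> 'u::ab_group_add \<Rightarrow> 'u" and F NK NB \<delta> h \<sigma> t \<eta>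
    and Z Z' :: "nat \<Rightarrow> ('k, 'v) vspace" and c c' d d' +
  fixes \<tau> \<tau>' :: "nat \<Rightarrow> 'v \<Rightarrow> 'v"
  assumes \<tau>: "\<And>n x. x \<in> F n \<Longrightarrow> \<tau> n (c n x) = c n (t n x)"
    and \<tau>': "\<And>n x. x \<in> F n \<Longrightarrow> \<tau>' n (c' n x) = c' n (t n x)"
begin

text \<open>Stated for an arbitrary quotient \<open>Y\<close> of the family \<open>F\<close>, to be
  used for both complexes.\<close>

lemma tsygan_diff_cls:
  assumes P: "\<And>n. presented s (Y n) (F n) (N n) (e n)"
    and f: "\<And>n i x. i \<le> Suc n \<Longrightarrow> x \<in> F (Suc n) \<Longrightarrow> f (Suc n) i (e (Suc n) x) = e n (\<delta> (Suc n) i x)"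
    and \<theta>: "\<And>n x. x \<in> F n \<Longrightarrow> \<theta> n (e n x) = e n (t n x)"
    and x: "\<And>p. p \<le> Suc n \<Longrightarrow> x p \<in> F (Suc n - p)"
  shows "tsygan_diff Y f \<theta> (Suc n) (\<lambda>p\<in>{..Suc n}. e (Suc n - p) (x p)) =
    (\<lambda>p\<in>{..n}. e (n - p) (tot (Suc n) x p))"
proof -
  interpret P: presented s "Y m" "F m" "N m" "e m" for m by (rule P)
  have b: "b_diff Y f (Suc q) (e (Suc q) v) = e q (\<beta> (Suc q) v)"
    "b'_diff Y f (Suc q) (e (Suc q) v) = e q (\<beta>' (Suc q) v)" if "v \<in> F (Suc q)" for q v
    unfolding b_diff_def b'_diff_def \<beta>_def \<beta>'_def
    using b_diff_presented[of s Y q F N e "Suc (Suc q)" f v "\<lambda>i. \<delta> (Suc q) i v"]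
      b_diff_presented[of s Y q F N e "Suc q" f v "\<lambda>i. \<delta> (Suc q) i v"]
      P[of q] f \<delta>_F that by auto
  have vert: "tsygan_vert Y f p (Suc q) (e (Suc q) v) = e q (vert p (Suc q) v)" if "v \<in> F (Suc q)" for p q v
    using that b[OF that] by (auto simp: tsygan_vert_def vert_def P.scl \<beta>'_F)
  have T: "signed_t Y \<theta> q (e q v) = e q (T q v)" if "v \<in> F q" for q v
    using that by (simp add: signed_t_def T_def \<theta> P.scl t_F)
  have Tp: "(signed_t Y \<theta> q ^^ i) (e q v) = e q ((T q ^^ i) v)" if "v \<in> F q" for q v i
    using that by (induction i) (auto simp: T T_pow_F)
  have horiz: "tsygan_horiz Y \<theta> p q (e q v) = e q (horiz p q v)" if "v \<in> F q" for p q v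
    unfolding tsygan_horiz_def horiz_def cyc_norm_def Nm_def
    using that P.vs_sum_cls[of "Suc q" "\<lambda>i. (T q ^^ i) v" q]
    by (auto simp: T Tp T_F T_pow_F P.vs_diff_cls)
  show ?thesis unfolding tsygan_diff_def diff_Suc_1
  proof (rule restrict_ext)
    fix p assume "p \<in> {..n}"
    then have p: "p \<le> n" by simp
    define q where "q = n - p"
    have q: "Suc n - p = Suc q" "n - p = q" using p by (auto simp: q_def)
    have "x p \<in> F (Suc q)" "x (Suc p) \<in> F q" using x[of p] x[of "Suc p"] p q by auto
    then show "vadd (Y (n - p))
        (tsygan_vert Y f p (Suc n - p) ((\<lambda>p\<in>{..Suc n}. e (Suc n - p) (x p)) p))
        (tsygan_horiz Y \<theta> (p + 1) (Suc n - (p + 1)) ((\<lambda>p\<in>{..Suc n}. e (Suc n - p) (x p)) (p + 1))) =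
      e (n - p) (tot (Suc n) x p)"
      using p by (simp add: q vert horiz P.add vert_F horiz_F tot_def)
  qed
qed

text \<open>\<open>\<sigma>\<close> acts on total complexes entrywise, and
  \<open>vs_iso_homology\<close> applies; its exactness assumption is
  \<open>tot_exact\<close>.\<close>

theorem vs_iso_cyclic: "vs_iso (cyclic_homology Z d \<tau> n) (cyclic_homology Z' d' \<tau>' n)"
  unfolding cyclic_homology_def
proof (rule vs_iso_homology[where \<delta> = tot and \<sigma> = "\<lambda>n x p. \<sigma> (n - p) (x p)",
    OF presented_tsygan_tot[OF Z] presented_tsygan_tot[OF Z']])
  interpret T: vector_space "tscale s" by (rule vector_space_tscale) unfold_locales
  show "module_hom (tscale s) (tscale s) (tot n)" for n
    by unfold_locales (auto simp: tot_def fun_eq_iff tscale_def vert.add horiz.add vert.scale horiz.scale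
        scale_right_distrib)
  show "module_hom (tscale s) (tscale s) (\<lambda>x p. \<sigma> (n - p) (x p))" for n
    by unfold_locales (auto simp: fun_eq_iff tscale_def \<sigma>.add \<sigma>.scale)
  fix n x
  {
    assume "x \<in> {x. \<forall>p\<le>Suc n. x p \<in> F (Suc n - p)}"
    then have x: "x p \<in> F (Suc n - p)" if "p \<le> Suc n" for p using that by auto
    have q: "x p \<in> F (Suc (n - p))" "x (Suc p) \<in> F (n - p)" if "p \<le> n" for p
      using x[of p] x[of "Suc p"] that by (auto simp: Suc_diff_le)
    show "tot (Suc n) x \<in> {x. \<forall>p\<le>n. x p \<in> F (n - p)}"
      using q by (auto simp: tot_def Suc_diff_le intro!: subspace_add[OF F] vert_F horiz_F)
    show "tsygan_diff Z d \<tau> (Suc n) (\<lambda>p\<in>{..Suc n}. c (Suc n - p) (x p)) =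
        (\<lambda>p\<in>{..n}. c (n - p) (tot (Suc n) x p))"
      by (rule tsygan_diff_cls[OF Z d \<tau> x])
    show "tsygan_diff Z' d' \<tau>' (Suc n) (\<lambda>p\<in>{..Suc n}. c' (Suc n - p) (x p)) =
        (\<lambda>p\<in>{..n}. c' (n - p) (tot (Suc n) x p))"
      by (rule tsygan_diff_cls[OF Z' d' \<tau>' x])
    have "cong (n - p) (\<sigma> (n - p) (tot (Suc n) x p)) (tot (Suc n) (\<lambda>p. \<sigma> (Suc n - p) (x p)) p)"
      if "p \<le> n" for p
      using that q[OF that] by (auto simp: tot_def \<sigma>.add Suc_diff_le intro!: cong_add \<sigma>_vert \<sigma>_horiz)
    then show "(\<lambda>p. \<sigma> (n - p) (tot (Suc n) x p)) - tot (Suc n) (\<lambda>p. \<sigma> (Suc n - p) (x p)) \<in>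
        {x. \<forall>p\<le>n. x p \<in> NK (n - p)}"
      by (auto simp: cong_def)
  }
  {
    assume x: "x \<in> {x. \<forall>p\<le>n. x p \<in> F (n - p)}"
      and cyc: "n = 0 \<or> tot n x \<in> {x. \<forall>p\<le>n - 1. x p \<in> NK (n - 1 - p)}"
    have "tot n x p \<in> NK (n - Suc p)" if "p < n" for p
      using cyc that by auto
    then obtain y where "\<forall>p\<le>Suc n. y p \<in> F (Suc n - p)"
      "\<forall>p\<le>n. cong (n - p) (tot (Suc n) y p) (\<pi> (n - p) (x p))"
      using tot_exact[of n x] x by auto
    then show "\<exists>y\<in>{x. \<forall>p\<le>Suc n. x p \<in> F (Suc n - p)}.
        x - (\<lambda>p. \<sigma> (n - p) (x p)) - tot (Suc n) y \<in> {x. \<forall>p\<le>n. x p \<in> NK (n - p)}"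
      using cong_sym by (intro bexI[of _ y]) (auto simp: cong_def \<pi>_def)
  }
qed (use \<sigma>_F subsetD[OF NK_NB] \<sigma>_NB \<sigma>_id in auto)

end

section \<open>Presentation of the Hochschild complex\<close>

lemma (in presented) vs_span_minimal:
  assumes "subspace P" "P \<subseteq> F" "S \<subseteq> c ` P"
  shows "vs_span V S \<subseteq> c ` P"
  unfolding vs_span_def by (rule hull_minimal) (use assms vs_subspace_image in auto)

lemma (in presented) vs_subspace_vs_span:
  assumes "S \<subseteq> vcarrier V"
  shows "vs_subspace V (vs_span V S)"
proof -
  have "vs_subspace V (vcarrier V)" unfolding carrier by (rule vs_subspace_image[OF F]) simp
  then have "vs_span V S \<subseteq> vcarrier V" unfolding vs_span_def by (intro hull_minimal assms)
  then show ?thesis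
    unfolding vs_span_def hull_def vs_subspace_def[of V "\<Inter>_"] by (auto simp: vs_subspace_def)
qed

lemma (in presented) vs_span_eq:
  assumes S: "S \<subseteq> F"
  shows "{x \<in> F. c x \<in> vs_span V (c ` S)} = span (S \<union> N)"
proof
  have SF: "span (S \<union> N) \<subseteq> F" using S N_F F by (intro span_minimal) auto
  show "{x \<in> F. c x \<in> vs_span V (c ` S)} \<subseteq> span (S \<union> N)"
  proof
    fix x assume "x \<in> {x \<in> F. c x \<in> vs_span V (c ` S)}"
    moreover have "vs_span V (c ` S) \<subseteq> c ` span (S \<union> N)"
      by (rule vs_span_minimal) (use SF span_base[of _ "S \<union> N"] in auto)
    ultimately obtain y where y: "x \<in> F" "y \<in> span (S \<union> N)" "c x = c y" by auto
    then have "x - y \<in> N" using cls SF by blast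
    then have "(x - y) + y \<in> span (S \<union> N)" using y(2) by (intro span_add) (auto intro: span_base)
    then show "x \<in> span (S \<union> N)" by simp
  qed
  have W: "vs_subspace V (vs_span V (c ` S))"
    by (rule vs_subspace_vs_span) (use S carrier in auto)
  show "span (S \<union> N) \<subseteq> {x \<in> F. c x \<in> vs_span V (c ` S)}"
  proof (rule span_minimal[OF _ subspace_preimage[OF W]])
    have "c ` S \<subseteq> vs_span V (c ` S)" unfolding vs_span_def by (rule hull_subset)
    moreover have "c x \<in> vs_span V (c ` S)" if "x \<in> N" for x
      using that cls_zero[of x] N_F W unfolding vs_subspace_def by (metis subsetD)
    ultimately show "S \<union> N \<subseteq> {x \<in> F. c x \<in> vs_span V (c ` S)}" using S N_F by auto
  qed
qed

text \<open>Reduces a congruence between linear maps on chains to tuples; most verifications below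
  pass through this.\<close>

lemma single_diff_mem:
  assumes hom: "module_hom pscale s f" "module_hom pscale s g" and P: "module.subspace s P"
    and "\<And>p. p \<in> G \<Longrightarrow> f (single p 1) - g (single p 1) \<in> P"
    and "keys x \<subseteq> G"
  shows "f x - g x \<in> P"
proof -
  interpret f: module_hom pscale s f by fact
  interpret g: module_hom pscale s g by fact
  have "pm.subspace {x. f x - g x \<in> P}"
    unfolding pm.subspace_def
    using f.m2.subspace_0[OF P] f.m2.subspace_add[OF P] f.m2.subspace_scale[OF P]
    by (auto simp: f.add g.add f.scale g.scale add_diff_add simp flip: f.m2.scale_right_diff_distrib)
  then have "pm.span ((\<lambda>p. single p 1) ` G) \<subseteq> {x. f x - g x \<in> P}"
    by (intro pm.span_minimal) (use assms(4) in auto)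
  then show ?thesis using keys_subset_span[OF assms(5)] by auto
qed

lemma single_mem:
  assumes hom: "module_hom pscale s f" and P: "module.subspace s P"
    and "\<And>p. p \<in> G \<Longrightarrow> f (single p 1) \<in> P" and "keys x \<subseteq> G"
  shows "f x \<in> P"
proof -
  interpret f: module_hom pscale s f by fact
  have "module_hom pscale s (\<lambda>_. 0)" by unfold_locales simp_all
  from single_diff_mem[OF hom this P, of G x] show ?thesis using assms(3,4) by simp
qed

lemma module_hom_span_mem:
  assumes hom: "module_hom s s' f" and P: "module.subspace s' P"
    and "\<And>x. x \<in> S \<Longrightarrow> f x \<in> P" and "x \<in> module.span s S"
  shows "f x \<in> P"
proof -
  interpret f: module_hom s s' f by fact
  have "f.m1.span S \<subseteq> f -` P" by (rule f.m1.span_minimal[OF _ f.subspace_vimage[OF P]]) (use assms(3) in auto)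
  then show ?thesis using assms(4) by auto
qed

lemma lin_ext_hom: "module_hom pscale pscale (lin_ext g)"
  unfolding lin_ext_lsum by (rule lsum_hom) unfold_locales

lemma lin_ext_single [simp]: "lin_ext g (single p a) = single (g p) a"
  unfolding lin_ext_lsum by (subst lsum_single) (unfold_locales, simp)

lemmas lin_ext_diff = module_hom.diff[OF lin_ext_hom]

lemma lin_ext_keys:
  assumes "keys x \<subseteq> G" "\<And>p. p \<in> G \<Longrightarrow> g p \<in> G'"
  shows "keys (lin_ext g x) \<subseteq> G'"
  using single_mem[OF lin_ext_hom subspace_keys, of G g G' x] assms by auto

lemma presented_free: "presented pscale (vs_free G) {x. keys x \<subseteq> G} {0} (\<lambda>x. x)"
  by unfold_locales (auto simp: vs_free_def pscale_def intro: subspace_keys pm.subspace_0)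

section \<open>Tensor products as presented quotients\<close>

lemma tens_rels_cases [consumes 1, case_names madd mscale add scale lbal bal]:
  assumes "x \<in> tens_rels sA sM r X Y B n"
  obtains
    m m' as where "x = pure (m + m') as - pure m as - pure m' as"
      "m \<in> X" "m' \<in> X" "set as \<subseteq> Y" "length as = n"
  | c m as where "x = pure (sM c m) as - single (m, as) c"
      "m \<in> X" "set as \<subseteq> Y" "length as = n"
  | m us a a' vs where "x = pure m (us @ (a + a') # vs) - pure m (us @ a # vs) - pure m (us @ a' # vs)"
      "m \<in> X" "set us \<subseteq> Y" "a \<in> Y" "a' \<in> Y" "set vs \<subseteq> Y" "length us + 1 + length vs = n"
  | c m us a vs where "x = pure m (us @ sA c a # vs) - single (m, us @ a # vs) c"
      "m \<in> X" "set us \<subseteq> Y" "a \<in> Y" "set vs \<subseteq> Y" "length us + 1 + length vs = n"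
  | m b a as where "x = pure (r m b) (a # as) - pure m ((b * a) # as)"
      "b \<in> B" "m \<in> X" "a \<in> Y" "set as \<subseteq> Y" "1 + length as = n"
  | m b us a a' vs where "x = pure m (us @ (a * b) # a' # vs) - pure m (us @ a # (b * a') # vs)"
      "b \<in> B" "m \<in> X" "set us \<subseteq> Y" "a \<in> Y" "a' \<in> Y" "set vs \<subseteq> Y" "length us + 2 + length vs = n"
  using assms unfolding tens_rels_def Un_subset_iff insert_subset
  by (elim UnE CollectE exE conjE)
    ((rule that(1); assumption), (rule that(2); assumption), (rule that(3); assumption),
      (rule that(4); assumption), (rule that(5); assumption), (rule that(6); assumption))

lemma tens_rels_intros:
  "m \<in> X \<Longrightarrow> m' \<in> X \<Longrightarrow> set as \<subseteq> Y \<Longrightarrow> length as = n \<Longrightarrow>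
    pure (m + m') as - pure m as - pure m' as \<in> tens_rels sA sM r X Y B n"
  "m \<in> X \<Longrightarrow> set as \<subseteq> Y \<Longrightarrow> length as = n \<Longrightarrow>
    pure (sM c m) as - single (m, as) c \<in> tens_rels sA sM r X Y B n"
  "m \<in> X \<Longrightarrow> set us \<subseteq> Y \<Longrightarrow> a \<in> Y \<Longrightarrow> a' \<in> Y \<Longrightarrow> set vs \<subseteq> Y \<Longrightarrow> length us + 1 + length vs = n \<Longrightarrow>
    pure m (us @ (a + a') # vs) - pure m (us @ a # vs) - pure m (us @ a' # vs) \<in> tens_rels sA sM r X Y B n"
  "m \<in> X \<Longrightarrow> set us \<subseteq> Y \<Longrightarrow> a \<in> Y \<Longrightarrow> set vs \<subseteq> Y \<Longrightarrow> length us + 1 + length vs = n \<Longrightarrow>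
    pure m (us @ sA c a # vs) - single (m, us @ a # vs) c \<in> tens_rels sA sM r X Y B n"
  "b \<in> B \<Longrightarrow> m \<in> X \<Longrightarrow> a \<in> Y \<Longrightarrow> set as \<subseteq> Y \<Longrightarrow> 1 + length as = n \<Longrightarrow>
    pure (r m b) (a # as) - pure m ((b * a) # as) \<in> tens_rels sA sM r X Y B n"
  "b \<in> B \<Longrightarrow> m \<in> X \<Longrightarrow> set us \<subseteq> Y \<Longrightarrow> a \<in> Y \<Longrightarrow> a' \<in> Y \<Longrightarrow> set vs \<subseteq> Y \<Longrightarrow> length us + 2 + length vs = n \<Longrightarrow>
    pure m (us @ (a * b) # a' # vs) - pure m (us @ a # (b * a') # vs) \<in> tens_rels sA sM r X Y B n"
  unfolding tens_rels_def
  by (rule UnI1, rule UnI1, rule UnI1, rule UnI1, rule UnI1, blast)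
    ((rule UnI1, rule UnI1, rule UnI1, rule UnI1, rule UnI2, blast),
      (rule UnI1, rule UnI1, rule UnI1, rule UnI2, blast),
      (rule UnI1, rule UnI1, rule UnI2, blast), (rule UnI1, rule UnI2, blast), (rule UnI2, blast))

lemma vcarrier_free: "vcarrier (vs_free G) = {x. keys x \<subseteq> G}"
  by (simp add: vs_free_def)

lemma vs_subspace_carrier: "vs_subspace V W \<Longrightarrow> W \<subseteq> vcarrier V"
  by (simp add: vs_subspace_def)

text \<open>For the presentation as a quotient it is enough that the relations involve admissible
  tuples only; closure properties of \<open>X\<close> and \<open>Y\<close> enter later, in
  \<open>tens_bimodule\<close>.\<close>

locale tens_presentation =
  fixes sA :: "'k::field \<Rightarrow> 'a::{ring, monoid_mult} \<Rightarrow> 'a" and sM :: "'k \<Rightarrow> 'm::ab_group_add \<Rightarrow> 'm"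
    and r :: "'m \<Rightarrow> 'a \<Rightarrow> 'm" and X :: "'m set" and Y B :: "'a set" and n :: nat
  assumes rels: "tens_rels sA sM r X Y B n \<subseteq> {x. keys x \<subseteq> tens_gens X Y n}"
begin

abbreviation "F \<equiv> {x :: 'm \<times> 'a list \<Rightarrow>\<^sub>0 'k. keys x \<subseteq> tens_gens X Y n}"

lemma vs_subspace_tens_ker: "vs_subspace (tens_free X Y n) (tens_ker sA sM r X Y B n)"
proof -
  interpret P: presented pscale "vs_free (tens_gens X Y n)" F "{0}" "\<lambda>x. x" by (rule presented_free)
  show ?thesis
    unfolding tens_ker_def tens_free_def
    by (rule P.vs_subspace_vs_span) (simp only: vcarrier_free rels)
qed

lemma tens_ker_F: "tens_ker sA sM r X Y B n \<subseteq> F"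
  using vs_subspace_carrier[OF vs_subspace_tens_ker] by (simp only: tens_free_def vcarrier_free)

lemma tens_ker_Int: "{x \<in> F. x \<in> tens_ker sA sM r X Y B n} = tens_ker sA sM r X Y B n"
  using tens_ker_F by blast

lemma tens_ker_span: "tens_ker sA sM r X Y B n = pm.span (tens_rels sA sM r X Y B n)"
proof -
  interpret P: presented pscale "vs_free (tens_gens X Y n)" F "{0}" "\<lambda>x. x" by (rule presented_free)
  have "pm.span (insert 0 S) = pm.span S" for S :: "('k, 'm, 'a) chains set"
    by (rule pm.span_redundant) (rule pm.span_zero)
  then show ?thesis
    using P.vs_span_eq[OF rels] tens_ker_Int
    by (simp only: image_ident tens_ker_def tens_free_def Un_insert_right Un_empty_right)
qed

lemma presented_tens:
  "presented pscale (tens sA sM r X Y B n) F (tens_ker sA sM r X Y B n) (tens_class sA sM r X Y B n)"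
proof -
  interpret P: presented pscale "vs_free (tens_gens X Y n)" F "{0}" "\<lambda>x. x" by (rule presented_free)
  have "presented pscale (tens sA sM r X Y B n) F {x \<in> F. x \<in> tens_ker sA sM r X Y B n}
      (tens_class sA sM r X Y B n)"
    unfolding tens_def tens_class_def tens_free_def
    by (rule P.presented_quot[OF vs_subspace_tens_ker[unfolded tens_free_def] P.F P.N_F order_refl])
      (simp add: vs_free_def)
  then show ?thesis by (simp only: tens_ker_Int)
qed

sublocale presented pscale "tens sA sM r X Y B n" F "tens_ker sA sM r X Y B n" "tens_class sA sM r X Y B n"
  by (rule presented_tens)

lemma tens_class_eq:
  assumes "x \<in> F"
  shows "tens_class sA sM r X Y B n x = {y \<in> F. y - x \<in> tens_ker sA sM r X Y B n}"
proof -
  interpret P: presented pscale "vs_free (tens_gens X Y n)" F "{0}" "\<lambda>x. x" by (rule presented_free)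
  show ?thesis
    using P.coset_eq[OF vs_subspace_tens_ker[unfolded tens_free_def] assms]
    unfolding tens_class_def tens_free_def by (simp only: image_ident)
qed

text \<open>Evaluates maps carried to the quotient by \<open>the_elem\<close>: the class is nonempty
  and \<open>g\<close> is constant on it.\<close>

lemma the_elem_tens_class:
  assumes "x \<in> F" "\<And>y. y \<in> F \<Longrightarrow> y - x \<in> tens_ker sA sM r X Y B n \<Longrightarrow> g y = g x"
  shows "the_elem (g ` tens_class sA sM r X Y B n x) = g x"
proof (rule the_elem_image_unique)
  show "tens_class sA sM r X Y B n x \<noteq> {}"
    using pm.subspace_0[OF N] assms(1) unfolding tens_class_eq[OF assms(1)] by fastforce
qed (use assms in \<open>simp add: tens_class_eq\<close>)

lemma the_elem_tens_map:
  assumes hom: "module_hom pscale pscale f" and F: "\<And>x. x \<in> F \<Longrightarrow> f x \<in> F"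
    and "\<And>x. x \<in> tens_rels sA sM r X Y B n \<Longrightarrow> f x \<in> tens_ker sA sM r X Y B n" and x: "x \<in> F"
  shows "the_elem ((\<lambda>x. tens_class sA sM r X Y B n (f x)) ` tens_class sA sM r X Y B n x) =
    tens_class sA sM r X Y B n (f x)"
proof (rule the_elem_tens_class[OF x])
  fix y assume y: "y \<in> F" "y - x \<in> tens_ker sA sM r X Y B n"
  then have "f (y - x) \<in> tens_ker sA sM r X Y B n"
    using module_hom_span_mem[OF hom N assms(3)] by (simp only: tens_ker_span)
  then show "tens_class sA sM r X Y B n (f y) = tens_class sA sM r X Y B n (f x)"
    using cls F x y by (simp add: module_hom.diff[OF hom])
qed

end

abbreviation lact_gen :: "('a \<Rightarrow> 'm \<Rightarrow> 'm) \<Rightarrow> 'a \<Rightarrow> 'm \<times> 'a list \<Rightarrow> 'm \<times> 'a list" where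
  "lact_gen l b \<equiv> \<lambda>(m, as). (l b m, as)"

abbreviation ract_gen ::
  "('m \<Rightarrow> 'a::times \<Rightarrow> 'm) \<Rightarrow> 'a \<Rightarrow> 'm \<times> 'a list \<Rightarrow> 'm \<times> 'a list" where
  "ract_gen r b \<equiv> \<lambda>(m, as). if as = [] then (r m b, []) else (m, butlast as @ [last as * b])"

lemma keys_diff_subset:
  fixes x y :: "'g \<Rightarrow>\<^sub>0 'k::field"
  shows "keys x \<subseteq> G \<Longrightarrow> keys y \<subseteq> G \<Longrightarrow> keys (x - y) \<subseteq> G"
  using pm.subspace_diff[OF subspace_keys, of x G y] by simp

text \<open>Covers two instances: \<open>X = Y = UNIV\<close> for the Hochschild spaces, and
  \<open>X = Y = B\<close> balanced over the scalars for the space \<open>B \<otimes> B\<close> in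
  which the separability section takes values.\<close>

locale tens_bimodule = k_bimodule sA sM l r
  for sA :: "'k::field \<Rightarrow> 'a::{ring, monoid_mult} \<Rightarrow> 'a" and sM :: "'k \<Rightarrow> 'm::ab_group_add \<Rightarrow> 'm"
    and l r +
  fixes X :: "'m set" and Y B :: "'a set"
  assumes X: "M.subspace X" and Y: "subspace Y"
    and Y_mult: "\<And>a b. a \<in> Y \<Longrightarrow> b \<in> Y \<Longrightarrow> a * b \<in> Y" and B_Y: "B \<subseteq> Y"
    and l_X: "\<And>b m. b \<in> Y \<Longrightarrow> m \<in> X \<Longrightarrow> l b m \<in> X" and r_X: "\<And>b m. b \<in> Y \<Longrightarrow> m \<in> X \<Longrightarrow> r m b \<in> X"
begin

sublocale tens_presentation sA sM r X Y B n for n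
proof
  note closed = M.subspace_add[OF X] M.subspace_scale[OF X] subspace_add[OF Y] subspace_scale[OF Y]
    Y_mult subsetD[OF B_Y] r_X tens_gens_def
  show "tens_rels sA sM r X Y B n \<subseteq> {x. keys x \<subseteq> tens_gens X Y n}"
  proof
    fix x assume "x \<in> tens_rels sA sM r X Y B n"
    then have "keys x \<subseteq> tens_gens X Y n"
      by (cases rule: tens_rels_cases)
        (hypsubst, (intro keys_diff_subset; auto simp: closed split: if_splits)[1])+
    then show "x \<in> {x. keys x \<subseteq> tens_gens X Y n}" by simp
  qed
qed

lemma lact_rels:
  assumes b: "b \<in> Y" and "x \<in> tens_rels sA sM r X Y B n"
  shows "lin_ext (lact_gen l b) x \<in> tens_rels sA sM r X Y B n"
  using assms(2)
  by (cases rule: tens_rels_cases)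
    (auto simp: lin_ext_diff l_add_right l_scale_right l_r[symmetric] l_X[OF b] intro!: tens_rels_intros)

lemma lact_keys:
  "b \<in> Y \<Longrightarrow> keys x \<subseteq> tens_gens X Y n \<Longrightarrow>
    keys (lin_ext (lact_gen l b) x) \<subseteq> tens_gens X Y n"
  by (rule lin_ext_keys) (auto simp: tens_gens_def l_X)

lemma tens_lact_class:
  assumes "b \<in> Y" "x \<in> F n"
  shows "tens_lact sA sM l r X Y B n b (tens_class sA sM r X Y B n x) =
    tens_class sA sM r X Y B n (lin_ext (lact_gen l b) x)"
  unfolding tens_lact_def
proof (rule the_elem_tens_map[OF lin_ext_hom _ _ assms(2)])
  show "lin_ext (lact_gen l b) x \<in> F n" if "x \<in> F n" for x
    using lact_keys[OF assms(1)] that by simp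
  show "lin_ext (lact_gen l b) x \<in> tens_ker sA sM r X Y B n" if "x \<in> tens_rels sA sM r X Y B n" for x
    unfolding tens_ker_span by (rule pm.span_base[OF lact_rels[OF assms(1) that]])
qed

text \<open>The right action touches only the last entry. Whether or not this is the entry a
  relation concerns, the relation goes to one of the same kind; hence the case splits from the end
  of the list.\<close>

lemma ract_rels:
  assumes b: "b \<in> Y" and "x \<in> tens_rels sA sM r X Y B n"
  shows "lin_ext (ract_gen r b) x \<in> tens_rels sA sM r X Y B n"
  using assms(2)
proof (cases rule: tens_rels_cases)
  case (madd m m' as)
  then show ?thesis using b
    by (cases as rule: rev_cases) (auto simp: lin_ext_diff butlast_append r_X Y_mult r_add_left intro!: tens_rels_intros)
next
  case (mscale c m as)
  then show ?thesis using b
    by (cases as rule: rev_cases) (auto simp: lin_ext_diff butlast_append r_X Y_mult r_scale_left intro!: tens_rels_intros)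
next
  case (add m us a a' vs)
  then show ?thesis using b
    by (cases vs rule: rev_cases) (auto simp: lin_ext_diff butlast_append r_X Y_mult distrib_right intro!: tens_rels_intros)
next
  case (scale c m us a vs)
  then show ?thesis using b
    by (cases vs rule: rev_cases) (auto simp: lin_ext_diff butlast_append r_X Y_mult scale_mult_left intro!: tens_rels_intros)
next
  case (lbal m b' a as)
  then show ?thesis using b
    by (cases as rule: rev_cases) (auto simp: lin_ext_diff butlast_append r_X Y_mult mult.assoc intro!: tens_rels_intros)
next
  case (bal m b' us a a' vs)
  then show ?thesis using b
    by (cases vs rule: rev_cases) (auto simp: lin_ext_diff butlast_append r_X Y_mult mult.assoc intro!: tens_rels_intros)
qed

lemma ract_keys:
  "b \<in> Y \<Longrightarrow> keys x \<subseteq> tens_gens X Y n \<Longrightarrow>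
    keys (lin_ext (ract_gen r b) x) \<subseteq> tens_gens X Y n"
proof (erule lin_ext_keys)
  fix p assume "b \<in> Y" "p \<in> tens_gens X Y n"
  then show "ract_gen r b p \<in> tens_gens X Y n"
    by (cases "snd p" rule: rev_cases) (auto simp: tens_gens_def r_X Y_mult)
qed

lemma tens_ract_class:
  assumes "b \<in> Y" "x \<in> F n"
  shows "tens_ract sA sM r X Y B n (tens_class sA sM r X Y B n x) b =
    tens_class sA sM r X Y B n (lin_ext (ract_gen r b) x)"
  unfolding tens_ract_def
proof (rule the_elem_tens_map[OF lin_ext_hom _ _ assms(2)])
  show "lin_ext (ract_gen r b) x \<in> F n" if "x \<in> F n" for x
    using ract_keys[OF assms(1)] that by simp
  show "lin_ext (ract_gen r b) x \<in> tens_ker sA sM r X Y B n" if "x \<in> tens_rels sA sM r X Y B n" for x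
    unfolding tens_ker_span by (rule pm.span_base[OF ract_rels[OF assms(1) that]])
qed

end

section \<open>Hochschild spaces as quotients of free chains\<close>

abbreviation tgens :: "nat \<Rightarrow> ('m \<times> 'a list) set" where
  "tgens \<equiv> tens_gens UNIV UNIV"

abbreviation tfree :: "nat \<Rightarrow> ('m \<times> 'a list \<Rightarrow>\<^sub>0 'k::field) set" where
  "tfree n \<equiv> {x. keys x \<subseteq> tgens n}"

context k_bimodule
begin

lemma tens_bimodule_UNIV: "tens_bimodule sA sM l r UNIV UNIV B"
  by unfold_locales auto

definition comm_rels :: "'a set \<Rightarrow> nat \<Rightarrow> ('k, 'm, 'a) chains set" where
  "comm_rels B n = {lin_ext (ract_gen r b) x - lin_ext (lact_gen l b) x | x b. x \<in> tfree n \<and> b \<in> B}"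

text \<open>Both quotients at once, by tensor relations and by commutators: the kernel of the map
  from formal combinations onto \<open>hoch_Z\<close>.\<close>

definition hoch_ker :: "'a set \<Rightarrow> nat \<Rightarrow> ('k, 'm, 'a) chains set" where
  "hoch_ker B n = pm.span (comm_rels B n \<union> tens_rels sA sM r UNIV UNIV B n)"

lemma comm_rels_tfree: "comm_rels B n \<subseteq> tfree n"
proof -
  interpret tens_bimodule sA sM l r UNIV UNIV B by (rule tens_bimodule_UNIV)
  show ?thesis
  proof
    fix y assume "y \<in> comm_rels B n"
    then obtain x b where x: "x \<in> tfree n" "y = lin_ext (ract_gen r b) x - lin_ext (lact_gen l b) x"
      unfolding comm_rels_def by blast
    have "keys y \<subseteq> tgens n"
      unfolding x(2) using x(1) by (intro keys_diff_subset lact_keys ract_keys) auto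
    then show "y \<in> tfree n" by simp
  qed
qed

text \<open>Elements of \<open>hoch_Z\<close> are cosets of cosets. Their union is a single coset in
  the free space, which is the set on which \<open>hoch_map\<close> evaluates.\<close>

lemma
  shows presented_hoch: "presented pscale (hoch_Z sA B sM l r n) (tfree n) (hoch_ker B n) (hoch_class sA B sM l r n)"
    and Union_hoch_class: "x \<in> tfree n \<Longrightarrow> \<Union> (hoch_class sA B sM l r n x) = {y \<in> tfree n. y - x \<in> hoch_ker B n}"
proof -
  interpret tens_bimodule sA sM l r UNIV UNIV B by (rule tens_bimodule_UNIV)
  let ?T = "tens sA sM r UNIV UNIV B n" and ?c = "tens_class sA sM r UNIV UNIV B n"
  let ?R = "tens_rels sA sM r UNIV UNIV B n" and ?W = "commutators sA B sM l r n"
  have cls: "vs_diff ?T (tens_ract sA sM r UNIV UNIV B n (?c u) b) (tens_lact sA sM l r UNIV UNIV B n b (?c u)) =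
      ?c (lin_ext (ract_gen r b) u - lin_ext (lact_gen l b) u)" if "u \<in> tfree n" for u :: "('k, 'm, 'a) chains" and b
    unfolding tens_ract_class[OF UNIV_I that] tens_lact_class[OF UNIV_I that]
    by (rule vs_diff_cls) (use lact_keys ract_keys that in simp_all)
  define g where "g u b = lin_ext (ract_gen r b) u - lin_ext (lact_gen l b) u"
    for u :: "('k, 'm, 'a) chains" and b
  define f where "f x b = vs_diff ?T (tens_ract sA sM r UNIV UNIV B n x b)
    (tens_lact sA sM l r UNIV UNIV B n b x)" for x b
  have fg: "f (?c u) b = ?c (g u b)" if "u \<in> tfree n" for u :: "('k, 'm, 'a) chains" and b
    unfolding f_def g_def by (rule cls[OF that])
  have img: "{f x b |x b. x \<in> ?c ` U \<and> b \<in> B} = ?c ` {g u b |u b. u \<in> U \<and> b \<in> B}"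
    if U: "\<And>u b. u \<in> U \<Longrightarrow> f (?c u) b = ?c (g u b)" for U
  proof -
    have "{f x b |x b. x \<in> ?c ` U \<and> b \<in> B} = (\<lambda>(u, b). f (?c u) b) ` (U \<times> B)" by auto
    also have "\<dots> = (\<lambda>(u, b). ?c (g u b)) ` (U \<times> B)" by (rule image_cong) (auto simp: U)
    also have "\<dots> = ?c ` {g u b |u b. u \<in> U \<and> b \<in> B}" by auto
    finally show ?thesis .
  qed
  have "{f x b |x b. x \<in> vcarrier ?T \<and> b \<in> B} = ?c ` comm_rels B n"
    unfolding carrier comm_rels_def g_def[symmetric] by (rule img[OF fg])
  then have W_eq: "?W = vs_span ?T (?c ` comm_rels B n)"
    by (simp only: commutators_def f_def)
  have W: "vs_subspace ?T ?W"
    unfolding W_eq by (rule vs_subspace_vs_span) (unfold carrier, rule image_mono[OF comm_rels_tfree])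
  have "pm.span (comm_rels B n \<union> pm.span ?R) = pm.span (comm_rels B n \<union> ?R)"
    by (simp only: pm.span_Un pm.span_span)
  then have ker: "{x \<in> tfree n. ?c x \<in> ?W} = hoch_ker B n"
    unfolding W_eq vs_span_eq[OF comm_rels_tfree] hoch_ker_def tens_ker_span .
  have "presented pscale (hoch_Z sA B sM l r n) (tfree n) {x \<in> tfree n. ?c x \<in> ?W} (hoch_class sA B sM l r n)"
    unfolding hoch_Z_def hoch_class_def[abs_def]
    by (rule presented_quot[OF W F N_F order_refl]) (simp add: carrier[symmetric])
  then show "presented pscale (hoch_Z sA B sM l r n) (tfree n) (hoch_ker B n) (hoch_class sA B sM l r n)"
    by (simp only: ker)
  assume x: "x \<in> tfree n"
  have "\<Union> (hoch_class sA B sM l r n x) = \<Union> (?c ` {y \<in> tfree n. ?c (y - x) \<in> ?W})"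
    unfolding hoch_class_def using coset_eq[OF W x] by simp
  also have "{y \<in> tfree n. ?c (y - x) \<in> ?W} = {y \<in> tfree n. y - x \<in> hoch_ker B n}"
  proof (rule Collect_cong, rule conj_cong[OF refl])
    fix y :: "('k, 'm, 'a) chains" assume "y \<in> tfree n"
    then have "y - x \<in> tfree n" by (rule Fdiff[OF _ x])
    then show "?c (y - x) \<in> ?W \<longleftrightarrow> y - x \<in> hoch_ker B n" unfolding ker[symmetric] by simp
  qed
  also have "\<Union> (?c ` \<dots>) = {y \<in> tfree n. y - x \<in> hoch_ker B n}"
  proof (intro set_eqI iffI)
    fix z assume "z \<in> \<Union> (?c ` {y \<in> tfree n. y - x \<in> hoch_ker B n})"
    then obtain y where y: "y \<in> tfree n" "y - x \<in> hoch_ker B n" "z \<in> ?c y" by blast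
    then have "z \<in> tfree n" "z - y \<in> tens_ker sA sM r UNIV UNIV B n"
      unfolding tens_class_eq[OF y(1)] by blast+
    moreover from this have "z - y \<in> hoch_ker B n"
      unfolding tens_ker_span hoch_ker_def using pm.span_mono[of ?R "comm_rels B n \<union> ?R"] by blast
    then have "(z - y) + (y - x) \<in> hoch_ker B n"
      using y(2) unfolding hoch_ker_def by (rule pm.span_add)
    ultimately show "z \<in> {y \<in> tfree n. y - x \<in> hoch_ker B n}" by simp
  next
    fix z assume z: "z \<in> {y \<in> tfree n. y - x \<in> hoch_ker B n}"
    then have zF: "z \<in> tfree n" by simp
    have "z \<in> ?c z" unfolding tens_class_eq[OF zF] using zF pm.subspace_0[OF N] by simp
    then show "z \<in> \<Union> (?c ` {y \<in> tfree n. y - x \<in> hoch_ker B n})" using z by blast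
  qed
  finally show "\<Union> (hoch_class sA B sM l r n x) = {y \<in> tfree n. y - x \<in> hoch_ker B n}" .
qed

lemma hoch_map_class:
  fixes x :: "('k, 'm, 'a) chains"
  assumes F: "\<And>x :: 'm \<times> 'a list \<Rightarrow>\<^sub>0 'k. x \<in> tfree p \<Longrightarrow> lin_ext g x \<in> tfree n"
    and N: "\<And>x. x \<in> hoch_ker B p \<Longrightarrow> lin_ext g x \<in> hoch_ker B n" and x: "x \<in> tfree p"
  shows "hoch_map sA B sM l r n g (hoch_class sA B sM l r p x) = hoch_class sA B sM l r n (lin_ext g x)"
proof -
  interpret P: presented pscale "hoch_Z sA B sM l r n" "tfree n" "hoch_ker B n" "hoch_class sA B sM l r n"
    by (rule presented_hoch)
  have "0 \<in> hoch_ker B p" unfolding hoch_ker_def by (rule pm.span_zero)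
  then show ?thesis
    unfolding hoch_map_def Union_hoch_class[OF x]
  proof (intro the_elem_image_unique)
    fix y assume y: "y \<in> {y \<in> tfree p. y - x \<in> hoch_ker B p}"
    then have "lin_ext g y - lin_ext g x \<in> hoch_ker B n"
      using N[of "y - x"] by (simp add: lin_ext_diff)
    then show "hoch_class sA B sM l r n (lin_ext g y) = hoch_class sA B sM l r n (lin_ext g x)"
      using P.cls[OF F F[OF x]] y by simp
  qed (use x in auto)
qed

text \<open>With the empty set in place of \<open>B\<close> no balancing relation remains, so the
  quotient is the tensor product over \<open>k\<close>.\<close>

abbreviation ml_ker :: "nat \<Rightarrow> ('k, 'm, 'a) chains set" where
  "ml_ker n \<equiv> pm.span (tens_rels sA sM r UNIV UNIV {} n)"

lemma tens_rels_mono: "B \<subseteq> B' \<Longrightarrow> tens_rels sA sM r X Y B n \<subseteq> tens_rels sA sM r X Y B' n"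
proof
  fix x assume "B \<subseteq> B'" "x \<in> tens_rels sA sM r X Y B n"
  from this(2,1) show "x \<in> tens_rels sA sM r X Y B' n"
    by (cases rule: tens_rels_cases) (auto intro!: tens_rels_intros)
qed

lemma ml_ker_intros:
  "length as = n \<Longrightarrow> pure (m + m') as - pure m as - pure m' as \<in> ml_ker n"
  "length as = n \<Longrightarrow> pure (sM c m) as - single (m, as) c \<in> ml_ker n"
  "length us + 1 + length vs = n \<Longrightarrow>
    pure m (us @ (a + a') # vs) - pure m (us @ a # vs) - pure m (us @ a' # vs) \<in> ml_ker n"
  "length us + 1 + length vs = n \<Longrightarrow>
    pure m (us @ sA c a # vs) - single (m, us @ a # vs) c \<in> ml_ker n"
  by (rule pm.span_base, rule tens_rels_intros; simp)+

text \<open>Balancedness over the scalars follows from multilinearity.\<close>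

lemma hoch_ker_ground: "hoch_ker (ground sA) n = ml_ker n"
proof
  show "ml_ker n \<subseteq> hoch_ker (ground sA) n"
    unfolding hoch_ker_def by (rule pm.span_mono) (use tens_rels_mono[of "{}"] in blast)
  have l1: "l (sA c 1) m = sM c m" "r m (sA c 1) = sM c m" for c m
    by (simp_all add: l_scale_left l_one r_scale_right r_one)
  have scale1: "sA c 1 * a = sA c a" "a * sA c 1 = sA c a" for c a
    by (simp_all add: scale_mult_left scale_mult_right)
  \<comment> \<open>Each balancing relation or commutator for the scalar \<open>c\<close> compares
    two elements that both reduce to \<open>c\<close> times the same tuple, which takes the role of
    \<open>z\<close>.\<close>
  have swap: "x - y \<in> ml_ker n" if "x - z \<in> ml_ker n" "y - z \<in> ml_ker n" for x y z
    using pm.span_diff[OF that] by simp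
  have "x \<in> ml_ker n" if "x \<in> tens_rels sA sM r UNIV UNIV (ground sA) n" for x
    using that
  proof (cases rule: tens_rels_cases)
    case (lbal m b a as)
    then obtain c where c: "b = sA c 1" by (auto simp: ground_def)
    have 1: "pure (sM c m) (a # as) - single (m, a # as) c \<in> ml_ker n"
      and 2: "pure m (sA c a # as) - single (m, a # as) c \<in> ml_ker n"
      using lbal ml_ker_intros(2)[of "a # as" n c m] ml_ker_intros(4)[of "[]" as n m c a] by simp_all
    show ?thesis using swap[OF 1 2] by (simp add: lbal(1) c l1 scale1)
  next
    case (bal m b us a a' vs)
    then obtain c where c: "b = sA c 1" by (auto simp: ground_def)
    have 1: "pure m (us @ sA c a # a' # vs) - single (m, us @ a # a' # vs) c \<in> ml_ker n"
      and 2: "pure m (us @ a # sA c a' # vs) - single (m, us @ a # a' # vs) c \<in> ml_ker n"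
      using bal ml_ker_intros(4)[of us "a' # vs" n m c a] ml_ker_intros(4)[of "us @ [a]" vs n m c a'] by simp_all
    show ?thesis using swap[OF 1 2] by (simp add: bal(1) c l1 scale1)
  qed (auto intro!: ml_ker_intros)
  moreover have "x \<in> ml_ker n" if x: "x \<in> comm_rels (ground sA) n" for x
  proof -
    obtain u c where u: "u \<in> tfree n" "x = lin_ext (ract_gen r (sA c 1)) u - lin_ext (lact_gen l (sA c 1)) u"
      using x unfolding comm_rels_def ground_def by blast
    show ?thesis
      unfolding u(2)
    proof (rule single_diff_mem[OF lin_ext_hom lin_ext_hom pm.subspace_span, of "tgens n"])
      fix p :: "'m \<times> 'a list" assume "p \<in> tgens n"
      then obtain m as where p: "p = (m, as)" "length as = n" by (auto simp: tens_gens_def)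
      show "lin_ext (ract_gen r (sA c 1)) (single p 1) -
          lin_ext (lact_gen l (sA c 1)) (single p 1) \<in> ml_ker n"
      proof (cases as rule: rev_cases)
        case Nil
        then show ?thesis by (simp add: p l1 pm.span_zero)
      next
        case (snoc us a)
        have 1: "pure m (us @ [sA c a]) - single (m, us @ [a]) c \<in> ml_ker n"
          and 2: "pure (sM c m) (us @ [a]) - single (m, us @ [a]) c \<in> ml_ker n"
          using p snoc ml_ker_intros(4)[of us "[]" n m c a] ml_ker_intros(2)[of "us @ [a]" n c m] by simp_all
        show ?thesis using swap[OF 1 2] by (simp add: p snoc l1 scale1)
      qed
    qed (use u(1) in simp)
  qed
  ultimately show "hoch_ker (ground sA) n \<subseteq> ml_ker n"
    unfolding hoch_ker_def by (intro pm.span_minimal pm.subspace_span) blast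
qed

end

section \<open>Operations on tuples\<close>

text \<open>
  Taking \<open>hd\<close> and \<open>tl\<close> also of lists that are too short makes most identities between these operations
  hold without conditions on lengths.
\<close>

primrec merge :: "nat \<Rightarrow> 'a::times list \<Rightarrow> 'a list" where
  "merge 0 as = hd as * hd (tl as) # tl (tl as)"
| "merge (Suc k) as = hd as # merge k (tl as)"

primrec ins :: "'a::times \<Rightarrow> 'a \<Rightarrow> nat \<Rightarrow> 'a list \<Rightarrow> 'a list" where
  "ins x y 0 as = hd as * x # y * hd (tl as) # tl (tl as)"
| "ins x y (Suc k) as = hd as # ins x y k (tl as)"

primrec cutl :: "'a::times \<Rightarrow> 'a \<Rightarrow> nat \<Rightarrow> 'a list \<Rightarrow> 'a list" where
  "cutl x y 0 as = hd as * x # y # tl as"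
| "cutl x y (Suc k) as = hd as # cutl x y k (tl as)"

primrec rmul :: "'a::times \<Rightarrow> nat \<Rightarrow> 'a list \<Rightarrow> 'a list" where
  "rmul z 0 as = hd as * z # tl as"
| "rmul z (Suc k) as = hd as # rmul z k (tl as)"

lemma length_merge: "Suc k < length as \<Longrightarrow> length (merge k as) = length as - 1"
  by (induction k arbitrary: as) auto

lemma length_ins: "Suc k < length as \<Longrightarrow> length (ins x y k as) = length as"
  by (induction k arbitrary: as) auto

lemma length_cutl: "k < length as \<Longrightarrow> length (cutl x y k as) = Suc (length as)"
  by (induction k arbitrary: as) auto

lemma length_rmul: "k < length as \<Longrightarrow> length (rmul z k as) = length as"
  by (induction k arbitrary: as) auto

lemma merge_take_drop: "Suc k < length as \<Longrightarrow> merge k as = take k as @ [as ! k * as ! Suc k] @ drop (k + 2) as"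
proof (induction k arbitrary: as)
  case 0
  then show ?case by (cases as; cases "tl as") auto
next
  case (Suc k)
  then show ?case by (cases as) auto
qed

lemma ins_append: "ins x y (length us) (us @ a # b # vs) = us @ (a * x) # (y * b) # vs"
  by (induction us) auto

lemma rmul_append: "rmul z (length us) (us @ a # vs) = us @ (a * z) # vs"
  by (induction us) auto

text \<open>The cases where a merge meets the inserted pair: closing the gap between
  \<open>x\<close> and \<open>y\<close> produces the factor \<open>x * y\<close>, closing the gap
  after \<open>y\<close> glues \<open>y\<close> to the next entry.\<close>

lemma
  fixes x y z :: "'a::semigroup_mult"
  shows merge_cutl_eq: "merge i (cutl x y i as) = rmul (x * y) i as"
    and merge_ins_eq: "merge i (ins x y i as) = merge i (rmul (x * y) i as)"
    and merge_Suc_cutl: "merge (Suc i) (cutl x y i as) = ins x y i as"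
    and rmul_rmul: "rmul y i (rmul x i as) = rmul (x * y) i as"
  by (induction i arbitrary: as) (auto simp: mult.assoc)

text \<open>Operations at different positions commute up to an index shift. One induction proves all
  five, since each step strips the head in every identity.\<close>

lemma
  fixes x y z :: "'a::semigroup_mult"
  assumes "i < j"
  shows merge_cutl_less: "merge i (cutl x y j as) = cutl x y (j - 1) (merge i as)"
    and merge_ins_less: "merge i (ins x y j as) = ins x y (j - 1) (merge i as)"
    and merge_rmul: "merge i (rmul z j as) = rmul z (j - 1) (merge i as)"
    and ins_ins: "ins x y i (ins x' y' j as) = ins x' y' j (ins x y i as)"
    and ins_rmul: "rmul z j (ins x y i as) = ins x y i (rmul z j as)"
proof -
  from assms have "merge i (cutl x y j as) = cutl x y (j - 1) (merge i as) \<and>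
    merge i (ins x y j as) = ins x y (j - 1) (merge i as) \<and> merge i (rmul z j as) = rmul z (j - 1) (merge i as) \<and>
    ins x y i (ins x' y' j as) = ins x' y' j (ins x y i as) \<and> rmul z j (ins x y i as) = ins x y i (rmul z j as)"
  proof (induction i arbitrary: j as)
    case 0
    then show ?case by (cases j; cases "j - 1") (auto simp: mult.assoc)
  next
    case (Suc i)
    then obtain j' where "j = Suc j'" "i < j'" by (cases j) auto
    then show ?case using Suc.IH[of j' "tl as"] by (cases j') auto
  qed
  then show "merge i (cutl x y j as) = cutl x y (j - 1) (merge i as)"
    "merge i (ins x y j as) = ins x y (j - 1) (merge i as)"
    "merge i (rmul z j as) = rmul z (j - 1) (merge i as)"
    "ins x y i (ins x' y' j as) = ins x' y' j (ins x y i as)"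
    "rmul z j (ins x y i as) = ins x y i (rmul z j as)"
    by simp_all
qed

lemma merge_ins_gt:
  fixes x y :: "'a::semigroup_mult"
  shows "j < i \<Longrightarrow> merge i (ins x y j as) = ins x y j (merge i as)"
proof (induction j arbitrary: i as)
  case 0
  then obtain i' where "i = Suc i'" by (cases i) auto
  then show ?case by (cases i') (auto simp: mult.assoc)
next
  case (Suc j)
  then obtain i' where "i = Suc i'" "j < i'" by (cases i) auto
  then show ?case using Suc.IH[of i' "tl as"] by auto
qed

lemma merge_cutl_gt: "Suc j < i \<Longrightarrow> merge i (cutl x y j as) = cutl x y j (merge (i - 1) as)"
proof (induction j arbitrary: i as)
  case 0
  then obtain i' where "i = Suc (Suc i')" by (cases i; cases "i - 1") auto
  then show ?case by simp
next
  case (Suc j)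
  then obtain i' where "i = Suc i'" "Suc j < i'" by (cases i) auto
  then show ?case using Suc.IH[of i' "tl as"] by (cases i') auto
qed

lemma last_butlast_cutl:
  "Suc k < length as \<Longrightarrow> cutl x y k (butlast as) @ [last as] = cutl x y k as"
proof (induction k arbitrary: as)
  case 0
  then show ?case by (cases as; cases "tl as") auto
next
  case (Suc k)
  show ?case using Suc.IH[of "tl as"] Suc.prems by (cases as; cases "tl as") auto
qed

lemma last_butlast_merge:
  "Suc (Suc k) < length as \<Longrightarrow> merge k (butlast as) @ [last as] = merge k as"
proof (induction k arbitrary: as)
  case 0
  then show ?case by (cases as; cases "tl as"; cases "tl (tl as)") auto
next
  case (Suc k)
  show ?case using Suc.IH[of "tl as"] Suc.prems by (cases as; cases "tl as") auto
qed

lemma last_butlast_ins: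
  "Suc (Suc k) < length as \<Longrightarrow> ins x y k (butlast as) @ [last as] = ins x y k as"
proof (induction k arbitrary: as)
  case 0
  then show ?case by (cases as; cases "tl as"; cases "tl (tl as)") auto
next
  case (Suc k)
  show ?case using Suc.IH[of "tl as"] Suc.prems by (cases as; cases "tl as") auto
qed

lemma cutl_last: "length as = Suc k \<Longrightarrow> cutl x y k as = rmul x k as @ [y]"
proof (induction k arbitrary: as)
  case (Suc k)
  then show ?case by (cases as) auto
qed (auto simp: length_Suc_conv)

lemma ins_last: "length as = Suc (Suc k) \<Longrightarrow> ins x y k as = rmul x k (butlast as) @ [y * last as]"
proof (induction k arbitrary: as)
  case (Suc k)
  then show ?case by (cases as; cases "tl as") auto
qed (auto simp: length_Suc_conv)

lemma merge_last:
  "length as = Suc (Suc k) \<Longrightarrow> merge k as = butlast (butlast as) @ [last (butlast as) * last as]"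
proof (induction k arbitrary: as)
  case (Suc k)
  then show ?case by (cases as; cases "tl as"; cases "tl (tl as)") auto
qed (auto simp: length_Suc_conv)

lemma rmul_last: "length as = Suc k \<Longrightarrow> rmul x k as = butlast as @ [last as * x]"
proof (induction k arbitrary: as)
  case (Suc k)
  then show ?case by (cases as; cases "tl as") auto
qed (auto simp: length_Suc_conv)

section \<open>Operators on chains induced by maps of tuples\<close>

lemma tens_gens_UNIV [simp]: "p \<in> tgens n \<longleftrightarrow> length (snd p) = n"
  by (cases p) (simp add: tens_gens_def)

text \<open>In the applications \<open>J\<close> indexes the terms \<open>x_j \<otimes> y_j\<close>
  of the idempotent and \<open>\<phi> j\<close> inserts the \<open>j\<close>-th term;
  \<open>lin_ext\<close> is the case of one index.\<close>

definition op :: "'j set \<Rightarrow> ('j \<Rightarrow> 'g \<Rightarrow> 'h) \<Rightarrow> ('g \<Rightarrow>\<^sub>0 'k::field) \<Rightarrow> ('h \<Rightarrow>\<^sub>0 'k)" where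
  "op J \<phi> = lsum pscale (\<lambda>p. \<Sum>j\<in>J. single (\<phi> j p) 1)"

lemma op_hom: "module_hom pscale pscale (op J \<phi>)"
  unfolding op_def by (rule lsum_hom) unfold_locales

lemma op_single [simp]: "op J \<phi> (single p a) = (\<Sum>j\<in>J. single (\<phi> j p) a)"
  unfolding op_def by (subst lsum_single) (unfold_locales, simp add: pm.scale_sum_right)

lemma hom_eq_tfree:
  assumes "module_hom pscale pscale f" "module_hom pscale pscale g"
    and "\<And>p. p \<in> G \<Longrightarrow> f (single p 1) = g (single p 1)"
    and "keys x \<subseteq> G"
  shows "f x = g x"
  using single_diff_mem[OF assms(1,2) pm.subspace_single_0, of G x] assms(3,4) by simp

lemmas hom_eq = hom_eq_tfree[where G = UNIV, simplified]

lemma op_cong: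
  assumes "\<And>j p. j \<in> J \<Longrightarrow> p \<in> G \<Longrightarrow> \<phi> j p = \<psi> j p" "keys x \<subseteq> G"
  shows "op J \<phi> x = op J \<psi> x"
  by (rule hom_eq_tfree[OF op_hom op_hom _ assms(2)]) (simp add: assms(1))

lemma lin_ext_op: "lin_ext g (op J \<phi> x) = op J (\<lambda>j p. g (\<phi> j p)) x"
proof -
  interpret L: module_hom pscale pscale "lin_ext g" by (rule lin_ext_hom)
  show ?thesis
    by (rule hom_eq[OF module_hom_compose[OF op_hom lin_ext_hom, unfolded o_def] op_hom])
      (simp add: L.sum)
qed

lemma op_lin_ext: "op J \<phi> (lin_ext g x) = op J (\<lambda>j p. \<phi> j (g p)) x"
  by (rule hom_eq[OF module_hom_compose[OF lin_ext_hom op_hom, unfolded o_def] op_hom]) simp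

text \<open>The two sums run over independent indices, so commuting maps of tuples give commuting
  operators.\<close>

lemma op_commute:
  assumes "\<And>i j p. p \<in> G \<Longrightarrow> \<phi> j (\<psi> i p) = \<psi> i (\<phi> j p)" "keys x \<subseteq> G"
  shows "op J \<phi> (op I \<psi> x) = op I \<psi> (op J \<phi> x)"
proof -
  interpret L: module_hom pscale pscale "op J \<phi>" by (rule op_hom)
  interpret M: module_hom pscale pscale "op I \<psi>" by (rule op_hom)
  show ?thesis
    by (rule hom_eq_tfree[OF module_hom_compose[OF op_hom op_hom, unfolded o_def]
          module_hom_compose[OF op_hom op_hom, unfolded o_def] _ assms(2)])
      (simp add: L.sum M.sum assms(1), rule sum.swap)
qed

lemma op_tfree:
  fixes \<phi> :: "'j \<Rightarrow> 'm \<times> 'a list \<Rightarrow> 'n \<times> 'b list" and x :: "'m \<times> 'a list \<Rightarrow>\<^sub>0 'k::field"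
  assumes "\<And>j p. j \<in> J \<Longrightarrow> length (snd p) = n \<Longrightarrow> length (snd (\<phi> j p)) = n'"
    and "x \<in> tfree n"
  shows "op J \<phi> x \<in> tfree n'"
proof (rule single_mem[OF op_hom subspace_keys, of "tgens n"])
  fix p :: "'m \<times> 'a list" assume p: "p \<in> tgens n"
  show "op J \<phi> (single p (1 :: 'k)) \<in> tfree n'"
    unfolding op_single
    by (rule pm.subspace_sum[OF subspace_keys]) (use p assms(1) in simp)
qed (use assms(2) in simp)

context k_bimodule
begin

lemma hom_intros:
  "module_hom sM sM (\<lambda>m. m)" "module_hom sA sA (\<lambda>a. a)"
  "module_hom sA sA (\<lambda>a. a * v)" "module_hom sA sA (\<lambda>a. u * a)"
  "module_hom sM sM (\<lambda>m. r m v)" "module_hom sM sM (\<lambda>m. l v m)"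
  "module_hom sA sM (\<lambda>a. r m a)" "module_hom sA sM (\<lambda>a. l a m)"
  by (unfold_locales; simp add: distrib_left distrib_right scale_mult_left scale_mult_right
      r_add_left r_add_right r_scale_left r_scale_right l_add_left l_add_right l_scale_left l_scale_right)+

text \<open>
  All operations below put each argument, acted upon linearly, into a single entry of the result;
  this is what makes them compatible with the multilinearity relations.
\<close>

definition slot_linear :: "('k \<Rightarrow> 'b::ab_group_add \<Rightarrow> 'b) \<Rightarrow> nat \<Rightarrow> ('b \<Rightarrow> 'm \<times> 'a list) \<Rightarrow> bool" where
  "slot_linear s n f \<longleftrightarrow>
    (\<exists>L as. module_hom s sM L \<and> length as = n \<and> f = (\<lambda>x. (L x, as))) \<or>
    (\<exists>L m us vs. module_hom s sA L \<and> length us + 1 + length vs = n \<and> f = (\<lambda>x. (m, us @ L x # vs)))"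

definition multilinear_op :: "nat \<Rightarrow> nat \<Rightarrow> ('m \<times> 'a list \<Rightarrow> 'm \<times> 'a list) \<Rightarrow> bool" where
  "multilinear_op n n' \<phi> \<longleftrightarrow>
    (\<forall>as. length as = n \<longrightarrow> slot_linear sM n' (\<lambda>m. \<phi> (m, as))) \<and>
    (\<forall>m us vs. length us + 1 + length vs = n \<longrightarrow> slot_linear sA n' (\<lambda>a. \<phi> (m, us @ a # vs)))"

lemma slot_linear_M: "module_hom s sM L \<Longrightarrow> length as = n \<Longrightarrow> slot_linear s n (\<lambda>x. (L x, as))"
  unfolding slot_linear_def by blast

lemma slot_linear_A:
  "module_hom s sA L \<Longrightarrow> length us + 1 + length vs = n \<Longrightarrow> slot_linear s n (\<lambda>x. (m, us @ L x # vs))"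
  unfolding slot_linear_def by blast

lemma slot_linear_cases:
  assumes "slot_linear s n f"
  obtains L as where "module_hom s sM L" "length as = n" "f = (\<lambda>x. (L x, as))"
  | L m us vs where "module_hom s sA L" "length us + 1 + length vs = n" "f = (\<lambda>x. (m, us @ L x # vs))"
  using assms unfolding slot_linear_def by blast

lemma slot_linear_length: "slot_linear s n f \<Longrightarrow> length (snd (f x)) = n"
  by (erule slot_linear_cases) auto

lemma multilinear_op_length: "multilinear_op n n' \<phi> \<Longrightarrow> length (snd p) = n \<Longrightarrow> length (snd (\<phi> p)) = n'"
  using slot_linear_length[of sM n' "\<lambda>m. \<phi> (m, snd p)" "fst p"] by (auto simp: multilinear_op_def)

lemma slot_linear_add:
  assumes "slot_linear s n f"
  shows "single (f (x + y)) 1 - single (f x) 1 - single (f y) 1 \<in> ml_ker n"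
  using assms
  by (cases rule: slot_linear_cases) (auto simp: module_hom.add intro!: ml_ker_intros)

lemma slot_linear_scale:
  assumes "slot_linear s n f"
  shows "single (f (s c x)) 1 - single (f x) c \<in> ml_ker n"
  using assms
  by (cases rule: slot_linear_cases) (auto simp: module_hom.scale intro!: ml_ker_intros)

text \<open>Collects a sum of tuples into a single entry; applied with
  \<open>\<Sum>j. x_j y_j = 1\<close>.\<close>

lemma slot_linear_sum:
  assumes "slot_linear s n f" "finite J"
  shows "(\<Sum>j\<in>J. single (f (z j)) 1) - single (f (\<Sum>j\<in>J. z j)) 1 \<in> ml_ker n"
  using assms(2)
proof induction
  case empty
  \<comment> \<open>The empty sum needs a tuple with a zero entry to be zero: this is the scaling
    relation for the scalar \<open>0\<close>.\<close>
  have "f (s 0 0) = f 0" using assms(1)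
    by (cases rule: slot_linear_cases) (simp_all add: module_hom.zero module_hom.scale)
  then show ?case using pm.span_neg[OF slot_linear_scale[OF assms(1), of 0 0]] by simp
next
  case (insert j J)
  have "(\<Sum>j\<in>J. single (f (z j)) 1) - single (f (\<Sum>j\<in>J. z j)) 1 -
      (single (f (z j + (\<Sum>j\<in>J. z j))) 1 - single (f (z j)) 1 -
        single (f (\<Sum>j\<in>J. z j)) 1) \<in> ml_ker n"
    by (rule pm.span_diff[OF insert.IH slot_linear_add[OF assms(1)]])
  then show ?case using insert by (simp add: algebra_simps)
qed

lemma slot_linear_comp:
  assumes "slot_linear s n f" "multilinear_op n n' \<phi>"
  shows "slot_linear s n' (\<lambda>x. \<phi> (f x))"
proof -
  have comp: "slot_linear s n' (\<lambda>x. g (L x))"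
    if L: "module_hom s s' L" and g: "slot_linear s' n' g" for s' :: "'k \<Rightarrow> 'c::ab_group_add \<Rightarrow> 'c" and L g
    using g
  proof (cases rule: slot_linear_cases)
    case (1 L' as)
    then show ?thesis
      using slot_linear_M[OF module_hom_compose[OF L 1(1)] 1(2)] by (simp add: o_def)
  next
    case (2 L' m us vs)
    then show ?thesis
      using slot_linear_A[OF module_hom_compose[OF L 2(1)] 2(2)] by (simp add: o_def)
  qed
  show ?thesis using assms(1)
  proof (cases rule: slot_linear_cases)
    case (1 L as)
    then have "slot_linear sM n' (\<lambda>m. \<phi> (m, as))" using assms(2) by (simp add: multilinear_op_def)
    from comp[OF 1(1) this] show ?thesis by (simp add: 1(3))
  next
    case (2 L m us vs)
    then have "slot_linear sA n' (\<lambda>a. \<phi> (m, us @ a # vs))" using assms(2) by (simp add: multilinear_op_def)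
    from comp[OF 2(1) this] show ?thesis by (simp add: 2(3))
  qed
qed

lemma multilinear_op_comp:
  "multilinear_op n n' \<phi> \<Longrightarrow> multilinear_op n' n'' \<psi> \<Longrightarrow> multilinear_op n n'' (\<lambda>p. \<psi> (\<phi> p))"
  unfolding multilinear_op_def[of n] by (intro conjI allI impI; rule slot_linear_comp) auto

text \<open>Every multilinearity relation concerns one argument, and by slot linearity each
  \<open>\<phi> j\<close> turns it into such a relation again.\<close>

lemma op_ml_ker:
  assumes \<phi>: "\<And>j. j \<in> J \<Longrightarrow> multilinear_op n n' (\<phi> j)" and x: "x \<in> ml_ker n"
  shows "op J \<phi> x \<in> ml_ker n'"
proof (rule module_hom_span_mem[OF op_hom pm.subspace_span _ x])
  interpret op: module_hom pscale pscale "op J \<phi>" by (rule op_hom)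
  fix x assume "x \<in> tens_rels sA sM r UNIV UNIV {} n"
  then show "op J \<phi> x \<in> ml_ker n'"
  proof (cases rule: tens_rels_cases)
    case (madd m m' as)
    then show ?thesis
      using \<phi> slot_linear_add[of sM n' "\<lambda>m. \<phi> _ (m, as)" m m']
      by (auto simp: op.diff multilinear_op_def sum_subtractf[symmetric] intro!: pm.span_sum)
  next
    case (mscale c m as)
    then show ?thesis
      using \<phi> slot_linear_scale[of sM n' "\<lambda>m. \<phi> _ (m, as)" c m]
      by (auto simp: op.diff multilinear_op_def sum_subtractf[symmetric] intro!: pm.span_sum)
  next
    case (add m us a a' vs)
    then show ?thesis
      using \<phi> slot_linear_add[of sA n' "\<lambda>a. \<phi> _ (m, us @ a # vs)" a a']
      by (auto simp: op.diff multilinear_op_def sum_subtractf[symmetric] intro!: pm.span_sum)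
  next
    case (scale c m us a vs)
    then show ?thesis
      using \<phi> slot_linear_scale[of sA n' "\<lambda>a. \<phi> _ (m, us @ a # vs)" c a]
      by (auto simp: op.diff multilinear_op_def sum_subtractf[symmetric] intro!: pm.span_sum)
  qed auto
qed

lemma lin_ext_eq_op: "lin_ext g = op {()} (\<lambda>_. g)"
  by (simp add: lin_ext_lsum op_def)

lemma lin_ext_ml_ker: "multilinear_op n n' g \<Longrightarrow> x \<in> ml_ker n \<Longrightarrow> lin_ext g x \<in> ml_ker n'"
  unfolding lin_ext_eq_op by (rule op_ml_ker)

lemma lin_ext_tfree:
  "multilinear_op n n' g \<Longrightarrow> x \<in> tfree n \<Longrightarrow> lin_ext g x \<in> tfree n'"
  unfolding lin_ext_eq_op by (rule op_tfree) (rule multilinear_op_length)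

text \<open>Slot \<open>0\<close> of a tuple is the module entry, slot \<open>Suc k\<close> is the list entry \<open>k\<close>.\<close>

fun face_at :: "nat \<Rightarrow> 'm \<times> 'a list \<Rightarrow> 'm \<times> 'a list" where
  "face_at 0 (m, as) = (r m (hd as), tl as)"
| "face_at (Suc k) (m, as) = (m, merge k as)"

fun face_last :: "'m \<times> 'a list \<Rightarrow> 'm \<times> 'a list" where
  "face_last (m, as) = (l (last as) m, butlast as)"

fun ins_at :: "'a \<Rightarrow> 'a \<Rightarrow> nat \<Rightarrow> 'm \<times> 'a list \<Rightarrow> 'm \<times> 'a list" where
  "ins_at x y 0 (m, as) = (r m x, y * hd as # tl as)"
| "ins_at x y (Suc k) (m, as) = (m, ins x y k as)"

fun cut_at :: "'a \<Rightarrow> 'a \<Rightarrow> nat \<Rightarrow> 'm \<times> 'a list \<Rightarrow> 'm \<times> 'a list" where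
  "cut_at x y 0 (m, as) = (r m x, y # as)"
| "cut_at x y (Suc k) (m, as) = (m, cutl x y k as)"

fun rmul_at :: "nat \<Rightarrow> 'a \<Rightarrow> 'm \<times> 'a list \<Rightarrow> 'm \<times> 'a list" where
  "rmul_at 0 z (m, as) = (r m z, as)"
| "rmul_at (Suc k) z (m, as) = (m, rmul z k as)"

text \<open>Insertion at the cyclic sign, from the last slot round to slot \<open>0\<close>. For
  \<open>n = 0\<close> these coincide and \<open>m\<close> becomes \<open>y m x\<close>.\<close>

definition ins_cyc :: "nat \<Rightarrow> 'a \<Rightarrow> 'a \<Rightarrow> 'm \<times> 'a list \<Rightarrow> 'm \<times> 'a list" where
  "ins_cyc n x y p = lact_gen l y (rmul_at n x p)"

lemma face_gen_face_at: "length (snd p) = Suc n \<Longrightarrow> i \<le> n \<Longrightarrow> face_gen l r (Suc n) i p = face_at i p"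
  by (cases p; cases i) (auto simp: face_gen_def merge_take_drop)

lemma face_gen_face_last: "face_gen l r (Suc n) (Suc n) p = face_last p"
  by (cases p) (auto simp: face_gen_def)

lemma ract_gen_rmul_at: "length (snd p) = n \<Longrightarrow> ract_gen r b p = rmul_at n b p"
  by (cases p; cases n) (auto simp: rmul_last)

lemma slot_linear_Cons: "slot_linear sA n (\<lambda>a. (m, f a)) \<Longrightarrow> slot_linear sA (Suc n) (\<lambda>a. (m, u # f a))"
proof (erule slot_linear_cases)
  \<comment> \<open>Degenerate alternative: the varying entry is the module slot, although it is the
    constant \<open>m\<close>. Then the constant map is linear and the list does not depend on
    \<open>a\<close>.\<close>
  fix L as assume as: "length as = n" and eq: "(\<lambda>a. (m, f a)) = (\<lambda>x. (L x, as))"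
  have f: "f a = as" for a using eq by (simp add: fun_eq_iff)
  assume "module_hom sA sM L"
  moreover have "L = (\<lambda>_. m)" using eq by (simp add: fun_eq_iff)
  ultimately have "module_hom sA sM (\<lambda>_. m)" by simp
  from slot_linear_M[OF this, of "u # as"] show ?thesis using as by (simp add: f)
next
  fix L m' us vs assume L: "module_hom sA sA L" and "length us + 1 + length vs = n"
    and "(\<lambda>a. (m, f a)) = (\<lambda>x. (m', us @ L x # vs))"
  then show ?thesis using slot_linear_A[OF L, of "u # us" vs "Suc n" m] by (simp add: fun_eq_iff)
qed

lemma slot_linear_hd: "module_hom sA sA L \<Longrightarrow> Suc (length vs) = n \<Longrightarrow> slot_linear sA n (\<lambda>a. (m, L a # vs))"
  using slot_linear_A[of sA L "[]" vs n m] by simp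

lemma slot_linear_snd: "module_hom sA sA L \<Longrightarrow> Suc (Suc (length vs)) = n \<Longrightarrow> slot_linear sA n (\<lambda>a. (m, u # L a # vs))"
  using slot_linear_A[of sA L "[u]" vs n m] by simp

text \<open>The common induction for \<open>merge\<close>, \<open>ins\<close>, \<open>cutl\<close>
  and \<open>rmul\<close>, which all recurse by passing over the head. \<open>c\<close> counts the
  entries needed beyond position \<open>k\<close>; the change of length is \<open>d - e\<close>,
  written with two numbers to avoid subtraction.\<close>

lemma slot_linear_at:
  fixes f :: "nat \<Rightarrow> 'a list \<Rightarrow> 'a list"
  assumes f_Suc: "\<And>k as. f (Suc k) as = hd as # f k (tl as)"
    and len: "\<And>k as. k + c < length as \<Longrightarrow> length (f k as) + e = length as + d"
    and f_0: "\<And>us vs n. length us + 1 + length vs + d = n + e \<Longrightarrow> c < length us + 1 + length vs \<Longrightarrow>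
      slot_linear sA n (\<lambda>a. (m, f 0 (us @ a # vs)))"
  shows "length us + 1 + length vs + d = n + e \<Longrightarrow> k + c < length us + 1 + length vs \<Longrightarrow>
    slot_linear sA n (\<lambda>a. (m, f k (us @ a # vs)))"
proof (induction k arbitrary: us n)
  case 0
  then show ?case using f_0 by simp
next
  case (Suc k)
  show ?case
  proof (cases us)
    case Nil
    then have "Suc (length (f k vs)) = n" using Suc.prems len[of k vs] by simp
    then show ?thesis using Nil by (auto simp: f_Suc intro!: slot_linear_hd hom_intros)
  next
    case (Cons u us')
    obtain n' where n: "n = Suc n'"
      using Suc.prems Cons len[of "Suc k" "us @ undefined # vs"] f_Suc by (cases n) auto
    then show ?thesis using Suc.prems Suc.IH[of us' n'] Cons by (auto simp: f_Suc intro!: slot_linear_Cons)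
  qed
qed

lemma slot_linear_merge:
  "length us + 1 + length vs = Suc n \<Longrightarrow> k < n \<Longrightarrow> slot_linear sA n (\<lambda>a. (m, merge k (us @ a # vs)))"
proof (rule slot_linear_at[where c = 1 and d = 0 and e = 1])
  fix us vs :: "'a list" and n
  assume "length us + 1 + length vs + 0 = n + 1" "1 < length us + 1 + length vs"
  then show "slot_linear sA n (\<lambda>a. (m, merge 0 (us @ a # vs)))"
    using slot_linear_A[OF hom_intros(2), of "hd us * hd (tl us) # tl (tl us)" vs n m]
    by (cases us; cases "tl us") (auto intro!: slot_linear_hd hom_intros)
qed (auto simp: length_merge)

lemma slot_linear_ins:
  "length us + 1 + length vs = n \<Longrightarrow> Suc k < n \<Longrightarrow> slot_linear sA n (\<lambda>a. (m, ins x y k (us @ a # vs)))"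
proof (rule slot_linear_at[where c = 1 and d = 0 and e = 0])
  fix us vs :: "'a list" and n
  assume "length us + 1 + length vs + 0 = n + 0" "1 < length us + 1 + length vs"
  then show "slot_linear sA n (\<lambda>a. (m, ins x y 0 (us @ a # vs)))"
    using slot_linear_A[OF hom_intros(2), of "hd us * x # y * hd (tl us) # tl (tl us)" vs n m]
    by (cases us; cases "tl us") (auto intro!: slot_linear_hd slot_linear_snd hom_intros)
qed (auto simp: length_ins)

lemma slot_linear_cutl:
  "length us + 1 + length vs = n \<Longrightarrow> k < n \<Longrightarrow> slot_linear sA (Suc n) (\<lambda>a. (m, cutl x y k (us @ a # vs)))"
proof (rule slot_linear_at[where c = 0 and d = 1 and e = 0])
  fix us vs :: "'a list" and n
  assume "length us + 1 + length vs + 1 = n + 0"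
  then show "slot_linear sA n (\<lambda>a. (m, cutl x y 0 (us @ a # vs)))"
    using slot_linear_A[OF hom_intros(2), of "hd us * x # y # tl us" vs n m]
    by (cases us) (auto intro!: slot_linear_hd hom_intros)
qed (auto simp: length_cutl)

lemma slot_linear_rmul:
  "length us + 1 + length vs = n \<Longrightarrow> k < n \<Longrightarrow> slot_linear sA n (\<lambda>a. (m, rmul z k (us @ a # vs)))"
proof (rule slot_linear_at[where c = 0 and d = 0 and e = 0])
  fix us vs :: "'a list" and n
  assume "length us + 1 + length vs + 0 = n + 0"
  then show "slot_linear sA n (\<lambda>a. (m, rmul z 0 (us @ a # vs)))"
    using slot_linear_A[OF hom_intros(2), of "hd us * z # tl us" vs n m]
    by (cases us) (auto intro!: slot_linear_hd hom_intros)
qed (auto simp: length_rmul)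

lemma multilinear_face_at: "i \<le> n \<Longrightarrow> multilinear_op (Suc n) n (face_at i)"
proof (cases i)
  case 0
  have "slot_linear sA n (\<lambda>a. face_at 0 (m, us @ a # vs))" if "length us + 1 + length vs = Suc n" for m us vs
    using that slot_linear_A[OF hom_intros(2), of "tl us" vs n "r m (hd us)"]
    by (cases us) (auto intro!: slot_linear_M hom_intros)
  then show ?thesis using 0 by (auto simp: multilinear_op_def intro!: slot_linear_M hom_intros)
next
  case (Suc k)
  assume "i \<le> n"
  then show ?thesis
    using Suc by (auto simp: multilinear_op_def length_merge intro!: slot_linear_M slot_linear_merge hom_intros)
qed

lemma multilinear_face_last: "multilinear_op (Suc n) n face_last"
proof -
  have "slot_linear sA n (\<lambda>a. face_last (m, us @ a # vs))" if "length us + 1 + length vs = Suc n" for m us vs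
    using that slot_linear_A[OF hom_intros(2), of us "butlast vs" n "l (last vs) m"]
    by (cases vs rule: rev_cases) (auto simp: butlast_append intro!: slot_linear_M hom_intros)
  then show ?thesis by (auto simp: multilinear_op_def intro!: slot_linear_M hom_intros)
qed

lemma multilinear_ins_at: "i < n \<Longrightarrow> multilinear_op n n (ins_at x y i)"
proof (cases i)
  case 0
  assume n: "i < n"
  have "slot_linear sA n (\<lambda>a. ins_at x y 0 (m, us @ a # vs))" if "length us + 1 + length vs = n" for m us vs
    using that slot_linear_A[OF hom_intros(2), of "y * hd us # tl us" vs n "r m x"]
    by (cases us) (auto intro!: slot_linear_hd hom_intros)
  then show ?thesis using 0 n by (auto simp: multilinear_op_def intro!: slot_linear_M hom_intros)
next
  case (Suc k)
  assume "i < n"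
  then show ?thesis
    using Suc by (auto simp: multilinear_op_def length_ins intro!: slot_linear_M slot_linear_ins hom_intros)
qed

lemma multilinear_cut_at: "i \<le> n \<Longrightarrow> multilinear_op n (Suc n) (cut_at x y i)"
proof (cases i)
  case 0
  have "slot_linear sA (Suc n) (\<lambda>a. cut_at x y 0 (m, us @ a # vs))" if "length us + 1 + length vs = n" for m us vs
    using that slot_linear_A[OF hom_intros(2), of "y # us" vs "Suc n" "r m x"] by simp
  then show ?thesis using 0 by (auto simp: multilinear_op_def intro!: slot_linear_M hom_intros)
next
  case (Suc k)
  assume "i \<le> n"
  then show ?thesis
    using Suc by (auto simp: multilinear_op_def length_cutl intro!: slot_linear_M slot_linear_cutl hom_intros)
qed

lemma multilinear_rmul_at: "i \<le> n \<Longrightarrow> multilinear_op n n (rmul_at i z)"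
proof (cases i)
  case 0
  then show ?thesis
    by (auto simp: multilinear_op_def intro!: slot_linear_M slot_linear_A hom_intros)
next
  case (Suc k)
  assume "i \<le> n"
  then show ?thesis
    using Suc by (auto simp: multilinear_op_def length_rmul intro!: slot_linear_M slot_linear_rmul hom_intros)
qed

lemma multilinear_lact: "multilinear_op n n (lact_gen l y)"
  by (auto simp: multilinear_op_def intro!: slot_linear_M slot_linear_A hom_intros)

lemma multilinear_ins_cyc: "multilinear_op n n (ins_cyc n x y)"
  unfolding ins_cyc_def by (rule multilinear_op_comp[OF multilinear_rmul_at multilinear_lact]) simp

text \<open>Linearity in the multiplier instead of an entry; this is what allows sums over the
  idempotent to be collected.\<close>

lemma slot_linear_rmul_at: "i \<le> length (snd p) \<Longrightarrow> slot_linear sA (length (snd p)) (\<lambda>z. rmul_at i z p)"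
proof -
  have "slot_linear sA (length as) (\<lambda>z. (m, rmul z k as))" if "k < length as" for m k as
    using that
  proof (induction k arbitrary: as)
    case 0
    then show ?case by (cases as) (auto intro!: slot_linear_hd hom_intros)
  next
    case (Suc k)
    then show ?case by (cases as) (auto intro!: slot_linear_Cons)
  qed
  then show "i \<le> length (snd p) \<Longrightarrow> ?thesis"
    by (cases p; cases i) (auto intro!: slot_linear_M hom_intros)
qed

section \<open>Relations between faces, cuts and insertions on tuples\<close>

lemma face_at_cut_at_less: "i < j \<Longrightarrow> face_at i (cut_at x y j p) = cut_at x y (j - 1) (face_at i p)"
  using merge_cutl_less[of "i - 1" "j - 1" x y "snd p"]
  by (cases p; cases i; cases j; cases "j - 1") (auto simp: r_mult)

lemma face_at_cut_at_gt: "Suc j < i \<Longrightarrow> face_at i (cut_at x y j p) = cut_at x y j (face_at (i - 1) p)"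
  using merge_cutl_gt[of "j - 1" "i - 1" x y "snd p"]
  by (cases p; cases j; cases i; cases "i - 1") auto

lemma face_at_cut_at_eq: "face_at i (cut_at x y i p) = rmul_at i (x * y) p"
  by (cases p; cases i) (auto simp: merge_cutl_eq r_mult)

lemma face_at_Suc_cut_at: "face_at (Suc i) (cut_at x y i p) = ins_at x y i p"
  using merge_Suc_cutl[of "i - 1" x y "snd p"] by (cases p; cases i) auto

lemma face_at_ins_at_less: "i < j \<Longrightarrow> face_at i (ins_at x y j p) = ins_at x y (j - 1) (face_at i p)"
  using merge_ins_less[of "i - 1" "j - 1" x y "snd p"]
  by (cases p; cases i; cases j; cases "j - 1") (auto simp: r_mult)

lemma face_at_ins_at_gt: "j < i \<Longrightarrow> face_at i (ins_at x y j p) = ins_at x y j (face_at i p)"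
  using merge_ins_gt[of "j - 1" "i - 1" x y "snd p"]
  by (cases p; cases j; cases i; cases "i - 1") (auto simp: mult.assoc)

lemma face_at_ins_at_eq: "face_at i (ins_at x y i p) = face_at i (rmul_at i (x * y) p)"
  by (cases p; cases i) (auto simp: merge_ins_eq r_mult)

lemma ins_at_commute: "i < j \<Longrightarrow> ins_at x y i (ins_at x' y' j p) = ins_at x' y' j (ins_at x y i p)"
  using ins_ins[of "i - 1" "j - 1" x y x' y' "snd p"]
  by (cases p; cases i; cases j; cases "j - 1") (auto simp: mult.assoc)

lemma face_at_rmul_at: "i < j \<Longrightarrow> face_at i (rmul_at j z p) = rmul_at (j - 1) z (face_at i p)"
  using merge_rmul[of "i - 1" "j - 1" z "snd p"]
  by (cases p; cases i; cases j; cases "j - 1") (auto simp: r_mult)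

lemma ins_at_rmul_at: "i < j \<Longrightarrow> rmul_at j z (ins_at x y i p) = ins_at x y i (rmul_at j z p)"
  using ins_rmul[of "i - 1" "j - 1" z x y "snd p"]
  by (cases p; cases i; cases j; cases "j - 1") (auto simp: mult.assoc)

lemma rmul_at_rmul_at: "rmul_at i y (rmul_at i x p) = rmul_at i (x * y) p"
  by (cases p; cases i) (auto simp: rmul_rmul r_mult)

lemma rmul_at_one: "i \<le> length (snd p) \<Longrightarrow> rmul_at i 1 p = p"
proof -
  have "rmul 1 k as = as" if "k < length as" for k and as :: "'a list"
    using that
  proof (induction k arbitrary: as)
    case 0
    then show ?case by (cases as) auto
  next
    case (Suc k)
    then show ?case by (cases as) auto
  qed
  then show "i \<le> length (snd p) \<Longrightarrow> ?thesis" by (cases p; cases i) (auto simp: r_one)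
qed

lemma face_at_lact: "face_at i (lact_gen l y p) = lact_gen l y (face_at i p)"
  by (cases p; cases i) (auto simp: l_r)

lemma ins_at_lact: "ins_at x y i (lact_gen l z p) = lact_gen l z (ins_at x y i p)"
  by (cases p; cases i) (auto simp: l_r)

lemma rmul_at_lact: "rmul_at i z (lact_gen l y p) = lact_gen l y (rmul_at i z p)"
  by (cases p; cases i) (auto simp: l_r)

lemma face_at_ins_cyc: "i \<le> n \<Longrightarrow> face_at i (ins_cyc (Suc n) x y p) = ins_cyc n x y (face_at i p)"
  by (simp add: ins_cyc_def face_at_lact face_at_rmul_at)

lemma ins_cyc_ins_at: "i < n \<Longrightarrow> ins_cyc n x y (ins_at x' y' i p) = ins_at x' y' i (ins_cyc n x y p)"
  by (simp add: ins_cyc_def ins_at_lact ins_at_rmul_at)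

lemma face_last_cut_at: "j < length (snd p) \<Longrightarrow> face_last (cut_at x y j p) = cut_at x y j (face_last p)"
  by (cases p; cases j) (auto simp: l_r simp flip: last_butlast_cutl)

lemma face_last_cut_at_last: "length (snd p) = n \<Longrightarrow> face_last (cut_at x y n p) = ins_cyc n x y p"
  by (cases p; cases n) (auto simp: ins_cyc_def cutl_last)

lemma face_last_ins_at: "Suc j < length (snd p) \<Longrightarrow> face_last (ins_at x y j p) = ins_at x y j (face_last p)"
proof (cases p; cases j)
  fix m as assume "p = (m, as)" "j = 0" "Suc j < length (snd p)"
  then show ?thesis by (cases as; cases "tl as") (auto simp: l_r)
next
  fix m as k assume "p = (m, as)" "j = Suc k" "Suc j < length (snd p)"
  then show ?thesis by (auto simp: l_r simp flip: last_butlast_ins)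
qed

lemma face_last_ins_at_last: "length (snd p) = Suc n \<Longrightarrow> face_last (ins_at x y n p) = ins_cyc n x y (face_last p)"
proof (cases p; cases n)
  fix m as assume "p = (m, as)" "n = 0" "length (snd p) = Suc n"
  then show ?thesis by (auto simp: ins_cyc_def length_Suc_conv l_r l_mult)
next
  fix m as k assume "p = (m, as)" "n = Suc k" "length (snd p) = Suc n"
  then show ?thesis by (auto simp: ins_cyc_def ins_last l_mult)
qed

text \<open>The last face brings the two halves of the inserted pair together: \<open>a x\<close>
  acts on \<open>y m\<close>, giving \<open>(a x y) m\<close>.\<close>

lemma face_last_ins_cyc: "length (snd p) = Suc n \<Longrightarrow> face_last (ins_cyc (Suc n) x y p) = face_last (rmul_at (Suc n) (x * y) p)"
  by (cases p) (auto simp: ins_cyc_def rmul_last mult.assoc simp flip: l_mult)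

end

section \<open>Separability idempotents\<close>

lemma tens_rels_subset:
  "X \<subseteq> X' \<Longrightarrow> Y \<subseteq> Y' \<Longrightarrow> tens_rels sA sM r X Y B n \<subseteq> tens_rels sA sM r X' Y' B n"
proof
  fix x assume X: "X \<subseteq> X'" "Y \<subseteq> Y'" and "x \<in> tens_rels sA sM r X Y B n"
  from this(3) show "x \<in> tens_rels sA sM r X' Y' B n"
    by (cases rule: tens_rels_cases) (use X in \<open>auto intro!: tens_rels_intros\<close>)
qed

lemma (in k_algebra) k_bimodule_self: "k_bimodule sA sA (*) (*)"
  by unfold_locales (auto simp: distrib_left distrib_right mult.assoc scale_mult_left scale_mult_right)

text \<open>
  The family \<open>\<Sum>j. x j \<otimes> y j\<close> is a separability idempotent: it is mapped to \<open>1\<close> by multiplication and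
  commutes with \<open>B\<close>, here already in \<open>A \<otimes> A\<close>.
\<close>

locale separability = k_bimodule sA sM l r
  for sA :: "'k::field \<Rightarrow> 'a::{ring, monoid_mult} \<Rightarrow> 'a" and sM :: "'k \<Rightarrow> 'm::ab_group_add \<Rightarrow> 'm"
    and l r +
  fixes B :: "'a set" and J :: "'j set" and x y :: "'j \<Rightarrow> 'a"
  assumes finite_J: "finite J" and y_B: "\<And>j. j \<in> J \<Longrightarrow> y j \<in> B"
    and mult_one: "(\<Sum>j\<in>J. x j * y j) = 1"
    and commute: "\<And>b. b \<in> B \<Longrightarrow>
      (\<Sum>j\<in>J. pure (b * x j) [y j]) - (\<Sum>j\<in>J. pure (x j) [y j * b]) \<in>
        pm.span (tens_rels sA sA (*) UNIV UNIV {} 1)"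
begin

text \<open>
  \<open>E i\<close> sends \<open>a\<^sub>0 \<otimes> \<dots> \<otimes> a\<^sub>n\<close> to \<open>\<Sum>j. \<dots> \<otimes> a\<^sub>i x\<^sub>j \<otimes> y\<^sub>j a\<^sub>i\<^sub>+\<^sub>1 \<otimes> \<dots>\<close>, \<open>EL n\<close> does the same between the last entry and
  the first, and \<open>S i\<close> sends it to \<open>\<Sum>j. \<dots> \<otimes> a\<^sub>i x\<^sub>j \<otimes> y\<^sub>j \<otimes> a\<^sub>i\<^sub>+\<^sub>1 \<otimes> \<dots>\<close>.
\<close>

definition D :: "nat \<Rightarrow> ('k, 'm, 'a) chains \<Rightarrow> ('k, 'm, 'a) chains" where "D i = lin_ext (face_at i)"
definition DL :: "('k, 'm, 'a) chains \<Rightarrow> ('k, 'm, 'a) chains" where "DL = lin_ext face_last"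
definition E :: "nat \<Rightarrow> ('k, 'm, 'a) chains \<Rightarrow> ('k, 'm, 'a) chains" where
  "E i = op J (\<lambda>j. ins_at (x j) (y j) i)"
definition EL :: "nat \<Rightarrow> ('k, 'm, 'a) chains \<Rightarrow> ('k, 'm, 'a) chains" where
  "EL n = op J (\<lambda>j. ins_cyc n (x j) (y j))"
definition S :: "nat \<Rightarrow> ('k, 'm, 'a) chains \<Rightarrow> ('k, 'm, 'a) chains" where
  "S i = op J (\<lambda>j. cut_at (x j) (y j) i)"
text \<open>Multiplication of slot \<open>i\<close> by \<open>1\<close>, spelled out as one tuple
  per term of the idempotent; it is the identity only modulo \<open>ml_ker\<close>.\<close>

definition GM :: "nat \<Rightarrow> ('k, 'm, 'a) chains \<Rightarrow> ('k, 'm, 'a) chains" where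
  "GM i = op J (\<lambda>j. rmul_at i (x j * y j))"

text \<open>The composite \<open>E (k - 1) ... E 0\<close>, filling the first \<open>k\<close>
  tensor signs. Each factor sums over \<open>J\<close> anew, so the copies are independent.\<close>

primrec EE :: "nat \<Rightarrow> ('k, 'm, 'a) chains \<Rightarrow> ('k, 'm, 'a) chains" where
  "EE 0 u = u"
| "EE (Suc k) u = E k (EE k u)"

definition sect :: "nat \<Rightarrow> ('k, 'm, 'a) chains \<Rightarrow> ('k, 'm, 'a) chains" where
  "sect n u = EL n (EE n u)"
definition face :: "nat \<Rightarrow> nat \<Rightarrow> ('k, 'm, 'a) chains \<Rightarrow> ('k, 'm, 'a) chains" where
  "face n i = lin_ext (face_gen l r n i)"
definition htp :: "nat \<Rightarrow> nat \<Rightarrow> ('k, 'm, 'a) chains \<Rightarrow> ('k, 'm, 'a) chains" where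
  "htp n j u = S j (EE j u)"

lemma D_hom: "module_hom pscale pscale (D i)" unfolding D_def by (rule lin_ext_hom)
lemma DL_hom: "module_hom pscale pscale DL" unfolding DL_def by (rule lin_ext_hom)
lemma E_hom: "module_hom pscale pscale (E i)" unfolding E_def by (rule op_hom)
lemma EL_hom: "module_hom pscale pscale (EL n)" unfolding EL_def by (rule op_hom)
lemma S_hom: "module_hom pscale pscale (S i)" unfolding S_def by (rule op_hom)
lemma face_hom: "module_hom pscale pscale (face n i)" unfolding face_def by (rule lin_ext_hom)

lemma EE_hom: "module_hom pscale pscale (EE k)"
proof (induction k)
  case 0
  show ?case by unfold_locales simp_all
next
  case (Suc k)
  have "EE (Suc k) = (\<lambda>u. E k (EE k u))" by (simp add: fun_eq_iff)
  then show ?case using module_hom_compose[OF Suc E_hom[of k]] by (simp add: o_def)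
qed

lemma sect_hom: "module_hom pscale pscale (sect n)"
  using module_hom_compose[OF EE_hom[of n] EL_hom[of n]] by (simp add: o_def sect_def[abs_def])

lemma htp_hom: "module_hom pscale pscale (htp n j)"
  using module_hom_compose[OF EE_hom[of j] S_hom[of j]] by (simp add: o_def htp_def[abs_def])

lemma E_F: "i < n \<Longrightarrow> u \<in> tfree n \<Longrightarrow> E i u \<in> tfree n"
  unfolding E_def by (rule op_tfree) (rule multilinear_op_length[OF multilinear_ins_at])
lemma EL_F: "u \<in> tfree n \<Longrightarrow> EL n u \<in> tfree n"
  unfolding EL_def by (rule op_tfree) (rule multilinear_op_length[OF multilinear_ins_cyc])
lemma S_F: "i \<le> n \<Longrightarrow> u \<in> tfree n \<Longrightarrow> S i u \<in> tfree (Suc n)"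
  unfolding S_def by (rule op_tfree) (rule multilinear_op_length[OF multilinear_cut_at])
lemma D_F: "i \<le> n \<Longrightarrow> u \<in> tfree (Suc n) \<Longrightarrow> D i u \<in> tfree n"
  unfolding D_def by (rule lin_ext_tfree[OF multilinear_face_at])
lemma DL_F: "u \<in> tfree (Suc n) \<Longrightarrow> DL u \<in> tfree n"
  unfolding DL_def by (rule lin_ext_tfree[OF multilinear_face_last])
lemma EE_F: "k \<le> n \<Longrightarrow> u \<in> tfree n \<Longrightarrow> EE k u \<in> tfree n"
  by (induction k) (simp_all only: EE.simps E_F Suc_le_eq less_imp_le)

lemma E_ml: "i < n \<Longrightarrow> u \<in> ml_ker n \<Longrightarrow> E i u \<in> ml_ker n"
  unfolding E_def by (rule op_ml_ker) (rule multilinear_ins_at)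
lemma EL_ml: "u \<in> ml_ker n \<Longrightarrow> EL n u \<in> ml_ker n"
  unfolding EL_def by (rule op_ml_ker) (rule multilinear_ins_cyc)
lemma S_ml: "i \<le> n \<Longrightarrow> u \<in> ml_ker n \<Longrightarrow> S i u \<in> ml_ker (Suc n)"
  unfolding S_def by (rule op_ml_ker) (rule multilinear_cut_at)
lemma D_ml: "i \<le> n \<Longrightarrow> u \<in> ml_ker (Suc n) \<Longrightarrow> D i u \<in> ml_ker n"
  unfolding D_def by (rule lin_ext_ml_ker) (rule multilinear_face_at)
lemma DL_ml: "u \<in> ml_ker (Suc n) \<Longrightarrow> DL u \<in> ml_ker n"
  unfolding DL_def by (rule lin_ext_ml_ker) (rule multilinear_face_last)
lemma EE_ml: "k \<le> n \<Longrightarrow> u \<in> ml_ker n \<Longrightarrow> EE k u \<in> ml_ker n"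
  by (induction k) (auto simp: E_ml)

lemma lin_ext_cong:
  assumes "\<And>p. p \<in> G \<Longrightarrow> g p = g' p" "keys u \<subseteq> G"
  shows "lin_ext g u = lin_ext g' u"
  unfolding lin_ext_eq_op using assms by (intro op_cong)

lemma face_D: "i \<le> n \<Longrightarrow> u \<in> tfree (Suc n) \<Longrightarrow> face (Suc n) i u = D i u"
  unfolding face_def D_def by (rule lin_ext_cong[of "tgens (Suc n)"]) (auto simp: face_gen_face_at)

lemma face_DL: "face (Suc n) (Suc n) u = DL u"
  unfolding face_def DL_def face_gen_face_last[abs_def] ..

section \<open>Simplicial identities on chains\<close>

lemma D_S_less: "i < j \<Longrightarrow> D i (S j u) = S (j - 1) (D i u)"
  by (simp add: D_def S_def lin_ext_op op_lin_ext face_at_cut_at_less)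
lemma D_S_gt: "Suc j < i \<Longrightarrow> D i (S j u) = S j (D (i - 1) u)"
  by (simp add: D_def S_def lin_ext_op op_lin_ext face_at_cut_at_gt)
lemma D_S_eq: "D i (S i u) = GM i u"
  by (simp add: D_def S_def GM_def lin_ext_op face_at_cut_at_eq)
lemma D_Suc_S: "D (Suc i) (S i u) = E i u"
  by (simp add: D_def S_def E_def lin_ext_op face_at_Suc_cut_at)
lemma D_E_less: "i < j \<Longrightarrow> D i (E j u) = E (j - 1) (D i u)"
  by (simp add: D_def E_def lin_ext_op op_lin_ext face_at_ins_at_less)
lemma D_E_gt: "j < i \<Longrightarrow> D i (E j u) = E j (D i u)"
  by (simp add: D_def E_def lin_ext_op op_lin_ext face_at_ins_at_gt)
lemma D_E_eq: "D i (E i u) = D i (GM i u)"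
  by (simp add: D_def E_def GM_def lin_ext_op face_at_ins_at_eq)
lemma D_EL: "i \<le> n \<Longrightarrow> D i (EL (Suc n) u) = EL n (D i u)"
  by (simp add: D_def EL_def lin_ext_op op_lin_ext face_at_ins_cyc)
lemma E_commute: "i < j \<Longrightarrow> E i (E j u) = E j (E i u)"
  unfolding E_def by (rule op_commute[of UNIV]) (auto simp: ins_at_commute)
lemma EL_E: "i < n \<Longrightarrow> EL n (E i u) = E i (EL n u)"
  unfolding E_def EL_def by (rule op_commute[of UNIV]) (auto simp: ins_cyc_ins_at)

lemma DL_S: "j < n \<Longrightarrow> u \<in> tfree n \<Longrightarrow> DL (S j u) = S j (DL u)"
  unfolding DL_def S_def lin_ext_op op_lin_ext
  by (rule op_cong[of _ "tgens n"]) (auto simp: face_last_cut_at)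
lemma DL_S_last: "u \<in> tfree n \<Longrightarrow> DL (S n u) = EL n u"
  unfolding DL_def S_def EL_def lin_ext_op
  by (rule op_cong[of _ "tgens n"]) (auto simp: face_last_cut_at_last)
lemma DL_E: "Suc j < n \<Longrightarrow> u \<in> tfree n \<Longrightarrow> DL (E j u) = E j (DL u)"
  unfolding DL_def E_def lin_ext_op op_lin_ext
  by (rule op_cong[of _ "tgens n"]) (auto simp: face_last_ins_at)
lemma DL_E_last: "u \<in> tfree (Suc n) \<Longrightarrow> DL (E n u) = EL n (DL u)"
  unfolding DL_def E_def EL_def lin_ext_op op_lin_ext
  by (rule op_cong[of _ "tgens (Suc n)"]) (auto simp: face_last_ins_at_last)
lemma DL_EL: "u \<in> tfree (Suc n) \<Longrightarrow> DL (EL (Suc n) u) = DL (GM (Suc n) u)"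
  unfolding DL_def EL_def GM_def lin_ext_op
  by (rule op_cong[of _ "tgens (Suc n)"]) (auto simp: face_last_ins_cyc)

text \<open>This is where the idempotent multiplying to \<open>1\<close> enters.\<close>

lemma GM_id:
  assumes i: "i \<le> n" and u: "u \<in> tfree n"
  shows "GM i u - u \<in> ml_ker n"
proof -
  have id: "module_hom pscale pscale (\<lambda>u. u)" by unfold_locales simp_all
  have GM: "module_hom pscale pscale (GM i)" unfolding GM_def by (rule op_hom)
  show ?thesis
  proof (rule single_diff_mem[OF GM id pm.subspace_span, of "tgens n"])
    fix p :: "'m \<times> 'a list" assume "p \<in> tgens n"
    then have p: "length (snd p) = n" by simp
    show "GM i (single p 1) - single p 1 \<in> ml_ker n"
      using slot_linear_sum[OF slot_linear_rmul_at finite_J, of i p "\<lambda>j. x j * y j"] i p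
      by (simp add: GM_def mult_one rmul_at_one)
  qed (use u in simp)
qed

lemma D_EE_le: "k \<le> i \<Longrightarrow> D i (EE k u) = EE k (D i u)"
  by (induction k) (auto simp: D_E_gt)

lemma EL_EE: "k \<le> n \<Longrightarrow> EL n (EE k u) = EE k (EL n u)"
  by (induction k) (auto simp: EL_E)

lemma E_EE: "k \<le> i \<Longrightarrow> E i (EE k u) = EE k (E i u)"
  by (induction k) (auto simp: E_commute[symmetric])

lemma DL_EE: "u \<in> tfree (Suc n) \<Longrightarrow> k \<le> n \<Longrightarrow> DL (EE k u) = EE k (DL u)"
proof (induction k)
  case (Suc k)
  have "EE k u \<in> tfree (Suc n)" by (rule EE_F) (use Suc in auto)
  then show ?case using Suc DL_E[of k "Suc n" "EE k u"] by simp
qed simp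

text \<open>Face \<open>i\<close> closes the sign that carries the copy inserted by
  \<open>E i\<close>. That copy collapses to \<open>GM i\<close>, the copies further right shift
  down by one, and \<open>k - 1\<close> remain.\<close>

lemma D_EE_gt:
  assumes u: "u \<in> tfree (Suc n)" and i: "i \<le> n"
  shows "i < k \<Longrightarrow> k \<le> Suc n \<Longrightarrow> D i (EE k u) - EE (k - 1) (D i u) \<in> ml_ker n"
proof (induction k)
  case (Suc k)
  interpret D: module_hom pscale pscale "D i" by (rule D_hom)
  interpret E: module_hom pscale pscale "E m" for m by (rule E_hom)
  show ?case
  proof (cases "k = i")
    case True
    have "EE i u \<in> tfree (Suc n)" by (rule EE_F) (use u i in auto)
    then have "D i (GM i (EE i u) - EE i u) \<in> ml_ker n"
      using i by (intro D_ml GM_id) auto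
    then show ?thesis using True by (simp add: D.diff D_E_eq D_EE_le)
  next
    case False
    then obtain k' where k: "k = Suc k'" "i \<le> k'" using Suc.prems by (cases k) auto
    have "D i (EE k u) - EE (k - 1) (D i u) \<in> ml_ker n"
      using Suc False by simp
    then have "E k' (D i (EE k u) - EE (k - 1) (D i u)) \<in> ml_ker n"
      using k Suc.prems by (intro E_ml) auto
    then show ?thesis using k Suc.prems by (simp add: E.diff D_E_less)
  qed
qed simp

lemma sect_face_ml:
  assumes u: "u \<in> tfree (Suc n)" and i: "i \<le> Suc n"
  shows "sect n (face (Suc n) i u) - face (Suc n) i (sect (Suc n) u) \<in> ml_ker n"
proof -
  interpret EL: module_hom pscale pscale "EL n" by (rule EL_hom)
  interpret DL: module_hom pscale pscale DL by (rule DL_hom)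
  have v: "EE (Suc n) u \<in> tfree (Suc n)" by (rule EE_F[OF order_refl u])
  have su: "sect (Suc n) u \<in> tfree (Suc n)" unfolding sect_def by (rule EL_F[OF v])
  show ?thesis
  proof (cases "i = Suc n")
    \<comment> \<open>The last face closes the cyclic sign, whose copy collapses, and turns the copy
      at the last ordinary sign into the new cyclic one.\<close>
    case True
    have "DL (GM (Suc n) (EE (Suc n) u) - EE (Suc n) u) \<in> ml_ker n"
      by (rule DL_ml[OF GM_id[OF order_refl v]])
    moreover have "DL (EE (Suc n) u) = sect n (DL u)"
      using DL_E_last[OF EE_F[OF _ u, of n]] DL_EE[OF u order_refl] by (simp add: sect_def)
    ultimately have "DL (sect (Suc n) u) - sect n (DL u) \<in> ml_ker n"
      unfolding sect_def[of "Suc n"] DL_EL[OF v] by (simp only: DL.diff)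
    then have "- (DL (sect (Suc n) u) - sect n (DL u)) \<in> ml_ker n" by (rule pm.span_neg)
    then show ?thesis using True by (simp add: face_DL)
  next
    case False
    then have i: "i \<le> n" using i by simp
    have "D i (EE (Suc n) u) - EE n (D i u) \<in> ml_ker n"
      using D_EE_gt[OF u i, of "Suc n"] i by simp
    then have "- EL n (D i (EE (Suc n) u) - EE n (D i u)) \<in> ml_ker n"
      by (intro pm.span_neg EL_ml)
    then have "sect n (D i u) - D i (sect (Suc n) u) \<in> ml_ker n"
      by (simp only: EL.diff sect_def D_EL[OF i] minus_diff_eq)
    then show ?thesis unfolding face_D[OF i u] face_D[OF i su] .
  qed
qed

text \<open>Whatever is bilinear in the two entries of the idempotent inherits its commutation with \<open>B\<close>.\<close>

lemma commute_bilinear: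
  assumes G: "\<And>v. slot_linear sA n (\<lambda>u. G u v)" "\<And>u. slot_linear sA n (\<lambda>v. G u v)" and b: "b \<in> B"
  shows "(\<Sum>j\<in>J. single (G (b * x j) (y j)) 1) -
    (\<Sum>j\<in>J. single (G (x j) (y j * b)) 1) \<in> ml_ker n"
proof -
  \<comment> \<open>A pair \<open>u \<otimes> v\<close> of \<open>A \<otimes> A\<close> is encoded
    as the chain \<open>(u, [v])\<close>; \<open>?g\<close> is the map that \<open>G\<close> induces
    on it.\<close>
  let ?g = "\<lambda>(u, vs). G u (hd vs)"
  interpret g: module_hom pscale pscale "lin_ext ?g :: ('k, 'a, 'a) chains \<Rightarrow> _" by (rule lin_ext_hom)
  have "lin_ext ?g ((\<Sum>j\<in>J. pure (b * x j) [y j]) - (\<Sum>j\<in>J. pure (x j) [y j * b])) \<in> ml_ker n"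
  proof (rule module_hom_span_mem[OF lin_ext_hom pm.subspace_span _ commute[OF b]])
    fix z :: "('k, 'a, 'a) chains" assume "z \<in> tens_rels sA sA (*) UNIV UNIV {} 1"
    then show "lin_ext ?g z \<in> ml_ker n"
    proof (cases rule: tens_rels_cases)
      case (madd m m' as)
      then show ?thesis using slot_linear_add[OF G(1)] by (simp add: g.diff)
    next
      case (mscale c m as)
      then show ?thesis using slot_linear_scale[OF G(1)] by (simp add: g.diff)
    next
      case (add m us a a' vs)
      then show ?thesis using slot_linear_add[OF G(2)] by (simp add: g.diff)
    next
      case (scale c m us a vs)
      then show ?thesis using slot_linear_scale[OF G(2)] by (simp add: g.diff)
    qed auto
  qed
  then show ?thesis by (simp add: g.diff g.sum)
qed

section \<open>The section kills the relations over \<open>B\<close> and splits the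
  projection\<close>

lemma sect_ml: "u \<in> ml_ker n \<Longrightarrow> sect n u \<in> ml_ker n"
  unfolding sect_def by (intro EL_ml EE_ml) auto

text \<open>Insertions at different signs commute, so the one at sign \<open>i\<close> can be
  performed first.\<close>

lemma sect_kill_E:
  assumes "i < n" "E i u \<in> ml_ker n"
  shows "sect n u \<in> ml_ker n"
proof -
  have "EE k u \<in> ml_ker n" if "i < k" "k \<le> n" for k
    using that
  proof (induction k)
    case (Suc k)
    show ?case
    proof (cases "k = i")
      case True
      then show ?thesis using assms E_EE[of i i u] EE_ml[of i n "E i u"] by simp
    next
      case False
      then show ?thesis using Suc by (auto intro: E_ml)
    qed
  qed simp
  from this[OF assms(1) order_refl] show ?thesis unfolding sect_def by (rule EL_ml)
qed

lemma sect_kill_EL: "EL n u \<in> ml_ker n \<Longrightarrow> sect n u \<in> ml_ker n"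
  unfolding sect_def EL_EE[OF order_refl] by (rule EE_ml) simp

text \<open>A balancing relation moves some \<open>b\<close> across one tensor sign. The copy of
  \<open>e\<close> inserted there turns this into \<open>b e - e b\<close>, which vanishes.
  Commutators are the same relation at the cyclic sign, handled by \<open>EL\<close>.\<close>

lemma sect_hoch_ker:
  assumes "u \<in> hoch_ker B n"
  shows "sect n u \<in> ml_ker n"
proof -
  interpret E: module_hom pscale pscale "E m" for m by (rule E_hom)
  have rels: "sect n z \<in> ml_ker n" if "z \<in> tens_rels sA sM r UNIV UNIV B n" for z
    using that
  proof (cases rule: tens_rels_cases)
    case (lbal m b a as)
    have 1: "slot_linear sA n (\<lambda>u. (r m u, (v * a) # as))" for v
      by (rule slot_linear_M[OF hom_intros(7)]) (use lbal in simp)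
    have 2: "slot_linear sA n (\<lambda>v. (r m u, (v * a) # as))" for u
      by (rule slot_linear_hd[OF hom_intros(3)]) (use lbal in simp)
    have "E 0 z \<in> ml_ker n"
      using commute_bilinear[of n "\<lambda>u v. (r m u, (v * a) # as)" b, OF 1 2 lbal(2)]
      by (simp add: lbal(1) E.diff) (simp add: E_def r_mult mult.assoc)
    then show ?thesis using lbal by (intro sect_kill_E[of 0]) auto
  next
    case (bal m b us a a' vs)
    have 1: "slot_linear sA n (\<lambda>u. (m, us @ (a * u) # (v * a') # vs))" for v
      by (rule slot_linear_A) (use bal in \<open>auto intro: hom_intros\<close>)
    have 2: "slot_linear sA n (\<lambda>v. (m, us @ (a * u) # (v * a') # vs))" for u
      using slot_linear_A[OF hom_intros(3)[of a'], of "us @ [a * u]" vs n m] bal by simp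
    have "E (Suc (length us)) z \<in> ml_ker n"
      using commute_bilinear[of n "\<lambda>u v. (m, us @ (a * u) # (v * a') # vs)" b, OF 1 2 bal(2)]
      by (simp add: bal(1) E.diff) (simp add: E_def ins_append mult.assoc)
    then show ?thesis using bal by (intro sect_kill_E[of "Suc (length us)"]) auto
  qed (auto intro!: sect_ml ml_ker_intros)
  have comm: "sect n z \<in> ml_ker n" if mem: "z \<in> comm_rels B n" for z
  proof -
    obtain v b where v: "v \<in> tfree n" "b \<in> B" and z: "z = lin_ext (ract_gen r b) v - lin_ext (lact_gen l b) v"
      using mem unfolding comm_rels_def by blast
    interpret EL: module_hom pscale pscale "EL n" by (rule EL_hom)
    have "EL n (lin_ext (ract_gen r b) v) - EL n (lin_ext (lact_gen l b) v) \<in> ml_ker n"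
      unfolding EL_def op_lin_ext
    proof (rule single_diff_mem[OF op_hom op_hom pm.subspace_span, of "tgens n"])
      fix p :: "'m \<times> 'a list" assume "p \<in> tgens n"
      then have p: "length (snd p) = n" by simp
      have 1: "slot_linear sA n (\<lambda>u. lact_gen l v (rmul_at n u p))" for v
        using slot_linear_comp[OF slot_linear_rmul_at multilinear_lact] p by blast
      have 2: "slot_linear sA n (\<lambda>v. lact_gen l v (rmul_at n u p))" for u
        using p multilinear_op_length[OF multilinear_rmul_at[OF order_refl], of p n u]
        by (cases "rmul_at n u p") (auto intro!: slot_linear_M hom_intros)
      have R: "ins_cyc n (x j) (y j) (ract_gen r b p) = lact_gen l (y j) (rmul_at n (b * x j) p)" for j
        unfolding ract_gen_rmul_at[OF p] by (simp add: ins_cyc_def rmul_at_rmul_at)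
      have L: "ins_cyc n (x j) (y j) (lact_gen l b p) = lact_gen l (y j * b) (rmul_at n (x j) p)" for j
        unfolding ins_cyc_def rmul_at_lact by (cases "rmul_at n (x j) p") (simp add: l_mult)
      show "op J (\<lambda>j p. ins_cyc n (x j) (y j) (ract_gen r b p)) (single p 1) -
          op J (\<lambda>j p. ins_cyc n (x j) (y j) (lact_gen l b p)) (single p 1) \<in> ml_ker n"
        unfolding op_single R L using commute_bilinear[OF 1 2 v(2)] by simp
    qed (use v in simp)
    then show ?thesis unfolding z by (intro sect_kill_EL) (simp only: EL.diff)
  qed
  show ?thesis
    by (rule module_hom_span_mem[OF sect_hom pm.subspace_span _ assms[unfolded hoch_ker_def]])
      (use rels comm in blast)
qed

lemma ml_hoch_ker: "ml_ker n \<subseteq> hoch_ker B n"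
  unfolding hoch_ker_def by (rule pm.span_mono) (use tens_rels_mono[of "{}" B] in blast)

text \<open>Since \<open>y j\<close> lies in \<open>B\<close>, it can be moved back across the sign;
  the pair then meets in slot \<open>i\<close> and \<open>GM i\<close> results.\<close>

lemma E_id:
  assumes i: "i < n" and u: "u \<in> tfree n"
  shows "E i u - u \<in> hoch_ker B n"
proof -
  have "E i u - GM i u \<in> hoch_ker B n"
    unfolding E_def GM_def
  proof (rule single_diff_mem[OF op_hom op_hom, of _ "tgens n"])
    show "pm.subspace (hoch_ker B n)" unfolding hoch_ker_def by (rule pm.subspace_span)
    fix p :: "'m \<times> 'a list" assume "p \<in> tgens n"
    then obtain m as where p: "p = (m, as)" "length as = n" by (cases p) auto
    have "single (ins_at (x j) (y j) i p) 1 - single (rmul_at i (x j * y j) p) 1 \<in> hoch_ker B n"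
      if j: "j \<in> J" for j
    proof -
      have "- (single (rmul_at i (x j * y j) p) 1 - single (ins_at (x j) (y j) i p) 1) \<in> hoch_ker B n"
      proof (unfold hoch_ker_def, rule pm.span_neg, rule pm.span_base, rule UnI2, cases i)
        case 0
        then obtain a vs where "as = a # vs" using p i by (cases as) auto
        then show "single (rmul_at i (x j * y j) p) 1 - single (ins_at (x j) (y j) i p) 1
            \<in> tens_rels sA sM r UNIV UNIV B n"
          using p 0 tens_rels_intros(5)[of "y j" B "r m (x j)" UNIV a UNIV vs n r sA sM] y_B[OF j]
          by (simp add: r_mult)
      next
        case (Suc k)
        define us where "us = take k as"
        have k: "Suc k < length as" using p i Suc by simp
        then have us: "k = length us" by (simp add: us_def)
        define a a' vs where "a = as ! k" and "a' = as ! Suc k" and "vs = drop (Suc (Suc k)) as"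
        have "as = take k as @ drop k as" by simp
        also have "drop k as = a # a' # vs"
          unfolding a_def a'_def vs_def using k by (simp only: Cons_nth_drop_Suc Suc_lessD)
        finally have as: "as = us @ a # a' # vs" unfolding us_def .
        have n: "length us + 2 + length vs = n" using p(2) unfolding as by simp
        show "single (rmul_at i (x j * y j) p) 1 - single (ins_at (x j) (y j) i p) 1
            \<in> tens_rels sA sM r UNIV UNIV B n"
          using tens_rels_intros(6)[OF y_B[OF j], of m UNIV us UNIV "a * x j" a' vs n sA sM r] n
          unfolding p(1) Suc rmul_at.simps ins_at.simps as us rmul_append ins_append by (simp add: mult.assoc)
      qed
      then show ?thesis by simp
    qed
    then show "op J (\<lambda>j. ins_at (x j) (y j) i) (single p 1) -
        op J (\<lambda>j. rmul_at i (x j * y j)) (single p 1) \<in> hoch_ker B n"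
      unfolding op_single sum_subtractf[symmetric] hoch_ker_def by (intro pm.span_sum)
  qed (use u in simp)
  moreover have "GM i u - u \<in> hoch_ker B n" using GM_id[OF _ u, of i] i ml_hoch_ker by auto
  ultimately have "(E i u - GM i u) + (GM i u - u) \<in> hoch_ker B n"
    unfolding hoch_ker_def by (rule pm.span_add)
  then show ?thesis by simp
qed

text \<open>As for \<open>E\<close>, but \<open>y j\<close> returns across the cyclic sign, by a
  commutator.\<close>

lemma EL_id:
  assumes u: "u \<in> tfree n"
  shows "EL n u - u \<in> hoch_ker B n"
proof -
  have "GM n u - EL n u \<in> hoch_ker B n"
    unfolding EL_def GM_def
  proof (rule single_diff_mem[OF op_hom op_hom, of _ "tgens n"])
    show "pm.subspace (hoch_ker B n)" unfolding hoch_ker_def by (rule pm.subspace_span)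
    fix p :: "'m \<times> 'a list" assume "p \<in> tgens n"
    then have p: "length (snd p) = n" by simp
    have "single (rmul_at n (x j * y j) p) 1 - single (ins_cyc n (x j) (y j) p) 1 \<in> hoch_ker B n"
      if j: "j \<in> J" for j
    proof -
      define q where "q = rmul_at n (x j) p"
      have q: "length (snd q) = n"
        unfolding q_def by (rule multilinear_op_length[OF multilinear_rmul_at[OF order_refl] p])
      then have "single q 1 \<in> tfree n" by simp
      then have "lin_ext (ract_gen r (y j)) (single q 1) -
          lin_ext (lact_gen l (y j)) (single q 1) \<in> comm_rels B n"
        unfolding comm_rels_def using y_B[OF j] by blast
      moreover have "ract_gen r (y j) q = rmul_at n (x j * y j) p"
        using ract_gen_rmul_at[OF q, of "y j"] rmul_at_rmul_at[of n "y j" "x j" p] by (simp only: q_def)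
      moreover have "lact_gen l (y j) q = ins_cyc n (x j) (y j) p" unfolding ins_cyc_def q_def ..
      ultimately have "single (rmul_at n (x j * y j) p) 1 - single (ins_cyc n (x j) (y j) p) 1
          \<in> comm_rels B n"
        by (simp only: lin_ext_single)
      then show ?thesis unfolding hoch_ker_def by (intro pm.span_base UnI1)
    qed
    then show "op J (\<lambda>j. rmul_at n (x j * y j)) (single p 1) -
        op J (\<lambda>j. ins_cyc n (x j) (y j)) (single p 1) \<in> hoch_ker B n"
      unfolding op_single sum_subtractf[symmetric] hoch_ker_def by (intro pm.span_sum)
  qed (use u in simp)
  moreover have "GM n u - u \<in> hoch_ker B n" using GM_id[OF order_refl u] ml_hoch_ker by blast
  ultimately have "(GM n u - u) - (GM n u - EL n u) \<in> hoch_ker B n"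
    unfolding hoch_ker_def by (rule pm.span_diff[rotated])
  then show ?thesis by simp
qed

lemma sect_id:
  assumes u: "u \<in> tfree n"
  shows "sect n u - u \<in> hoch_ker B n"
proof -
  have EE: "EE k u - u \<in> hoch_ker B n" if "k \<le> n" for k
    using that
  proof (induction k)
    case 0
    show ?case by (simp add: hoch_ker_def pm.span_zero)
  next
    case (Suc k)
    have "EE k u \<in> tfree n" by (rule EE_F) (use u Suc in auto)
    then have "(E k (EE k u) - EE k u) + (EE k u - u) \<in> hoch_ker B n"
      using E_id[of k n "EE k u"] Suc unfolding hoch_ker_def by (intro pm.span_add) auto
    then show ?case by simp
  qed
  have "(EL n (EE n u) - EE n u) + (EE n u - u) \<in> hoch_ker B n"
    using EL_id[OF EE_F[OF order_refl u]] EE[OF order_refl] unfolding hoch_ker_def by (intro pm.span_add) auto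
  then show ?thesis by (simp add: sect_def)
qed

end

text \<open>Modulo \<open>NB\<close>, \<open>f x\<close> equals \<open>\<sigma> (f x)\<close>, which
  is congruent to \<open>f (\<sigma> x)\<close> and so lies in \<open>NK\<close>. Thus faces and
  rotation descend to the quotient over \<open>B\<close> without a check on balancing
  relations.\<close>

lemma (in splitting) NB_invariant:
  assumes f: "module_hom s s f" "\<And>u. u \<in> F m \<Longrightarrow> f u \<in> F n"
    and f_NK: "\<And>u. u \<in> NK m \<Longrightarrow> f u \<in> NK n"
    and comm: "\<And>u. u \<in> F m \<Longrightarrow> \<sigma> n (f u) - f (\<sigma> m u) \<in> NK n"
    and NB: "subspace (NB n)" and x: "x \<in> NB m"
  shows "f x \<in> NB n"
proof -
  have xF: "x \<in> F m" using x NB_F by blast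
  have "(\<sigma> n (f x) - f (\<sigma> m x)) + f (\<sigma> m x) \<in> NK n"
    by (rule subspace_add[OF NK comm[OF xF] f_NK[OF \<sigma>_NB[OF x]]])
  then have "\<sigma> n (f x) \<in> NB n" using NK_NB by auto
  then have "\<sigma> n (f x) - (\<sigma> n (f x) - f x) \<in> NB n"
    by (rule subspace_diff[OF NB _ \<sigma>_id[OF f(2)[OF xF]]])
  then show ?thesis by simp
qed

section \<open>Verification of the splitting for the Hochschild complexes\<close>

context separability
begin

lemma face_tfree: "i \<le> Suc n \<Longrightarrow> u \<in> tfree (Suc n) \<Longrightarrow> face (Suc n) i u \<in> tfree n"
  using D_F[of i n u] DL_F[of u n] face_D[of i n u] face_DL[of n u] by (cases "i = Suc n") simp_all

lemma ml_tfree: "u \<in> ml_ker n \<Longrightarrow> u \<in> tfree n"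
  using presented.N_F[OF presented_hoch[of "ground sA" n]] unfolding hoch_ker_ground by blast

lemma face_ml: "i \<le> Suc n \<Longrightarrow> u \<in> ml_ker (Suc n) \<Longrightarrow> face (Suc n) i u \<in> ml_ker n"
  using D_ml[of i n u] DL_ml[of u n] face_D[OF _ ml_tfree, of i n u] face_DL[of n u]
  by (cases "i = Suc n") simp_all

lemma splitting: "splitting pscale tfree ml_ker (hoch_ker B) face htp sect"
proof (intro splitting.intro splitting_axioms.intro)
  show "pm.subspace (ml_ker n)" for n by (rule pm.subspace_span)
  show "hoch_ker B n \<subseteq> tfree n" for n by (rule presented.N_F[OF presented_hoch])
  show "sect n u \<in> tfree n" if "u \<in> tfree n" for n u
    unfolding sect_def by (rule EL_F[OF EE_F[OF order_refl that]])
  show "htp n j u \<in> tfree (Suc n)" if "j \<le> n" "u \<in> tfree n" for n j u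
    unfolding htp_def by (rule S_F[OF that(1) EE_F[OF that]])
  show "htp n j u \<in> ml_ker (Suc n)" if "j \<le> n" "u \<in> ml_ker n" for n j u
    unfolding htp_def by (rule S_ml[OF that(1) EE_ml[OF that]])
  show "face (Suc n) 0 (htp n 0 u) - u \<in> ml_ker n" if "u \<in> tfree n" for n u
    using that S_F[of 0 n u] by (simp add: htp_def face_D D_S_eq GM_id)
  show "face (Suc n) (Suc n) (htp n n u) - sect n u \<in> ml_ker n" if "u \<in> tfree n" for n u
    unfolding htp_def face_DL sect_def DL_S_last[OF EE_F[OF order_refl that]]
    by (simp add: pm.span_zero)
  \<comment> \<open>Both sides represent \<open>EE (Suc j) u\<close>: one glues the free
    \<open>y\<close> to the next entry, the other multiplies the pair at the next cut to
    \<open>1\<close>.\<close>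
  show "face (Suc n) (Suc j) (htp n j u) - face (Suc n) (Suc j) (htp n (Suc j) u) \<in> ml_ker n"
    if j: "j < n" and u: "u \<in> tfree n" for n j u
  proof -
    have F: "EE j u \<in> tfree n" "EE (Suc j) u \<in> tfree n"
      by (rule EE_F[OF _ u], use j in simp)+
    have SF: "S j (EE j u) \<in> tfree (Suc n)" "S (Suc j) (EE (Suc j) u) \<in> tfree (Suc n)"
      using S_F[OF _ F(1), of j] S_F[OF _ F(2), of "Suc j"] j by simp_all
    have "- (GM (Suc j) (EE (Suc j) u) - EE (Suc j) u) \<in> ml_ker n"
      using j F(2) by (intro pm.span_neg GM_id) auto
    moreover have "face (Suc n) (Suc j) (htp n j u) = EE (Suc j) u"
      unfolding htp_def using face_D[OF _ SF(1), of "Suc j"] j by (simp add: D_Suc_S)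
    moreover have "face (Suc n) (Suc j) (htp n (Suc j) u) = GM (Suc j) (EE (Suc j) u)"
      unfolding htp_def using face_D[OF _ SF(2), of "Suc j"] j by (simp only: D_S_eq)
    ultimately show ?thesis by (simp only: minus_diff_eq)
  qed
  \<comment> \<open>Here the face closes a sign filled by \<open>EE j\<close>, and the copy there
    collapses only modulo \<open>ml_ker\<close>.\<close>
  show "face (Suc (Suc n)) i (htp (Suc n) j u) - htp n (j - 1) (face (Suc n) i u) \<in> ml_ker (Suc n)"
    if ij: "i < j" "j \<le> Suc n" and u: "u \<in> tfree (Suc n)" for n i j u
  proof -
    interpret S: module_hom pscale pscale "S (j - 1)" by (rule S_hom)
    have SF: "S j (EE j u) \<in> tfree (Suc (Suc n))" by (rule S_F[OF ij(2) EE_F[OF ij(2) u]])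
    have "D i (EE j u) - EE (j - 1) (D i u) \<in> ml_ker n"
      using ij by (intro D_EE_gt[OF u]) auto
    then have "S (j - 1) (D i (EE j u) - EE (j - 1) (D i u)) \<in> ml_ker (Suc n)"
      using ij by (intro S_ml) auto
    moreover have "face (Suc (Suc n)) i (htp (Suc n) j u) = S (j - 1) (D i (EE j u))"
      unfolding htp_def using face_D[OF _ SF, of i] ij by (simp add: D_S_less)
    moreover have "htp n (j - 1) (face (Suc n) i u) = S (j - 1) (EE (j - 1) (D i u))"
      unfolding htp_def using face_D[OF _ u, of i] ij by simp
    ultimately show ?thesis by (simp only: S.diff)
  qed
  show "face (Suc (Suc n)) i (htp (Suc n) j u) - htp n j (face (Suc n) (i - 1) u) \<in> ml_ker (Suc n)"
    if ij: "Suc j < i" "i \<le> Suc (Suc n)" and u: "u \<in> tfree (Suc n)" for n i j u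
  proof -
    have EF: "EE j u \<in> tfree (Suc n)" using ij by (intro EE_F[OF _ u]) auto
    then have SF: "S j (EE j u) \<in> tfree (Suc (Suc n))" using ij by (intro S_F) auto
    \<comment> \<open>Such a face closes a sign without an inserted copy, hence an equation of
      formal combinations.\<close>
    have "face (Suc (Suc n)) i (htp (Suc n) j u) = htp n j (face (Suc n) (i - 1) u)"
    proof (cases "i = Suc (Suc n)")
      case True
      have "DL (S j (EE j u)) = S j (EE j (DL u))"
        using DL_S[OF _ EF, of j] DL_EE[OF u, of j] ij by simp
      then show ?thesis using True by (simp add: face_DL htp_def)
    next
      case False
      then have "face (Suc (Suc n)) i (S j (EE j u)) = D i (S j (EE j u))"
        "face (Suc n) (i - 1) u = D (i - 1) u"
        using face_D[OF _ SF, of i] face_D[OF _ u, of "i - 1"] ij by auto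
      moreover have "D i (S j (EE j u)) = S j (EE j (D (i - 1) u))"
        using ij by (simp add: D_S_gt D_EE_le)
      ultimately show ?thesis by (simp add: htp_def)
    qed
    then show ?thesis by (simp add: pm.span_zero)
  qed
qed (fact pm.vector_space_axioms subspace_keys ml_hoch_ker face_hom htp_hom sect_hom face_tfree sect_hoch_ker sect_id
    sect_face_ml[rotated])+

lemma presented_splitting:
  "presented_splitting pscale tfree ml_ker (hoch_ker B) face htp sect
    (hoch_Z sA B sM l r) (hoch_Z sA (ground sA) sM l r)
    (hoch_class sA B sM l r) (hoch_class sA (ground sA) sM l r)
    (hoch_face sA B sM l r) (hoch_face sA (ground sA) sM l r)"
proof -
  interpret splitting pscale tfree ml_ker "hoch_ker B" face htp sect by (rule splitting)
  show ?thesis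
  proof (intro presented_splitting.intro presented_splitting_axioms.intro splitting)
    show "presented pscale (hoch_Z sA B sM l r n) (tfree n) (hoch_ker B n) (hoch_class sA B sM l r n)" for n
      by (rule presented_hoch)
    show "presented pscale (hoch_Z sA (ground sA) sM l r n) (tfree n) (ml_ker n) (hoch_class sA (ground sA) sM l r n)" for n
      using presented_hoch[of "ground sA" n] unfolding hoch_ker_ground .
    show "hoch_face sA B sM l r (Suc n) i (hoch_class sA B sM l r (Suc n) u) =
        hoch_class sA B sM l r n (face (Suc n) i u)" if i: "i \<le> Suc n" and u: "u \<in> tfree (Suc n)" for n i u
    proof -
      have "lin_ext (face_gen l r (Suc n) i) v \<in> hoch_ker B n" if "v \<in> hoch_ker B (Suc n)" for v
        using NB_invariant[OF face_hom face_tfree[OF i] face_ml[OF i] sect_face_ml[OF _ i] _ that]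
        unfolding face_def hoch_ker_def by (simp only: pm.subspace_span)
      then show ?thesis
        unfolding hoch_face_def diff_Suc_1 face_def
        by (intro hoch_map_class face_tfree[OF i, unfolded face_def] u)
    qed
    show "hoch_face sA (ground sA) sM l r (Suc n) i (hoch_class sA (ground sA) sM l r (Suc n) u) =
        hoch_class sA (ground sA) sM l r n (face (Suc n) i u)" if i: "i \<le> Suc n" and u: "u \<in> tfree (Suc n)" for n i u
      unfolding hoch_face_def diff_Suc_1 face_def
      by (intro hoch_map_class face_tfree[OF i, unfolded face_def] u)
        (assumption, unfold hoch_ker_ground, rule face_ml[OF i, unfolded face_def])
  qed
qed

theorem vs_iso_HH: "vs_iso (HH sA B sM l r n) (HH sA (ground sA) sM l r n)"
  unfolding HH_def by (rule presented_splitting.vs_iso_hochschild[OF presented_splitting])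

end

lemma lin_ext_ident [simp]: "lin_ext (\<lambda>p. p) u = u"
proof -
  have "module_hom pscale pscale (\<lambda>u. u)" by unfold_locales simp_all
  then show ?thesis by (rule hom_eq[OF lin_ext_hom]) simp
qed

text \<open>On the flattened list \<open>a # as\<close>, \<open>t_gen\<close> is inverse to
  \<open>rotate1\<close>, and rotation by the full length is the identity.\<close>

lemma t_gen_funpow: "(t_gen ^^ Suc (length as)) (a, as) = (a, as)"
proof -
  define rot where "rot w = last w # butlast w" for w :: "'a list"
  define f where "f = (\<lambda>(a :: 'a, as). a # as)"
  have rot: "f (t_gen p) = rot (f p)" for p
    by (cases p) (auto simp: t_gen_def f_def rot_def)
  have f_pow: "f ((t_gen ^^ k) p) = (rot ^^ k) (f p)" for k p
    by (induction k) (simp_all add: rot)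
  have len: "length ((rot ^^ k) w) = length w" if "w \<noteq> []" for k w
    using that by (induction k) (auto simp: rot_def)
  have "rotate k ((rot ^^ k) w) = w" if "w \<noteq> []" for k w
  proof (induction k)
    case (Suc k)
    have "(rot ^^ k) w \<noteq> []" using len[OF that, of k] that by auto
    then have "rotate1 (rot ((rot ^^ k) w)) = (rot ^^ k) w" by (simp add: rot_def)
    then show ?case using Suc by (simp add: rotate_def funpow_swap1)
  qed simp
  from this[of "a # as" "length (a # as)"]
  have "(rot ^^ Suc (length as)) (a # as) = a # as"
    using rotate_id[of "Suc (length as)" "(rot ^^ Suc (length as)) (a # as)"] len[of "a # as" "Suc (length as)"]
    by simp
  then have "f ((t_gen ^^ Suc (length as)) (a, as)) = a # as"
    unfolding f_pow by (simp add: f_def)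
  then show ?thesis by (auto simp: f_def split: prod.splits)
qed

section \<open>Cyclic structure for \<open>M = A\<close>\<close>

locale algebra_separability = separability sA sA "(*)" "(*)" B J x y
  for sA :: "'k::field \<Rightarrow> 'a::{ring, monoid_mult} \<Rightarrow> 'a" and B :: "'a set" and J :: "'j set" and x y
begin

text \<open>The extra degeneracy, available because the coefficients are \<open>A\<close> itself:
  the old coefficient becomes the first list entry.\<close>

abbreviation cons_one :: "'a \<times> 'a list \<Rightarrow> 'a \<times> 'a list" where
  "cons_one \<equiv> \<lambda>(a, as). (1, a # as)"

definition T :: "nat \<Rightarrow> ('k, 'a, 'a) chains \<Rightarrow> ('k, 'a, 'a) chains" where "T n = lin_ext t_gen"
definition extra :: "nat \<Rightarrow> ('k, 'a, 'a) chains \<Rightarrow> ('k, 'a, 'a) chains" where "extra n = lin_ext cons_one"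

lemma multilinear_t_gen: "multilinear_op n n t_gen"
proof -
  have "slot_linear sA n (\<lambda>a. t_gen (a, as))" if "length as = n" for as
    using that slot_linear_A[OF hom_intros(2), of "[]" "butlast as" n "last as"]
    by (cases "as = []") (auto simp: t_gen_def intro!: slot_linear_M hom_intros)
  moreover have "slot_linear sA n (\<lambda>a. t_gen (m, us @ a # vs))" if "length us + 1 + length vs = n" for m us vs
    using that slot_linear_A[OF hom_intros(2), of "m # us" "butlast vs" n "last vs"]
    by (cases "vs = []") (auto simp: t_gen_def butlast_append intro!: slot_linear_M hom_intros)
  ultimately show ?thesis unfolding multilinear_op_def by blast
qed

lemma multilinear_cons_one: "multilinear_op n (Suc n) cons_one"
proof -
  have "slot_linear sA (Suc n) (\<lambda>a. cons_one (a, as))" if "length as = n" for as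
    using that slot_linear_A[OF hom_intros(2), of "[]" as "Suc n" 1] by simp
  moreover have "slot_linear sA (Suc n) (\<lambda>a. cons_one (m, us @ a # vs))" if "length us + 1 + length vs = n" for m us vs
    using that slot_linear_A[OF hom_intros(2), of "m # us" vs "Suc n" 1] by simp
  ultimately show ?thesis unfolding multilinear_op_def by blast
qed

text \<open>With the two lemmas that follow: rotation permutes the signs cyclically, sign
  \<open>i\<close> to \<open>Suc i\<close>, the last ordinary sign to the cyclic one, the cyclic one
  to sign \<open>0\<close>.\<close>

lemma t_gen_ins_at: "Suc i < length (snd p) \<Longrightarrow> t_gen (ins_at u v i p) = ins_at u v (Suc i) (t_gen p)"
proof (cases p; cases i)
  fix a as assume "p = (a, as)" "i = 0" "Suc i < length (snd p)"
  then show ?thesis by (cases as; cases "tl as") (auto simp: t_gen_def)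
next
  fix a as k assume *: "p = (a, as)" "i = Suc k" "Suc i < length (snd p)"
  then have "ins u v k as = ins u v k (butlast as) @ [last as]" by (simp add: last_butlast_ins)
  then show ?thesis using * by (auto simp: t_gen_def)
qed

lemma t_gen_ins_at_last: "length (snd p) = Suc n \<Longrightarrow> t_gen (ins_at u v n p) = ins_cyc (Suc n) u v (t_gen p)"
proof (cases p; cases n)
  fix a as assume "p = (a, as)" "n = 0" "length (snd p) = Suc n"
  then show ?thesis by (auto simp: t_gen_def ins_cyc_def length_Suc_conv)
next
  fix a as k assume "p = (a, as)" "n = Suc k" "length (snd p) = Suc n"
  moreover from this have "as \<noteq> []" by auto
  ultimately show ?thesis by (auto simp: t_gen_def ins_cyc_def ins_last)
qed

lemma t_gen_ins_cyc: "length (snd p) = Suc n \<Longrightarrow> t_gen (ins_cyc (Suc n) u v p) = ins_at u v 0 (t_gen p)"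
  by (cases p) (auto simp: t_gen_def ins_cyc_def rmul_last)

lemma face_at_0_t_gen: "length (snd p) = Suc n \<Longrightarrow> face_at 0 (t_gen p) = face_last p"
  by (cases p) (auto simp: t_gen_def)

lemma face_at_Suc_t_gen: "Suc i < length (snd p) \<Longrightarrow> face_at (Suc i) (t_gen p) = t_gen (face_at i p)"
proof (cases p; cases i)
  fix a as assume "p = (a, as)" "i = 0" "Suc i < length (snd p)"
  then show ?thesis by (cases as; cases "tl as") (auto simp: t_gen_def)
next
  fix a as k assume *: "p = (a, as)" "i = Suc k" "Suc i < length (snd p)"
  then have "merge k as = merge k (butlast as) @ [last as]" by (simp add: last_butlast_merge)
  then show ?thesis using * by (auto simp: t_gen_def)
qed

lemma face_last_t_gen: "length (snd p) = Suc n \<Longrightarrow> face_last (t_gen p) = t_gen (face_at n p)"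
proof (cases p; cases n)
  fix a as assume "p = (a, as)" "n = 0" "length (snd p) = Suc n"
  then show ?thesis by (auto simp: t_gen_def length_Suc_conv)
next
  fix a as k assume *: "p = (a, as)" "n = Suc k" "length (snd p) = Suc n"
  then have "merge k as = butlast (butlast as) @ [last (butlast as) * last as]" by (simp add: merge_last)
  moreover have "as \<noteq> []" "butlast as \<noteq> []" using * by (auto simp flip: length_greater_0_conv)
  ultimately show ?thesis using * by (auto simp: t_gen_def)
qed

lemma face_at_0_cons_one: "face_at 0 (cons_one p) = p"
  by (cases p) simp

lemma face_at_Suc_cons_one: "face_at (Suc i) (cons_one p) = cons_one (face_at i p)"
  by (cases p; cases i) auto

lemma T_hom: "module_hom pscale pscale (T n)" unfolding T_def by (rule lin_ext_hom)
lemma extra_hom: "module_hom pscale pscale (extra n)" unfolding extra_def by (rule lin_ext_hom)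
lemma T_F: "u \<in> tfree n \<Longrightarrow> T n u \<in> tfree n"
  unfolding T_def by (rule lin_ext_tfree[OF multilinear_t_gen])
lemma T_ml: "u \<in> ml_ker n \<Longrightarrow> T n u \<in> ml_ker n"
  unfolding T_def by (rule lin_ext_ml_ker[OF multilinear_t_gen])
lemma extra_F: "u \<in> tfree n \<Longrightarrow> extra n u \<in> tfree (Suc n)"
  unfolding extra_def by (rule lin_ext_tfree[OF multilinear_cons_one])
lemma extra_ml: "u \<in> ml_ker n \<Longrightarrow> extra n u \<in> ml_ker (Suc n)"
  unfolding extra_def by (rule lin_ext_ml_ker[OF multilinear_cons_one])

lemma lin_ext_lin_ext: "lin_ext g (lin_ext g' u) = lin_ext (\<lambda>p. g (g' p)) u"
  unfolding lin_ext_eq_op[of g'] lin_ext_op unfolding lin_ext_eq_op ..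

lemma T_E: "Suc i < n \<Longrightarrow> u \<in> tfree n \<Longrightarrow> T n (E i u) = E (Suc i) (T n u)"
  unfolding T_def E_def lin_ext_op op_lin_ext
  by (rule op_cong[of _ "tgens n"]) (auto simp: t_gen_ins_at)
lemma T_E_last: "u \<in> tfree (Suc n) \<Longrightarrow> T (Suc n) (E n u) = EL (Suc n) (T (Suc n) u)"
  unfolding T_def E_def EL_def lin_ext_op op_lin_ext
  by (rule op_cong[of _ "tgens (Suc n)"]) (auto simp: t_gen_ins_at_last)
lemma T_EL: "u \<in> tfree (Suc n) \<Longrightarrow> T (Suc n) (EL (Suc n) u) = E 0 (T (Suc n) u)"
  unfolding T_def E_def EL_def lin_ext_op op_lin_ext
  by (rule op_cong[of _ "tgens (Suc n)"]) (auto simp: t_gen_ins_cyc)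

text \<open>Insertions at the signs \<open>1, ..., k\<close>, which is where rotation carries the
  first \<open>k\<close> signs.\<close>

primrec FF :: "nat \<Rightarrow> ('k, 'a, 'a) chains \<Rightarrow> ('k, 'a, 'a) chains" where
  "FF 0 u = u"
| "FF (Suc k) u = E (Suc k) (FF k u)"

lemma FF_E: "FF k (E 0 u) = EE (Suc k) u"
  by (induction k) auto

lemma E_FF: "E 0 (FF k u) = FF k (E 0 u)"
  by (induction k) (simp_all add: E_commute[of 0])

lemma T_EE: "u \<in> tfree (Suc n) \<Longrightarrow> k \<le> n \<Longrightarrow> T (Suc n) (EE k u) = FF k (T (Suc n) u)"
proof (induction k)
  case (Suc k)
  have "EE k u \<in> tfree (Suc n)" by (rule EE_F) (use Suc in auto)
  then show ?case using Suc T_E[of k "Suc n" "EE k u"] by simp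
qed simp

text \<open>Rotation only permutes the set of all signs, and the insertions commute; so the equality
  holds even on formal combinations.\<close>

lemma T_sect:
  assumes u: "u \<in> tfree n"
  shows "T n (sect n u) = sect n (T n u)"
proof (cases n)
  case 0
  have "T 0 v = v" if "v \<in> tfree 0" for v
  proof -
    have "T 0 v = lin_ext (\<lambda>p. p) v"
      unfolding T_def by (rule lin_ext_cong[of "tgens 0"]) (use that in \<open>auto simp: t_gen_def\<close>)
    then show ?thesis by simp
  qed
  then show ?thesis using 0 u EL_F[of u 0] by (simp add: sect_def)
next
  case (Suc m)
  then have u: "u \<in> tfree (Suc m)" using u by simp
  have v: "EE m u \<in> tfree (Suc m)" by (rule EE_F[OF _ u]) simp
  then have w: "E m (EE m u) \<in> tfree (Suc m)" by (intro E_F) auto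
  have "T (Suc m) (sect (Suc m) u) = E 0 (EL (Suc m) (FF m (T (Suc m) u)))"
    using T_EL[OF w] T_E_last[OF v] T_EE[OF u order_refl] by (simp add: sect_def)
  also have "\<dots> = EL (Suc m) (E 0 (FF m (T (Suc m) u)))"
    by (simp add: EL_E)
  also have "\<dots> = sect (Suc m) (T (Suc m) u)"
    unfolding E_FF FF_E sect_def ..
  finally show ?thesis using Suc by simp
qed

lemma T_pow: "u \<in> tfree n \<Longrightarrow> (T n ^^ Suc n) u = u"
proof -
  assume u: "u \<in> tfree n"
  have pow: "(T n ^^ k) v = lin_ext (t_gen ^^ k) v" for k v
  proof (induction k)
    case 0
    show ?case by (simp add: id_def)
  next
    case (Suc k)
    then show ?case by (simp add: T_def lin_ext_lin_ext o_def)
  qed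
  have "(T n ^^ Suc n) u = lin_ext (\<lambda>p. p) u"
    unfolding pow
  proof (rule lin_ext_cong[of "tgens n"])
    fix p :: "'a \<times> 'a list" assume "p \<in> tgens n"
    then show "(t_gen ^^ Suc n) p = p" using t_gen_funpow[of "snd p" "fst p"] by simp
  qed (use u in simp)
  then show ?thesis by simp
qed

lemma cyclic_splitting: "cyclic_splitting pscale tfree ml_ker (hoch_ker B) face htp sect T extra"
proof (intro cyclic_splitting.intro cyclic_splitting_axioms.intro splitting)
  show "sect n (T n u) - T n (sect n u) \<in> ml_ker n" if "u \<in> tfree n" for n u
    using T_sect[OF that] by (simp add: pm.span_zero)
  show "face (Suc n) 0 (T (Suc n) u) = face (Suc n) (Suc n) u" if u: "u \<in> tfree (Suc n)" for n u
    unfolding face_D[OF le0 T_F[OF u]] face_DL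
    unfolding D_def DL_def T_def lin_ext_lin_ext
    by (rule lin_ext_cong[of "tgens (Suc n)"]) (use u in \<open>auto simp: face_at_0_t_gen simp del: face_last.simps face_at.simps\<close>)
  show "face (Suc n) (Suc i) (T (Suc n) u) = T n (face (Suc n) i u)"
    if i: "i \<le> n" and u: "u \<in> tfree (Suc n)" for n i u
  proof (cases "i = n")
    case True
    have "lin_ext (\<lambda>p. face_last (t_gen p)) u = lin_ext (\<lambda>p. t_gen (face_at n p)) u"
      by (rule lin_ext_cong[of "tgens (Suc n)"]) (use u in \<open>auto simp: face_last_t_gen simp del: face_last.simps\<close>)
    then show ?thesis
      using True face_D[OF order_refl u] by (simp add: face_DL D_def DL_def T_def lin_ext_lin_ext)
  next
    case False
    then have "lin_ext (\<lambda>p. face_at (Suc i) (t_gen p)) u = lin_ext (\<lambda>p. t_gen (face_at i p)) u"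
      using i by (intro lin_ext_cong[of "tgens (Suc n)"]) (use u in \<open>auto simp: face_at_Suc_t_gen simp del: face_at.simps\<close>)
    then show ?thesis
      using False i face_D[OF _ u, of i] face_D[OF _ T_F[OF u], of "Suc i"]
      by (simp add: D_def T_def lin_ext_lin_ext)
  qed
  show "face (Suc n) 0 (extra n u) = u" if u: "u \<in> tfree n" for n u
    unfolding face_D[OF le0 extra_F[OF u]]
    unfolding D_def extra_def lin_ext_lin_ext face_at_0_cons_one by (rule lin_ext_ident)
  show "face (Suc (Suc n)) (Suc i) (extra (Suc n) u) = extra n (face (Suc n) i u)"
    if i: "i \<le> n" and u: "u \<in> tfree (Suc n)" for n i u
  proof -
    have "face (Suc (Suc n)) (Suc i) (extra (Suc n) u) = D (Suc i) (extra (Suc n) u)"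
      using i by (intro face_D extra_F u) simp
    then show ?thesis
      unfolding face_D[OF i u]
      by (simp only: D_def extra_def lin_ext_lin_ext face_at_Suc_cons_one)
  qed
qed (fact T_hom extra_hom T_F T_ml T_pow extra_F extra_ml)+

lemma presented_cyclic_splitting:
  "presented_cyclic_splitting pscale tfree ml_ker (hoch_ker B) face htp sect T extra
    (hoch_Z sA B sA (*) (*)) (hoch_Z sA (ground sA) sA (*) (*))
    (hoch_class sA B sA (*) (*)) (hoch_class sA (ground sA) sA (*) (*))
    (hoch_face sA B sA (*) (*)) (hoch_face sA (ground sA) sA (*) (*))
    (\<lambda>n. hoch_map sA B sA (*) (*) n t_gen) (\<lambda>n. hoch_map sA (ground sA) sA (*) (*) n t_gen)"
proof (intro presented_cyclic_splitting.intro presented_cyclic_splitting_axioms.intro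
    presented_splitting cyclic_splitting)
  interpret C: cyclic_splitting pscale tfree ml_ker "hoch_ker B" face htp sect T extra by (rule cyclic_splitting)
  show "hoch_map sA B sA (*) (*) n t_gen (hoch_class sA B sA (*) (*) n u) = hoch_class sA B sA (*) (*) n (T n u)"
    if u: "u \<in> tfree n" for n u
  proof -
    have "lin_ext t_gen v \<in> hoch_ker B n" if "v \<in> hoch_ker B n" for v
      using C.NB_invariant[OF T_hom T_F T_ml C.\<sigma>_t _ that]
      unfolding T_def hoch_ker_def by (simp only: pm.subspace_span)
    then show ?thesis
      unfolding T_def by (intro hoch_map_class T_F[unfolded T_def] u)
  qed
  show "hoch_map sA (ground sA) sA (*) (*) n t_gen (hoch_class sA (ground sA) sA (*) (*) n u) =
      hoch_class sA (ground sA) sA (*) (*) n (T n u)"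
    if u: "u \<in> tfree n" for n u
    unfolding T_def by (intro hoch_map_class T_F[unfolded T_def] u)
      (assumption, unfold hoch_ker_ground, rule T_ml[unfolded T_def])
qed

theorem vs_iso_HC: "vs_iso (HC sA B n) (HC sA (ground sA) n)"
  unfolding HC_def by (rule presented_cyclic_splitting.vs_iso_cyclic[OF presented_cyclic_splitting])

end

text \<open>The idempotent is \<open>s 1\<close>: bilinearity gives
  \<open>b (s 1) = s b = (s 1) b\<close>, and a section of the multiplication sends \<open>1\<close>
  to an element of product \<open>1\<close>.\<close>

lemma separable_idempotent:
  fixes sA :: "'k::field \<Rightarrow> 'a::{ring, monoid_mult} \<Rightarrow> 'a"
  assumes "k_algebra sA" and sub: "subalgebra sA B" and sep: "separable sA B"
  obtains J :: "('a \<times> 'a list) set" and x y where "finite J" "\<And>j. j \<in> J \<Longrightarrow> y j \<in> B"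
    "(\<Sum>j\<in>J. x j * y j) = 1"
    "\<And>b. b \<in> B \<Longrightarrow> (\<Sum>j\<in>J. pure (b * x j) [y j]) - (\<Sum>j\<in>J. pure (x j) [y j * b]) \<in>
      pm.span (tens_rels sA sA (*) UNIV UNIV {} 1)"
proof -
  interpret k_algebra sA by fact
  interpret A: k_bimodule sA sA "(*)" "(*)" by (rule k_bimodule_self)
  let ?BB = "tens sA sA (*) B B (ground sA) 1" and ?c = "tens_class sA sA (*) B B (ground sA) 1"
  have B: "subspace B" "1 \<in> B" "\<And>a b. a \<in> B \<Longrightarrow> b \<in> B \<Longrightarrow> a * b \<in> B"
    using sub by (auto simp: subalgebra_def)
  interpret T: tens_bimodule sA sA "(*)" "(*)" B B "ground sA"
    by unfold_locales (use B in \<open>auto simp: ground_def subspace_scale\<close>)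
  obtain s where s: "s \<in> B \<rightarrow> vcarrier ?BB"
    "\<And>b z. b \<in> B \<Longrightarrow> z \<in> B \<Longrightarrow> s (b * z) = tens_lact sA sA (*) (*) B B (ground sA) 1 b (s z)"
    "\<And>b z. b \<in> B \<Longrightarrow> z \<in> B \<Longrightarrow> s (z * b) = tens_ract sA sA (*) B B (ground sA) 1 (s z) b"
    "\<And>z. z \<in> B \<Longrightarrow> sep_mult sA (s z) = z"
    using sep unfolding separable_def Let_def by blast
  \<comment> \<open>The support of a representative \<open>w\<close> of \<open>s 1\<close> becomes
    the index set. Its coefficients are absorbed into the left factors, as the idempotent is to be a
    plain sum of pairs.\<close>
  obtain w where w: "s 1 = ?c w" "w \<in> T.F 1"
    using funcset_mem[OF s(1) B(2)] unfolding T.carrier[of 1] by (rule imageE)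
  define x where "x p = sA (lookup w p) (fst p)" for p :: "'a \<times> 'a list"
  define y where "y p = hd (snd p)" for p :: "'a \<times> 'a list"
  have keys: "fst p \<in> B" "snd p = [y p]" "y p \<in> B" if "p \<in> keys w" for p
  proof -
    have "p \<in> tens_gens B B 1" using subsetD[OF CollectD[OF w(2)] that] .
    then have "fst p \<in> B \<and> snd p = [y p] \<and> y p \<in> B"
      by (cases p) (auto simp: tens_gens_def y_def length_Suc_conv)
    then show "fst p \<in> B" "snd p = [y p]" "y p \<in> B" by simp_all
  qed
  \<comment> \<open>\<open>sep_mult\<close> on representatives. It vanishes on the relations, so its
    value on the class of \<open>w\<close> is \<open>\<mu> w\<close>.\<close>
  define \<mu> where "\<mu> = lsum sA (\<lambda>(a, as). a * prod_list as)"
  have \<mu>_hom: "module_hom pscale sA \<mu>" unfolding \<mu>_def by (rule lsum_hom) unfold_locales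
  have \<mu>_single: "\<mu> (single (a, as) c) = sA c (a * prod_list as)" for a as c
    unfolding \<mu>_def by (subst lsum_single) (unfold_locales, simp)
  interpret \<mu>: module_hom pscale sA \<mu> by (rule \<mu>_hom)
  have \<mu>_ker: "\<mu> z = 0" if "z \<in> tens_ker sA sA (*) B B (ground sA) 1" for z
  proof -
    have "\<mu> u \<in> {0}" if "u \<in> tens_rels sA sA (*) B B (ground sA) 1" for u
      using that
      by (cases rule: tens_rels_cases)
        (auto simp: \<mu>.diff \<mu>_single distrib_left distrib_right mult.assoc scale_mult_left scale_mult_right)
    then show ?thesis
      using module_hom_span_mem[OF \<mu>_hom subspace_single_0 _ that[unfolded T.tens_ker_span]] by blast
  qed
  have "the_elem (\<mu> ` ?c w) = \<mu> w"
  proof (rule T.the_elem_tens_class[OF w(2)])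
    show "\<mu> z = \<mu> w" if "z - w \<in> tens_ker sA sA (*) B B (ground sA) 1" for z
      using \<mu>_ker[OF that] by (simp add: \<mu>.diff)
  qed
  then have "sep_mult sA (?c w) = \<mu> w"
    unfolding sep_mult_def \<mu>_def lsum_def by (simp only: split_def prod.collapse)
  then have "\<mu> w = 1" using s(4)[OF B(2)] w(1) by simp
  then have one: "(\<Sum>p\<in>keys w. x p * y p) = 1"
    using keys unfolding \<mu>_def lsum_def x_def
    by (simp add: split_def scale_mult_left cong: sum.cong)
  have comm: "(\<Sum>p\<in>keys w. pure (b * x p) [y p]) - (\<Sum>p\<in>keys w. pure (x p) [y p * b])
      \<in> A.ml_ker 1" if b: "b \<in> B" for b
  proof -
    let ?L = "lin_ext (lact_gen (*) b)" and ?R = "lin_ext (ract_gen (*) b)"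
    have "?c (?L w) = ?c (?R w)"
      using s(2)[OF b B(2)] s(3)[OF b B(2)] T.tens_lact_class[OF b w(2)] T.tens_ract_class[OF b w(2)] w(1)
      by simp
    moreover have "?L w \<in> T.F 1" "?R w \<in> T.F 1"
      using T.lact_keys[OF b] T.ract_keys[OF b] w(2) by simp_all
    ultimately have "?L w - ?R w \<in> tens_ker sA sA (*) B B (ground sA) 1"
      using T.cls[of "?L w" 1 "?R w"] by simp
    \<comment> \<open>Passage from \<open>B \<otimes> B\<close> to \<open>A \<otimes> A\<close>: the
      relations are among those for \<open>A\<close>, and balancing over scalars reduces to
      multilinearity.\<close>
    also have "\<dots> \<subseteq> A.hoch_ker (ground sA) 1"
      unfolding T.tens_ker_span A.hoch_ker_def
      by (rule pm.span_mono) (use tens_rels_subset[of B UNIV B UNIV] in blast)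
    finally have LR: "?L w - ?R w \<in> A.ml_ker 1" unfolding A.hoch_ker_ground .
    \<comment> \<open>\<open>?L w\<close> and \<open>?R w\<close> keep the coefficients as scalars,
      the sums over \<open>x\<close> and \<open>y\<close> keep them in the left entry; the scaling
      relation bridges the two.\<close>
    have "?L w = (\<Sum>p\<in>keys w. single (b * fst p, [y p]) (lookup w p))"
      unfolding lin_ext_def by (rule sum.cong[OF refl]) (use keys(2) in \<open>simp add: split_def\<close>)
    then have "(\<Sum>p\<in>keys w. pure (b * x p) [y p]) - ?L w \<in> A.ml_ker 1"
      using A.ml_ker_intros(2)[of "[y _]" 1]
      by (simp add: x_def scale_mult_right sum_subtractf[symmetric] pm.span_sum)
    moreover have "?R w = (\<Sum>p\<in>keys w. single (fst p, [y p * b]) (lookup w p))"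
      unfolding lin_ext_def by (rule sum.cong[OF refl]) (use keys(2) in \<open>simp add: split_def\<close>)
    then have "(\<Sum>p\<in>keys w. pure (x p) [y p * b]) - ?R w \<in> A.ml_ker 1"
      using A.ml_ker_intros(2)[of "[y _ * b]" 1]
      by (simp add: x_def sum_subtractf[symmetric] pm.span_sum)
    ultimately have "((\<Sum>p\<in>keys w. pure (b * x p) [y p]) - ?L w) -
        ((\<Sum>p\<in>keys w. pure (x p) [y p * b]) - ?R w) + (?L w - ?R w) \<in> A.ml_ker 1"
      by (intro pm.span_add[OF pm.span_diff LR])
    then show ?thesis by simp
  qed
  show thesis by (rule that[of "keys w" y x, OF finite_keys keys(3) one comm])
qed

theorem corollary1p14:
  fixes sA :: "'k::field \<Rightarrow> 'a::{ring, monoid_mult} \<Rightarrow> 'a" and B :: "'a set"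
  assumes "k_algebra sA" and "subalgebra sA B" and "separable sA B"
  shows "(\<forall>(sM :: 'k \<Rightarrow> 'm::ab_group_add \<Rightarrow> 'm) l r. k_bimodule sA sM l r \<longrightarrow>
            (\<forall>n. vs_iso (HH sA B sM l r n) (HH sA (ground sA) sM l r n))) \<and>
         (\<forall>n. vs_iso (HC sA B n) (HC sA (ground sA) n))"
proof -
  obtain J :: "('a \<times> 'a list) set" and x y where e: "finite J" "\<And>j. j \<in> J \<Longrightarrow> y j \<in> B"
    "(\<Sum>j\<in>J. x j * y j) = 1"
    "\<And>b. b \<in> B \<Longrightarrow> (\<Sum>j\<in>J. pure (b * x j) [y j]) - (\<Sum>j\<in>J. pure (x j) [y j * b]) \<in>
      pm.span (tens_rels sA sA (*) UNIV UNIV {} 1)"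
    by (rule separable_idempotent[OF assms]) blast
  have M: "separability sA sM l r B J x y" if "k_bimodule sA sM l r"
    for sM :: "'k \<Rightarrow> 'm \<Rightarrow> 'm" and l r
    using that e by (intro separability.intro separability_axioms.intro)
  have A: "algebra_separability sA B J x y"
    using k_algebra.k_bimodule_self[OF assms(1)] e
    by (intro algebra_separability.intro separability.intro separability_axioms.intro)
  show ?thesis
    by (intro conjI allI impI)
      (rule separability.vs_iso_HH[OF M], assumption, rule algebra_separability.vs_iso_HC[OF A])
qed

end
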